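(* Let $1<q<p<N$, $N\ge 2$, $p^\ast=Np/(N-p)$, and let $\Omega\subset\mathbb{R}^N$ be a bounded star-shaped domain with $C^1$ boundary. If $$\mu\le\frac{N(p-q)}{N(p-q)+pq}\,\mu_1,$$ then the problem $$-\Delta_p u-\Delta_q u=\mu|u|^{q-2}u+|u|^{p^\ast-2}u\text{ in }\Omega,\qquad u=0\text{ on }\partial\Omega$$ has no nontrivial weak solution in $W^{1,p}_0(\Omega)\cap W^{2,p}(\Omega)$.
   Context: $\Delta_r u=\operatorname{div}(|\nabla u|^{r-2}\nabla u)$. $\mu_1=\inf_{u\in W^{1,q}_0(\Omega)\setminus\{0\}}\int_\Omega|\nabla u|^q/\int_\Omega|u|^q$ is the first Dirichlet eigenvalue of the $q$-Laplacian. A weak solution is a $u\in W^{1,p}_0(\Omega)$ with $\int_\Omega\big(|\nabla u|^{p-2}\nabla u\cdot\nabla v+|\nabla u|^{q-2}\nabla u\cdot\nabla v-\mu|u|^{q-2}uv-|u|^{p^\ast-2}uv\big)dx=0$ for all $v\in W^{1,p}_0(\Omega)$. *)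

theory Defs
  imports "HOL-Analysis.Analysis"
begin

text \<open>Smooth (C-infinity) real functions on a Euclidean space: all iterated partial
  derivatives (along basis vectors) exist everywhere.  D es is the iterated partial
  derivative along the directions in the list es.\<close>
definition Cinf :: "('a::euclidean_space \<Rightarrow> real) \<Rightarrow> bool" where
  "Cinf f \<longleftrightarrow> (\<exists>D :: 'a list \<Rightarrow> 'a \<Rightarrow> real. D [] = f \<and>
     (\<forall>es x. (D es has_derivative (\<lambda>h. \<Sum>i\<in>Basis. (h \<bullet> i) * D (i # es) x)) (at x)))"

definition test_fun :: "'a::euclidean_space set \<Rightarrow> ('a \<Rightarrow> real) \<Rightarrow> bool" where
  "test_fun \<Omega> \<phi> \<longleftrightarrow> Cinf \<phi> \<and> compact (closure {x. \<phi> x \<noteq> 0}) \<and> closure {x. \<phi> x \<noteq> 0} \<subseteq> \<Omega>"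

definition is_grad :: "('a::euclidean_space \<Rightarrow> real) \<Rightarrow> ('a \<Rightarrow> 'a) \<Rightarrow> bool" where
  "is_grad \<phi> g \<longleftrightarrow> (\<forall>x. (\<phi> has_derivative (\<lambda>h. g x \<bullet> h)) (at x))"

definition weak_grad :: "'a::euclidean_space set \<Rightarrow> ('a \<Rightarrow> real) \<Rightarrow> ('a \<Rightarrow> 'a) \<Rightarrow> bool" where
  "weak_grad \<Omega> u G \<longleftrightarrow> (\<forall>\<phi> g i. test_fun \<Omega> \<phi> \<and> is_grad \<phi> g \<and> i \<in> Basis \<longrightarrow>
      set_integrable lebesgue \<Omega> (\<lambda>x. u x * (g x \<bullet> i)) \<and>
      set_integrable lebesgue \<Omega> (\<lambda>x. (G x \<bullet> i) * \<phi> x) \<and>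
      (LINT x:\<Omega>|lebesgue. u x * (g x \<bullet> i)) = - (LINT x:\<Omega>|lebesgue. (G x \<bullet> i) * \<phi> x))"

definition Lp :: "'a::euclidean_space set \<Rightarrow> real \<Rightarrow> ('a \<Rightarrow> real) \<Rightarrow> bool" where
  "Lp \<Omega> p u \<longleftrightarrow> u \<in> borel_measurable (lebesgue_on \<Omega>) \<and>
     set_integrable lebesgue \<Omega> (\<lambda>x. \<bar>u x\<bar> powr p)"

definition Lp_vec :: "'a::euclidean_space set \<Rightarrow> real \<Rightarrow> ('a \<Rightarrow> 'a) \<Rightarrow> bool" where
  "Lp_vec \<Omega> p G \<longleftrightarrow> G \<in> borel_measurable (lebesgue_on \<Omega>) \<and>
     set_integrable lebesgue \<Omega> (\<lambda>x. norm (G x) powr p)"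

definition W1p :: "'a::euclidean_space set \<Rightarrow> real \<Rightarrow> ('a \<Rightarrow> real) \<Rightarrow> ('a \<Rightarrow> 'a) \<Rightarrow> bool" where
  "W1p \<Omega> p u G \<longleftrightarrow> Lp \<Omega> p u \<and> Lp_vec \<Omega> p G \<and> weak_grad \<Omega> u G"

definition W1p0 :: "'a::euclidean_space set \<Rightarrow> real \<Rightarrow> ('a \<Rightarrow> real) \<Rightarrow> ('a \<Rightarrow> 'a) \<Rightarrow> bool" where
  "W1p0 \<Omega> p u G \<longleftrightarrow> W1p \<Omega> p u G \<and>
     (\<exists>\<phi>s gs. (\<forall>k. test_fun \<Omega> (\<phi>s k) \<and> is_grad (\<phi>s k) (gs k)) \<and>
        (\<lambda>k. LINT x:\<Omega>|lebesgue. \<bar>\<phi>s k x - u x\<bar> powr p) \<longlonglongrightarrow> 0 \<and>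
        (\<lambda>k. LINT x:\<Omega>|lebesgue. norm (gs k x - G x) powr p) \<longlonglongrightarrow> 0)"

definition W2p :: "'a::euclidean_space set \<Rightarrow> real \<Rightarrow> ('a \<Rightarrow> real) \<Rightarrow> bool" where
  "W2p \<Omega> p u \<longleftrightarrow> (\<exists>G. W1p \<Omega> p u G \<and> (\<forall>i\<in>Basis. \<exists>H. W1p \<Omega> p (\<lambda>x. G x \<bullet> i) H))"

definition nontrivial :: "'a::euclidean_space set \<Rightarrow> ('a \<Rightarrow> real) \<Rightarrow> bool" where
  "nontrivial \<Omega> u \<longleftrightarrow> \<not> (AE x in lebesgue. x \<in> \<Omega> \<longrightarrow> u x = 0)"

text \<open>First Dirichlet eigenvalue of the q-Laplacian.\<close>
definition mu1 :: "'a::euclidean_space set \<Rightarrow> real \<Rightarrow> real" where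
  "mu1 \<Omega> q = Inf {(LINT x:\<Omega>|lebesgue. norm (G x) powr q) / (LINT x:\<Omega>|lebesgue. \<bar>u x\<bar> powr q)
      | u G. W1p0 \<Omega> q u G \<and> nontrivial \<Omega> u}"

definition pstar :: "real \<Rightarrow> real \<Rightarrow> real" where
  "pstar N p = N * p / (N - p)"

definition weak_solution :: "'a::euclidean_space set \<Rightarrow> real \<Rightarrow> real \<Rightarrow> real \<Rightarrow> ('a \<Rightarrow> real) \<Rightarrow> bool" where
  "weak_solution \<Omega> p q \<mu> u \<longleftrightarrow> (\<exists>G. W1p0 \<Omega> p u G \<and>
     (\<forall>v H. W1p0 \<Omega> p v H \<longrightarrow>
        (LINT x:\<Omega>|lebesgue.
            norm (G x) powr (p - 2) * (G x \<bullet> H x) + norm (G x) powr (q - 2) * (G x \<bullet> H x)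
          - \<mu> * (\<bar>u x\<bar> powr (q - 2) * u x * v x)
          - \<bar>u x\<bar> powr (pstar (real DIM('a)) p - 2) * u x * v x) = 0))"

definition C1_boundary :: "'a::euclidean_space set \<Rightarrow> bool" where
  "C1_boundary \<Omega> \<longleftrightarrow> (\<forall>x0\<in>frontier \<Omega>. \<exists>r>0. \<exists>\<rho> g.
      (\<forall>x\<in>ball x0 r. (\<rho> has_derivative (\<lambda>h. g x \<bullet> h)) (at x) \<and> g x \<noteq> 0) \<and>
      continuous_on (ball x0 r) g \<and>
      \<Omega> \<inter> ball x0 r = {x\<in>ball x0 r. \<rho> x < 0})"

end

theory Submission
  imports Defs "HOL-Probability.Probability"
begin

text \<open>
  The Pohozaev inequality is obtained without boundary terms and without second derivatives. Let
  \<open>\<Omega>\<close> be star-shaped about \<open>a\<close> and put \<open>u\<^sub>l(x) = u(a + l(x - a))\<close>. For \<open>l > 1\<close> this function is again in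
  \<open>W\<^sub>0\<^sup>1\<^sup>,\<^sup>p(\<Omega>)\<close>, so \<open>u\<^sub>l - u\<close> is an admissible test function. Convexity bounds the gradient terms of the
  weak equation by the explicit increments of the energies under scaling, and dividing by \<open>l - 1 \<rightarrow> 0\<close>
  gives the inequality. The limit of the critical term needs \<open>\<bar>u\<bar>\<^sup>P\<^sup>-\<^sup>1\<close> in the dual of \<open>L\<^sup>p\<close>, which
  a Brezis--Kato argument provides.

  Combined with the energy identity, the Pohozaev inequality and the bound on \<open>\<mu>\<close> force equality: \<open>u\<close> is a
  minimizer of the Rayleigh quotient of the \<open>q\<close>-Laplacian. Its Euler--Lagrange equation removes the
  \<open>q\<close>-Laplacian from the problem, and the Pohozaev inequality for the remaining \<open>p\<close>-Laplacian problem
  is contradictory because \<open>q < p\<close>.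
\<close>

section \<open>Gagliardo's inequality for line integrals\<close>

text \<open>Classically Pohozaev's identity comes from testing with (x - a) . grad u, which need not
  vanish on the boundary. The quotient (u_l - u)/(l - 1) replaces it, and admissibility for l > 1
  only is why one-sided estimates survive. These quotients are bounded in L^p, while Sobolev's
  inequality places |u|^{P-1} only in L^{P/(P-1)}, and P/(P-1) < p/(p-1); this gap is what makes the
  critical term delicate. The threshold has a simple origin. Let A, B be the integrals of |grad
  u|^p, |grad u|^q, let C, D be those of |u|^q, |u|^P, and k = N(p-q). Eliminating D between the
  Pohozaev inequality and the energy identity also cancels A and leaves k B \<le> \<mu> (k + p q) C.
  Together with \<open>mu1\<close> C \<le> B this excludes \<mu> (k + p q) < k \<open>mu1\<close> at
  once. At the threshold itself all inequalities become equalities without contradiction, since no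
  boundary integral is kept that could decide the case; this is what forces the second Pohozaev
  inequality.\<close>

lemma weighted_arith_geom_mean:
  fixes y a :: "'i \<Rightarrow> real"
  assumes fin: "finite J" and a: "\<And>j. j \<in> J \<Longrightarrow> 0 \<le> a j" "sum a J = 1"
    and y: "\<And>j. j \<in> J \<Longrightarrow> 0 < y j"
  shows "(\<Prod>j\<in>J. y j powr a j) \<le> (\<Sum>j\<in>J. a j * y j)"
proof -
  have ne: "J \<noteq> {}" using a(2) by auto
  have pos: "0 < (\<Sum>j\<in>J. a j * y j)"
  proof -
    obtain j where "j \<in> J" "a j > 0"
      using a by (metis less_eq_real_def order_less_irrefl sum.neutral zero_neq_one)
    then show ?thesis using fin a y by (intro sum_pos2[of J j]) (auto simp: less_imp_le)
  qed
  have "(\<Sum>j\<in>J. a j * ln (y j)) \<le> ln (\<Sum>j\<in>J. a j *\<^sub>R y j)"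
    using concave_on_sum[OF fin ne ln_concave a(2,1), of y] y by auto
  then have "exp (\<Sum>j\<in>J. a j * ln (y j)) \<le> (\<Sum>j\<in>J. a j * y j)"
    using pos by (simp add: ln_ge_iff)
  moreover have "exp (\<Sum>j\<in>J. a j * ln (y j)) = (\<Prod>j\<in>J. y j powr a j)"
    using y fin by (subst exp_sum) (auto simp: powr_def intro!: prod.cong, force)
  ultimately show ?thesis by simp
qed

lemma (in prob_space) expectation_bounds:
  fixes h :: "'a \<Rightarrow> real"
  assumes h: "h \<in> borel_measurable M" and b: "\<And>x. x \<in> space M \<Longrightarrow> \<epsilon> \<le> h x \<and> h x \<le> K"
  shows "integrable M h" "\<epsilon> \<le> (\<integral>x. h x \<partial>M)" "(\<integral>x. h x \<partial>M) \<le> K"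
proof -
  show i: "integrable M h"
    by (rule integrable_const_bound[where B="max \<bar>\<epsilon>\<bar> \<bar>K\<bar>"]) (use b h in \<open>auto intro!: AE_I2\<close>, force)
  show "\<epsilon> \<le> (\<integral>x. h x \<partial>M)" using b i by (intro integral_ge_const) (auto intro!: AE_I2)
  show "(\<integral>x. h x \<partial>M) \<le> K" using b i by (intro integral_le_const) (auto intro!: AE_I2)
qed

text \<open>Hoelder's inequality for many factors: the weighted arithmetic-geometric mean inequality
  is applied pointwise to each \<open>h j\<close> divided by its mean. The lower bound \<epsilon> >
  0 keeps the means positive, so that no degenerate cases arise, and K provides
  integrability.\<close>

lemma (in prob_space) expectation_prod_powr_le:
  fixes h :: "'i \<Rightarrow> 'a \<Rightarrow> real"
  assumes fin: "finite J" and a: "\<And>j. j \<in> J \<Longrightarrow> 0 \<le> a j" "sum a J = 1" and "0 < \<epsilon>"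
    and h[measurable]: "\<And>j. j \<in> J \<Longrightarrow> h j \<in> borel_measurable M"
    and b: "\<And>j x. j \<in> J \<Longrightarrow> x \<in> space M \<Longrightarrow> \<epsilon> \<le> h j x \<and> h j x \<le> K"
  shows "(\<integral>x. (\<Prod>j\<in>J. h j x powr a j) \<partial>M) \<le> (\<Prod>j\<in>J. (\<integral>x. h j x \<partial>M) powr a j)"
proof -
  define c where "c j = (\<integral>x. h j x \<partial>M)" for j
  have c: "j \<in> J \<Longrightarrow> c j \<ge> \<epsilon>" for j unfolding c_def using expectation_bounds(2)[OF h b] by auto
  have cp: "j \<in> J \<Longrightarrow> c j > 0" for j using c \<open>0<\<epsilon>\<close> by force
  have int: "j \<in> J \<Longrightarrow> integrable M (h j)" for j using expectation_bounds(1)[OF h b] by auto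
  have P: "0 < (\<Prod>j\<in>J. c j powr a j)" using cp by (force intro!: prod_pos)
  have "(\<integral>x. (\<Prod>j\<in>J. h j x powr a j) \<partial>M) \<le> (\<integral>x. (\<Prod>j\<in>J. c j powr a j) * (\<Sum>j\<in>J. a j * (h j x / c j)) \<partial>M)"
  proof (rule integral_mono_AE')
    show "integrable M (\<lambda>x. (\<Prod>j\<in>J. c j powr a j) * (\<Sum>j\<in>J. a j * (h j x / c j)))"
      using int by (auto intro!: integrable_sum)
    show "AE x in M. (\<Prod>j\<in>J. h j x powr a j) \<le> (\<Prod>j\<in>J. c j powr a j) * (\<Sum>j\<in>J. a j * (h j x / c j))"
    proof (rule AE_I2)
      fix x assume x: "x \<in> space M"
      have hp: "j \<in> J \<Longrightarrow> h j x > 0" for j using b[OF _ x, of j] \<open>0<\<epsilon>\<close> by auto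
      have "(\<Prod>j\<in>J. (h j x / c j) powr a j) \<le> (\<Sum>j\<in>J. a j * (h j x / c j))"
        using cp hp by (intro weighted_arith_geom_mean fin a) auto
      moreover have "(\<Prod>j\<in>J. (h j x / c j) powr a j) = (\<Prod>j\<in>J. h j x powr a j) / (\<Prod>j\<in>J. c j powr a j)"
        using cp hp by (subst prod_dividef[symmetric]) (auto intro!: prod.cong simp: powr_divide less_imp_le)
      ultimately show "(\<Prod>j\<in>J. h j x powr a j) \<le> (\<Prod>j\<in>J. c j powr a j) * (\<Sum>j\<in>J. a j * (h j x / c j))"
        using P by (simp add: field_simps)
    qed
    show "AE x in M. 0 \<le> (\<Prod>j\<in>J. c j powr a j) * (\<Sum>j\<in>J. a j * (h j x / c j))"
      using P b cp a \<open>0<\<epsilon>\<close> by (intro AE_I2 mult_nonneg_nonneg sum_nonneg divide_nonneg_nonneg) (force simp: less_imp_le)+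
  qed
  also have "\<dots> = (\<Prod>j\<in>J. c j powr a j) * (\<Sum>j\<in>J. a j * (c j / c j))"
    using int by (simp add: c_def[symmetric] Bochner_Integration.integral_sum del: div_self divide_self_if)
  also have "(\<Sum>j\<in>J. a j * (c j / c j)) = 1"
    using cp a(2) by (metis (no_types, lifting) div_self less_irrefl mult.right_neutral sum.cong)
  finally show ?thesis by (simp add: c_def)
qed

text \<open>Following van Doorn and Macbeth, the powers of \<open>f\<close> and of its line integrals are balanced
  so that integrating out one coordinate reproduces the statement for the partial integral of
  \<open>f\<close>; the case \<open>(card I - 1) * \<theta> = 1\<close> is the Gagliardo--Nirenberg--Sobolev one.\<close>
lemma (in product_prob_space) gagliardo_line_integrals:
  fixes f :: "('i \<Rightarrow> 'a) \<Rightarrow> real"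
  assumes "finite I" "0 \<le> \<theta>" "(real (card I) - 1) * \<theta> \<le> 1" "0 < \<epsilon>"
    and "f \<in> borel_measurable (PiM I M)"
    and "\<And>x. x \<in> space (PiM I M) \<Longrightarrow> \<epsilon> \<le> f x \<and> f x \<le> K"
  shows "(\<integral>x. f x powr (1 - (real (card I) - 1) * \<theta>) * (\<Prod>i\<in>I. (\<integral>t. f (x(i:=t)) \<partial>M i) powr \<theta>) \<partial>PiM I M)
       \<le> (\<integral>x. f x \<partial>PiM I M) powr (1 + \<theta>)"
  using assms
proof (induction I arbitrary: f rule: finite_induct)
  case empty
  then show ?case by (simp add: PiM_empty lebesgue_integral_count_space_finite)
next
  case (insert i I f)
  note f[measurable] = insert.prems(4) and fb = insert.prems(5)
  have fi: "finite I" by fact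
  interpret FI: finite_product_prob_space M I by standard fact
  interpret FiI: finite_product_prob_space M "insert i I" by standard (use fi in auto)
  have card: "real (card (insert i I)) - 1 = real (card I)" using insert.hyps by simp
  define g where "g x = (\<integral>t. f (x(i:=t)) \<partial>M i)" for x
  have upd[measurable]: "(\<lambda>(x,t). f (x(i:=t))) \<in> borel_measurable (PiM I M \<Otimes>\<^sub>M M i)"
    by measurable
  have g_meas[measurable]: "g \<in> borel_measurable (PiM I M)"
    unfolding g_def by measurable
  have sp: "x(i:=t) \<in> space (PiM (insert i I) M)" if "x \<in> space (PiM I M)" "t \<in> space (M i)" for x t
    using that by (auto simp: space_PiM PiE_def extensional_def)
  have fm: "(\<lambda>t. f (x(i:=t))) \<in> borel_measurable (M i)" if "x \<in> space (PiM I M)" for x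
    using upd that by (auto intro: measurable_Pair2)
  have gb: "\<epsilon> \<le> g x \<and> g x \<le> K" if "x \<in> space (PiM I M)" for x
    unfolding g_def using prob_space.expectation_bounds(2,3)[OF prob_space fm[OF that], of \<epsilon> K] fb sp that by blast
  define L where "L j x = (\<integral>s. f (x(j:=s)) \<partial>M j)" for j x
  have updj: "(\<lambda>(x,s). f (x(j:=s))) \<in> borel_measurable (PiM (insert i I) M \<Otimes>\<^sub>M M j)" if "j \<in> insert i I" for j
  proof -
    have [measurable]: "(\<lambda>p. (fst p)(j := snd p)) \<in> PiM (insert i I) M \<Otimes>\<^sub>M M j \<rightarrow>\<^sub>M PiM (insert i I) M"
      by (rule measurable_fun_upd[where J="insert i I"]) (use that in auto)
    show ?thesis by (simp add: case_prod_beta)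
  qed
  have L_meas: "L j \<in> borel_measurable (PiM (insert i I) M)" if "j \<in> insert i I" for j
    unfolding L_def using updj[OF that] sigma_finite_measure.borel_measurable_lebesgue_integral[OF sigma_finite_measures[of j]] by auto
  have spj: "x(j:=s) \<in> space (PiM (insert i I) M)" if "j \<in> insert i I" "x \<in> space (PiM (insert i I) M)" "s \<in> space (M j)" for x j s
    using that by (auto simp: space_PiM PiE_def extensional_def)
  have fmj: "(\<lambda>s. f (x(j:=s))) \<in> borel_measurable (M j)" if "j \<in> insert i I" "x \<in> space (PiM (insert i I) M)" for x j
    using updj[OF that(1)] that(2) by (auto intro: measurable_Pair2)
  have Lb: "\<epsilon> \<le> L j x \<and> L j x \<le> K" if "j \<in> insert i I" "x \<in> space (PiM (insert i I) M)" for j x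
    unfolding L_def using prob_space.expectation_bounds(2,3)[OF prob_space fmj[OF that], of \<epsilon> K] fb spj[OF that] by blast
  define H where "H x = f x powr (1 - real (card I) * \<theta>) * (\<Prod>j\<in>insert i I. L j x powr \<theta>)" for x
  have H_meas[measurable]: "H \<in> borel_measurable (PiM (insert i I) M)"
    unfolding H_def by (intro borel_measurable_times borel_measurable_prod powr_real_measurable L_meas f borel_measurable_const)
  define C where "C = K powr (1 - real (card I) * \<theta>) * (\<Prod>j\<in>insert i I. K powr \<theta>)"
  have Hb: "0 \<le> H x \<and> H x \<le> C" if "x \<in> space (PiM (insert i I) M)" for x
  proof
    show "0 \<le> H x" unfolding H_def by (auto intro!: mult_nonneg_nonneg prod_nonneg)
    show "H x \<le> C" unfolding H_def C_def
      using fb[OF that] Lb[OF _ that] \<open>0<\<epsilon>\<close> \<open>0\<le>\<theta>\<close> insert.prems(2) card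
      by (intro mult_mono prod_mono conjI powr_mono2 prod_nonneg) (auto intro: order.trans[OF less_imp_le[OF \<open>0<\<epsilon>\<close>]])
  qed
  have H_int: "integrable (PiM (insert i I) M) H"
    by (rule FiI.expectation_bounds(1)[OF H_meas Hb])
  have f_int: "integrable (PiM (insert i I) M) f"
    by (rule FiI.expectation_bounds(1)[OF f fb])
  have updH: "(\<lambda>(x,t). H (x(i:=t))) \<in> borel_measurable (PiM I M \<Otimes>\<^sub>M M i)"
    by measurable
  have "(\<integral>x. H x \<partial>PiM (insert i I) M) = (\<integral>x. (\<integral>t. H (x(i:=t)) \<partial>M i) \<partial>PiM I M)"
    by (rule product_integral_insert[OF fi insert.hyps(2) H_int])
  also have "\<dots> \<le> (\<integral>x. g x powr (1 - (real (card I) - 1) * \<theta>) * (\<Prod>j\<in>I. (\<integral>s. g (x(j:=s)) \<partial>M j) powr \<theta>) \<partial>PiM I M)"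
  proof (rule integral_mono)
    have HHb: "0 \<le> (\<integral>t. H (x(i:=t)) \<partial>M i) \<and> (\<integral>t. H (x(i:=t)) \<partial>M i) \<le> C" if "x \<in> space (PiM I M)" for x
      using prob_space.expectation_bounds(2,3)[OF prob_space[of i], of "\<lambda>t. H (x(i:=t))" 0 C] updH that Hb sp by (auto intro: measurable_Pair2)
    show "integrable (PiM I M) (\<lambda>x. \<integral>t. H (x(i:=t)) \<partial>M i)"
      by (rule FI.expectation_bounds(1)[OF _ HHb]) (use updH in measurable)
    have gj: "(\<lambda>x. \<integral>s. g (x(j:=s)) \<partial>M j) \<in> borel_measurable (PiM I M)" if "j \<in> I" for j
    proof -
      have [measurable]: "(\<lambda>p. (fst p)(j := snd p)) \<in> PiM I M \<Otimes>\<^sub>M M j \<rightarrow>\<^sub>M PiM I M"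
        by (rule measurable_fun_upd[where J="I"]) (use that in auto)
      have "(\<lambda>(x,s). g (x(j:=s))) \<in> borel_measurable (PiM I M \<Otimes>\<^sub>M M j)" by (simp add: case_prod_beta)
      then show ?thesis using sigma_finite_measure.borel_measurable_lebesgue_integral[OF sigma_finite_measures[of j]] by auto
    qed
    have gjb: "\<epsilon> \<le> (\<integral>s. g (x(j:=s)) \<partial>M j) \<and> (\<integral>s. g (x(j:=s)) \<partial>M j) \<le> K" if "j \<in> I" "x \<in> space (PiM I M)" for x j
    proof -
      have s: "x(j:=s) \<in> space (PiM I M)" if "s \<in> space (M j)" for s
        using that \<open>j \<in> I\<close> \<open>x \<in> _\<close> by (auto simp: space_PiM PiE_def extensional_def)
      have [measurable]: "(\<lambda>s. x(j := s)) \<in> M j \<rightarrow>\<^sub>M PiM I M"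
        by (rule measurable_fun_upd[where J="I"]) (use that in auto)
      have "(\<lambda>s. g (x(j:=s))) \<in> borel_measurable (M j)" by measurable
      then show ?thesis using prob_space.expectation_bounds(2,3)[OF prob_space[of j], of "\<lambda>s. g (x(j:=s))" \<epsilon> K] gb s by blast
    qed
    show "integrable (PiM I M) (\<lambda>x. g x powr (1 - (real (card I) - 1) * \<theta>) * (\<Prod>j\<in>I. (\<integral>s. g (x(j:=s)) \<partial>M j) powr \<theta>))"
    proof (rule FI.expectation_bounds(1))
      show "(\<lambda>x. g x powr (1 - (real (card I) - 1) * \<theta>) * (\<Prod>j\<in>I. (\<integral>s. g (x(j:=s)) \<partial>M j) powr \<theta>)) \<in> borel_measurable (PiM I M)"
        by (intro borel_measurable_times borel_measurable_prod powr_real_measurable gj g_meas borel_measurable_const)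
      fix x assume x: "x \<in> space (PiM I M)"
      show "0 \<le> g x powr (1 - (real (card I) - 1) * \<theta>) * (\<Prod>j\<in>I. (\<integral>s. g (x(j:=s)) \<partial>M j) powr \<theta>) \<and>
        g x powr (1 - (real (card I) - 1) * \<theta>) * (\<Prod>j\<in>I. (\<integral>s. g (x(j:=s)) \<partial>M j) powr \<theta>)
        \<le> K powr (1 - (real (card I) - 1) * \<theta>) * (\<Prod>j\<in>I. K powr \<theta>)"
        using gb[OF x] gjb[OF _ x] \<open>0<\<epsilon>\<close> \<open>0\<le>\<theta>\<close> insert.prems(2) card
        by (intro conjI mult_mono prod_mono powr_mono2 prod_nonneg mult_nonneg_nonneg) (auto simp: left_diff_distrib intro: order.trans[OF less_imp_le[OF \<open>0<\<epsilon>\<close>]])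
    qed
    fix x assume x: "x \<in> space (PiM I M)"
    have gx: "g x > 0" using gb[OF x] \<open>0<\<epsilon>\<close> by auto
    \<comment> \<open>The line integral in direction \<open>i\<close> is constant along that line,
      so its factor leaves the inner integral. The other exponents, 1 - card I * \<theta> for
      \<open>f\<close> and \<theta> for each remaining line integral, sum to one, as Hoelder's
      inequality requires.\<close>
    have Li: "L i (x(i:=t)) = g x" for t by (simp add: L_def g_def)
    define a where "a j = (if j = i then 1 - real (card I) * \<theta> else \<theta>)" for j
    define h where "h j t = (if j = i then f (x(i:=t)) else L j (x(i:=t)))" for j t
    have upm: "(\<lambda>t. x(i:=t)) \<in> M i \<rightarrow>\<^sub>M PiM (insert i I) M"
      using x by measurable
    have "(\<integral>t. H (x(i:=t)) \<partial>M i) = (\<integral>t. g x powr \<theta> * (\<Prod>j\<in>insert i I. h j t powr a j) \<partial>M i)"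
    proof (rule Bochner_Integration.integral_cong[OF refl])
      fix t
      have "(\<Prod>j\<in>I. h j t powr a j) = (\<Prod>j\<in>I. L j (x(i:=t)) powr \<theta>)"
        using insert.hyps by (intro prod.cong) (auto simp: h_def a_def)
      then show "H (x(i:=t)) = g x powr \<theta> * (\<Prod>j\<in>insert i I. h j t powr a j)"
        using insert.hyps by (simp add: H_def Li, simp add: h_def a_def)
    qed
    also have "\<dots> = g x powr \<theta> * (\<integral>t. (\<Prod>j\<in>insert i I. h j t powr a j) \<partial>M i)" by simp
    also have "\<dots> \<le> g x powr \<theta> * (\<Prod>j\<in>insert i I. (\<integral>t. h j t \<partial>M i) powr a j)"
    proof (intro mult_left_mono prob_space.expectation_prod_powr_le[OF prob_space])
      show "finite (insert i I)" using fi by simp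
      show "j \<in> insert i I \<Longrightarrow> 0 \<le> a j" for j using insert.prems(1,2) card by (auto simp: a_def)
      have "sum a I = real (card I) * \<theta>" using insert.hyps by (subst sum.cong[OF refl, of _ _ "\<lambda>_. \<theta>"]) (auto simp: a_def)
      then show "sum a (insert i I) = 1" using insert.hyps by (simp add: a_def)
      show "0 < \<epsilon>" by fact
      show "h j \<in> borel_measurable (M i)" if "j \<in> insert i I" for j
        using measurable_compose[OF upm L_meas[OF that]] fm[OF x] unfolding h_def by (cases "j=i") auto
      show "\<epsilon> \<le> h j t \<and> h j t \<le> K" if "j \<in> insert i I" "t \<in> space (M i)" for j t
        using Lb[OF that(1) sp[OF x that(2)]] fb[OF sp[OF x that(2)]] unfolding h_def by presburger
    qed simp
    also have "(\<Prod>j\<in>insert i I. (\<integral>t. h j t \<partial>M i) powr a j) = g x powr (1 - real (card I) * \<theta>) * (\<Prod>j\<in>I. (\<integral>s. g (x(j:=s)) \<partial>M j) powr \<theta>)"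
    proof -
      have "(\<integral>t. h j t \<partial>M i) powr a j = (\<integral>s. g (x(j:=s)) \<partial>M j) powr \<theta>" if j: "j \<in> I" for j
      proof -
        have ji: "j \<noteq> i" using j insert.hyps by auto
        interpret Mj: prob_space "M j" by (rule prob_space)
        interpret pij: pair_prob_space "M i" "M j" by standard
        have up2: "(\<lambda>p. x(i := fst p, j := snd p)) \<in> M i \<Otimes>\<^sub>M M j \<rightarrow>\<^sub>M PiM (insert i I) M"
        proof (rule measurable_fun_upd[where J="insert i I"])
          show "(\<lambda>p. x(i := fst p)) \<in> M i \<Otimes>\<^sub>M M j \<rightarrow>\<^sub>M PiM (insert i I) M"
            by (rule measurable_fun_upd[where J="I"]) (use x in auto)
        qed (use j in auto)
        have fm2: "(\<lambda>(t,s). f (x(i:=t, j:=s))) \<in> borel_measurable (M i \<Otimes>\<^sub>M M j)"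
          unfolding case_prod_beta by (rule measurable_compose[OF up2 f])
        have "integrable (M i \<Otimes>\<^sub>M M j) (\<lambda>(t,s). f (x(i:=t, j:=s)))"
          by (rule pij.expectation_bounds(1)[OF fm2, of \<epsilon> K])
             (use j x in \<open>auto intro!: fb[THEN conjunct1] fb[THEN conjunct2] spj sp simp: space_pair_measure\<close>)
        from pij.Fubini_integral[OF this]
        have "(\<integral>t. \<integral>s. f (x(i:=t, j:=s)) \<partial>M j \<partial>M i) = (\<integral>s. \<integral>t. f (x(i:=t, j:=s)) \<partial>M i \<partial>M j)" by simp
        then show ?thesis using ji by (simp add: h_def a_def L_def g_def fun_upd_twist)
      qed
      moreover have "(\<integral>t. h i t \<partial>M i) powr a i = g x powr (1 - real (card I) * \<theta>)"
        by (simp add: h_def a_def g_def)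
      ultimately show ?thesis using insert.hyps by simp
    qed
    \<comment> \<open>The factor taken out and the one returned by Hoelder's inequality combine to
      the exponent that the statement prescribes for \<open>g\<close> on the smaller index
      set.\<close>
    also have "g x powr \<theta> * (g x powr (1 - real (card I) * \<theta>) * (\<Prod>j\<in>I. (\<integral>s. g (x(j:=s)) \<partial>M j) powr \<theta>))
      = g x powr (1 - (real (card I) - 1) * \<theta>) * (\<Prod>j\<in>I. (\<integral>s. g (x(j:=s)) \<partial>M j) powr \<theta>)"
      using gx by (simp add: mult.assoc[symmetric] powr_add[symmetric] algebra_simps)
    finally show "(\<integral>t. H (x(i:=t)) \<partial>M i) \<le> g x powr (1 - (real (card I) - 1) * \<theta>) * (\<Prod>j\<in>I. (\<integral>s. g (x(j:=s)) \<partial>M j) powr \<theta>)" .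
  qed
  also have "\<dots> \<le> (\<integral>x. g x \<partial>PiM I M) powr (1 + \<theta>)"
    using insert.prems(1,2,3) card
    by (intro insert.IH g_meas gb) (auto simp: left_diff_distrib)
  also have "(\<integral>x. g x \<partial>PiM I M) = (\<integral>x. f x \<partial>PiM (insert i I) M)"
    unfolding g_def by (rule product_integral_insert[OF fi insert.hyps(2) f_int, symmetric])
  finally show ?case unfolding H_def L_def card .
qed

section \<open>The Sobolev inequality\<close>

text \<open>The uniform distribution on [-R, R]. The induction over coordinates wants probability
  measures; for functions supported in the box the product of these agrees with Lebesgue measure up
  to the factor (2R)^N.\<close>

definition unif :: "real \<Rightarrow> real measure" where
  "unif R = density lborel (\<lambda>t. ennreal (indicator {-R..R} t / (2*R)))"

lemma sets_unif[simp, measurable_cong]: "sets (unif R) = sets borel" by (simp add: unif_def)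
lemma space_unif[simp]: "space (unif R) = UNIV" by (simp add: unif_def)

lemma prob_space_unif: "0 < R \<Longrightarrow> prob_space (unif R)"
proof
  assume R: "0 < R"
  have "emeasure (unif R) (space (unif R)) = (\<integral>\<^sup>+t. ennreal (1/(2*R)) * indicator {-R..R} t \<partial>lborel)"
    unfolding unif_def by (auto simp: emeasure_density indicator_def intro!: nn_integral_cong)
  also have "\<dots> = 1" using R by (simp add: nn_integral_cmult_indicator ennreal_mult[symmetric] flip: ennreal_1)
  finally show "emeasure (unif R) (space (unif R)) = 1" .
qed

lemma integral_unif:
  fixes f :: "real \<Rightarrow> real"
  assumes "f \<in> borel_measurable borel" "0 < R"
  shows "(\<integral>t. f t \<partial>unif R) = (\<integral>t. indicator {-R..R} t * f t \<partial>lborel) / (2*R)"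
proof -
  have "(\<integral>t. f t \<partial>unif R) = (\<integral>t. indicator {-R..R} t * f t / (2*R) \<partial>lborel)"
    unfolding unif_def using assms by (subst integral_density) auto
  then show ?thesis by simp
qed

definition Eucl :: "('a::euclidean_space \<Rightarrow> real) \<Rightarrow> 'a" where
  "Eucl x = (\<Sum>b\<in>Basis. x b *\<^sub>R b)"

lemma Eucl_inner: "i \<in> Basis \<Longrightarrow> Eucl x \<bullet> i = x i" by (simp add: Eucl_def)

lemma Eucl_upd: "i \<in> Basis \<Longrightarrow> Eucl (x(i := t)) = Eucl x + (t - x i) *\<^sub>R i"
proof (rule euclidean_eqI)
  fix j :: 'a assume "i \<in> Basis" "j \<in> Basis"
  then show "Eucl (x(i := t)) \<bullet> j = (Eucl x + (t - x i) *\<^sub>R i) \<bullet> j"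
    unfolding inner_add_left inner_scaleR_left Eucl_inner[OF \<open>j \<in> Basis\<close>]
    by (cases "i = j") (auto simp: inner_not_same_Basis)
qed

lemma PiM_unif:
  assumes R: "0 < R"
  shows "PiM (Basis :: 'a::euclidean_space set) (\<lambda>_. unif R) =
    density (PiM Basis (\<lambda>_. lborel)) (\<lambda>x. ennreal (\<Prod>i\<in>Basis. indicator {-R..R} (x i) / (2*R)))"
    (is "_ = ?D")
proof -
  interpret U: product_prob_space "\<lambda>_::'a. unif R" Basis by (rule product_prob_spaceI) (rule prob_space_unif[OF R])
  interpret L: product_sigma_finite "\<lambda>_::'a. lborel :: real measure" by standard
  show ?thesis
  proof (rule U.PiM_eqI[symmetric])
    show "sets ?D = sets (PiM Basis (\<lambda>_::'a. unif R))" by (auto intro!: sets_PiM_cong)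
    fix A :: "'a \<Rightarrow> real set" assume A: "\<And>i. i \<in> Basis \<Longrightarrow> A i \<in> sets (unif R)"
    then have A[measurable]: "\<And>i. i \<in> Basis \<Longrightarrow> A i \<in> sets borel" by simp
    have AP: "Pi\<^sub>E Basis A \<in> sets (PiM Basis (\<lambda>_::'a. lborel :: real measure))"
      by (rule sets_PiM_I_finite) (use A in auto)
    have "emeasure ?D (Pi\<^sub>E Basis A) = (\<integral>\<^sup>+x. ennreal (\<Prod>i\<in>Basis. indicator {-R..R} (x i) / (2*R)) * indicator (Pi\<^sub>E Basis A) x \<partial>PiM Basis (\<lambda>_. lborel))"
      by (rule emeasure_density[OF _ AP]) measurable
    also have "\<dots> = (\<integral>\<^sup>+x. (\<Prod>i\<in>Basis. ennreal (indicator {-R..R} (x i) / (2*R)) * indicator (A i) (x i)) \<partial>PiM Basis (\<lambda>_. lborel))"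
    proof (rule nn_integral_cong)
      fix x assume x: "x \<in> space (PiM (Basis::'a set) (\<lambda>_. lborel::real measure))"
      have "indicator (Pi\<^sub>E Basis A) x = (\<Prod>i\<in>Basis. indicator (A i) (x i) :: ennreal)"
        using x by (auto simp: indicator_def PiE_def space_PiM intro!: prod.neutral[symmetric] prod.neutral)
      then show "ennreal (\<Prod>i\<in>Basis. indicator {-R..R} (x i) / (2*R)) * indicator (Pi\<^sub>E Basis A) x =
        (\<Prod>i\<in>Basis. ennreal (indicator {-R..R} (x i) / (2*R)) * indicator (A i) (x i))"
        using R by (subst prod_ennreal[symmetric]) (auto simp: prod.distrib)
    qed
    also have "\<dots> = (\<Prod>i\<in>(Basis::'a set). (\<integral>\<^sup>+t. ennreal (indicator {-R..R} t / (2*R)) * indicator (A i) t \<partial>lborel))"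
      by (rule L.product_nn_integral_prod) auto
    also have "\<dots> = (\<Prod>i\<in>Basis. emeasure (unif R) (A i))"
      unfolding unif_def by (intro prod.cong refl emeasure_density[symmetric]) auto
    finally show "emeasure ?D (Pi\<^sub>E Basis A) = (\<Prod>i\<in>Basis. emeasure (unif R) (A i))" .
  qed auto
qed

lemma measurable_Eucl[measurable]: "Eucl \<in> PiM (Basis::'a::euclidean_space set) (\<lambda>_. lborel) \<rightarrow>\<^sub>M borel"
  unfolding Eucl_def by measurable

lemma integral_PiM_unif:
  fixes h :: "'a::euclidean_space \<Rightarrow> real"
  assumes R: "0 < R" and h[measurable]: "h \<in> borel_measurable borel"
    and supp: "\<And>x i. i \<in> Basis \<Longrightarrow> R \<le> \<bar>x \<bullet> i\<bar> \<Longrightarrow> h x = 0"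
  shows "(\<integral>x. h (Eucl x) \<partial>PiM Basis (\<lambda>_. unif R)) = (\<integral>x. h x \<partial>lborel) / (2*R) ^ DIM('a)"
proof -
  have "(\<integral>x. h (Eucl x) \<partial>PiM (Basis::'a set) (\<lambda>_. unif R)) =
      (\<integral>x. (\<Prod>i\<in>(Basis::'a set). indicator {-R..R} (x i) / (2*R)) * h (Eucl x) \<partial>PiM Basis (\<lambda>_. lborel))"
    unfolding PiM_unif[OF R] using R by (subst integral_density) (auto intro!: prod_nonneg)
  also have "\<dots> = (\<integral>x. h (Eucl x) / (2*R) ^ DIM('a) \<partial>PiM (Basis::'a set) (\<lambda>_. lborel))"
  proof (rule Bochner_Integration.integral_cong[OF refl])
    fix x :: "'a \<Rightarrow> real"
    show "(\<Prod>i\<in>(Basis::'a set). indicator {-R..R} (x i) / (2*R)) * h (Eucl x) = h (Eucl x) / (2*R) ^ DIM('a)"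
    proof (cases "\<exists>i\<in>Basis. R \<le> \<bar>x i\<bar>")
      case True
      then have "h (Eucl x) = 0" using supp[of _ "Eucl x"] by (auto simp: Eucl_inner)
      then show ?thesis by simp
    next
      case False
      then have "(\<Prod>i\<in>(Basis::'a set). indicator {-R..R} (x i) / (2*R)) = (\<Prod>i\<in>(Basis::'a set). 1 / (2*R))"
        by (intro prod.cong) (auto simp: indicator_def abs_le_iff not_le)
      then show ?thesis by (simp add: power_divide power_one_over)
    qed
  qed
  also have "\<dots> = (\<integral>x. h (Eucl x) \<partial>PiM (Basis::'a set) (\<lambda>_. lborel)) / (2*R) ^ DIM('a)" by simp
  also have "(\<integral>x. h (Eucl x) \<partial>PiM (Basis::'a set) (\<lambda>_. lborel)) = (\<integral>x. h x \<partial>lborel)"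
    by (subst lborel_eq, subst integral_distr) (auto simp: Eucl_def[abs_def])
  finally show ?thesis .
qed

text \<open>Test functions are not closed under |.|^\<gamma>, which is smooth only to finite order
  at 0. This larger class is closed under composition with every C^1 function vanishing at 0, and
  the Sobolev inequality is proved on it.\<close>

definition C1c :: "'a::euclidean_space set \<Rightarrow> ('a \<Rightarrow> real) \<Rightarrow> ('a \<Rightarrow> 'a) \<Rightarrow> bool" where
  "C1c S \<phi> g \<longleftrightarrow> is_grad \<phi> g \<and> continuous_on UNIV g \<and>
     (\<exists>K. compact K \<and> K \<subseteq> S \<and> (\<forall>x. x \<notin> K \<longrightarrow> \<phi> x = 0 \<and> g x = 0))"

lemma is_grad_continuous: "is_grad \<phi> g \<Longrightarrow> continuous_on S \<phi>"
  unfolding is_grad_def by (auto intro!: continuous_at_imp_continuous_on has_derivative_continuous)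

lemma C1c_continuous:
  assumes "C1c S \<phi> g" shows "continuous_on A \<phi>" "continuous_on A g"
  using assms is_grad_continuous continuous_on_subset unfolding C1c_def by blast+

text \<open>The fundamental theorem of calculus along a coordinate line, starting on the face of the
  box where \<phi> vanishes. The factor 2R undoes the normalization of \<open>unif\<close>; the
  slack \<epsilon> is there so that the integrand can be bounded away from zero.\<close>

lemma line_integral_bound:
  assumes c: "C1c (box (- R *\<^sub>R One) (R *\<^sub>R One)) \<phi> g" and i: "i \<in> Basis" and "0 < R" and e: "0 \<le> \<epsilon>"
  shows "\<bar>\<phi> (Eucl x)\<bar> \<le> 2*R * (\<integral>t. norm (g (Eucl (x(i:=t)))) + \<epsilon> \<partial>unif R)"
proof -
  have cg: "continuous_on UNIV g" and grad: "is_grad \<phi> g"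
    and out: "\<And>x. x \<notin> box (- R *\<^sub>R One) (R *\<^sub>R One) \<Longrightarrow> \<phi> x = 0"
    using c unfolding C1c_def by blast+
  define \<gamma> where "\<gamma> t = Eucl x + (t - x i) *\<^sub>R i" for t
  have cgam: "continuous_on UNIV \<gamma>" unfolding \<gamma>_def by (intro continuous_intros)
  have cgg: "continuous_on UNIV (\<lambda>t. g (\<gamma> t))"
    using continuous_on_compose[OF cgam, of g] cg continuous_on_subset by (auto simp: o_def)
  have [measurable]: "(\<lambda>t. g (\<gamma> t)) \<in> borel_measurable borel" using cgg by (rule borel_measurable_continuous_onI)
  have inti: "integrable lborel (\<lambda>t. indicator {a..b} t *\<^sub>R (norm (g (\<gamma> t)) + \<epsilon>))" for a b
    by (rule borel_integrable_compact) (auto intro!: continuous_intros continuous_on_subset[OF cgg])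
  have "\<bar>\<phi> (Eucl x)\<bar> \<le> (\<integral>t. indicator {-R..R} t * (norm (g (\<gamma> t)) + \<epsilon>) \<partial>lborel)"
  proof (cases "\<bar>x i\<bar> < R")
    case False
    then have "\<phi> (Eucl x) = 0" using i by (intro out) (auto simp: box_def Eucl_inner intro!: bexI[of _ i])
    then show ?thesis using e by (auto intro!: integral_nonneg_AE)
  next
    case True
    have "\<phi> (\<gamma> (-R)) = 0" using i by (intro out) (auto simp: box_def \<gamma>_def inner_add_left Eucl_inner intro!: bexI[of _ i])
    moreover have "\<phi> (\<gamma> (x i)) = \<phi> (Eucl x)" by (simp add: \<gamma>_def)
    moreover have "(\<integral>t. indicator {-R..x i} t *\<^sub>R (g (\<gamma> t) \<bullet> i) \<partial>lborel) = \<phi> (\<gamma> (x i)) - \<phi> (\<gamma> (-R))"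
    proof (rule integral_FTC_Icc)
      show "- R \<le> x i" using True by auto
      show "continuous_on {-R..x i} (\<lambda>t. g (\<gamma> t) \<bullet> i)" by (intro continuous_intros continuous_on_subset[OF cgg]) auto
      fix t
      have "((\<lambda>t. \<phi> (\<gamma> t)) has_derivative (\<lambda>h. g (\<gamma> t) \<bullet> (h *\<^sub>R i))) (at t)"
        by (rule has_derivative_compose[where g=\<phi> and g'="\<lambda>h. g (\<gamma> t) \<bullet> h"])
           (use grad in \<open>auto simp: is_grad_def \<gamma>_def intro!: derivative_eq_intros\<close>)
      then have "((\<lambda>t. \<phi> (\<gamma> t)) has_vector_derivative (g (\<gamma> t) \<bullet> i)) (at t)"
        by (simp add: has_vector_derivative_def)
      then show "((\<lambda>t. \<phi> (\<gamma> t)) has_vector_derivative (g (\<gamma> t) \<bullet> i)) (at t within {-R..x i})"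
        by (rule has_vector_derivative_at_within)
    qed
    ultimately have "\<bar>\<phi> (Eucl x)\<bar> = norm (\<integral>t. indicator {-R..x i} t *\<^sub>R (g (\<gamma> t) \<bullet> i) \<partial>lborel)" by simp
    also have "\<dots> \<le> (\<integral>t. indicator {-R..R} t * (norm (g (\<gamma> t)) + \<epsilon>) \<partial>lborel)"
    proof (rule Bochner_Integration.integral_norm_bound_integral)
      show "integrable lborel (\<lambda>t. indicator {-R..x i} t *\<^sub>R (g (\<gamma> t) \<bullet> i))"
        by (rule borel_integrable_compact) (auto intro!: continuous_intros continuous_on_subset[OF cgg])
      show "integrable lborel (\<lambda>t. indicator {-R..R} t * (norm (g (\<gamma> t)) + \<epsilon>))" using inti[of "-R" R] by simp
      fix t
      have "\<bar>g (\<gamma> t) \<bullet> i\<bar> \<le> norm (g (\<gamma> t))" using Cauchy_Schwarz_ineq2[of "g (\<gamma> t)" i] i by simp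
      then show "norm (indicator {-R..x i} t *\<^sub>R (g (\<gamma> t) \<bullet> i)) \<le> indicator {-R..R} t * (norm (g (\<gamma> t)) + \<epsilon>)"
        using True e by (auto simp: indicator_def abs_le_iff)
    qed
    finally show ?thesis .
  qed
  also have "\<dots> = 2*R * (\<integral>t. norm (g (Eucl (x(i:=t)))) + \<epsilon> \<partial>unif R)"
    using \<open>0 < R\<close> i by (subst integral_unif) (auto simp: Eucl_upd \<gamma>_def[symmetric])
  finally show ?thesis .
qed

lemma C1c_bounded:
  assumes "C1c S \<phi> g" obtains B where "\<And>x. \<bar>\<phi> x\<bar> \<le> B" "\<And>x. norm (g x) \<le> B" "0 \<le> B"
proof -
  obtain K where K: "compact K" "\<And>x. x \<notin> K \<Longrightarrow> \<phi> x = 0 \<and> g x = 0" using assms by (auto simp: C1c_def)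
  have "bounded (\<phi> ` K)" "bounded (g ` K)"
    using compact_continuous_image[OF C1c_continuous(1)[OF assms] K(1)] compact_continuous_image[OF C1c_continuous(2)[OF assms] K(1)]
    by (auto intro: compact_imp_bounded)
  then obtain A B where AB: "\<And>x. x \<in> K \<Longrightarrow> \<bar>\<phi> x\<bar> \<le> A" "\<And>x. x \<in> K \<Longrightarrow> norm (g x) \<le> B"
    by (auto simp: bounded_iff)
  show ?thesis
  proof (rule that[of "max 0 (max A B)"])
    show "\<bar>\<phi> x\<bar> \<le> max 0 (max A B)" for x using K(2)[of x] AB(1)[of x] by (cases "x \<in> K") auto
    show "norm (g x) \<le> max 0 (max A B)" for x using K(2)[of x] AB(2)[of x] by (cases "x \<in> K") auto
  qed auto
qed

text \<open>The product of the n line bounds, each raised to 1/(n-1), dominates |\<phi>|^{n/(n-1)}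
  by a product of line integrals, which Gagliardo's inequality integrates. The powers of 2R only
  account for the normalized measures.\<close>

lemma gagliardo_nirenberg_box:
  fixes \<phi> :: "'a::euclidean_space \<Rightarrow> real"
  assumes N: "DIM('a) \<ge> 2" and R: "0 < R" and c: "C1c (box (- R *\<^sub>R One) (R *\<^sub>R One)) \<phi> g"
  defines "n \<equiv> real DIM('a)"
  shows "(\<integral>x. \<bar>\<phi> x\<bar> powr (n/(n-1)) \<partial>lborel)
      \<le> (2*R)^DIM('a) * (2*R) powr (n/(n-1)) * ((\<integral>x. norm (g x) \<partial>lborel) / (2*R)^DIM('a)) powr (n/(n-1))"
proof -
  interpret U: product_prob_space "\<lambda>_::'a. unif R" Basis by (rule product_prob_spaceI) (rule prob_space_unif[OF R])
  let ?U = "PiM (Basis::'a set) (\<lambda>_. unif R)"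
  have PU: "prob_space ?U" by (intro prob_space_PiM prob_space_unif R)
  have n: "n \<ge> 2" using N by (simp add: n_def)
  define \<theta> where "\<theta> = 1/(n-1)"
  have th: "\<theta> > 0" "(n-1)*\<theta> = 1" "n/(n-1) = 1+\<theta>" "n * \<theta> = 1 + \<theta>" using n by (auto simp: \<theta>_def field_simps)
  have pw: "(y powr \<theta>) ^ DIM('a) = y powr (1+\<theta>)" for y
    using th(4) by (cases "y = 0") (simp_all add: powr_power n_def mult.commute)
  obtain B where B: "\<And>x. \<bar>\<phi> x\<bar> \<le> B" "\<And>x. norm (g x) \<le> B" "0 \<le> B" using C1c_bounded[OF c] by blast
  have [measurable]: "\<phi> \<in> borel_measurable borel" "g \<in> borel_measurable borel"
    using C1c_continuous[OF c] by (auto intro: borel_measurable_continuous_onI)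
  have [measurable]: "Eucl \<in> ?U \<rightarrow>\<^sub>M borel" unfolding Eucl_def by measurable
  have out: "x \<notin> box (- R *\<^sub>R One) (R *\<^sub>R One) \<Longrightarrow> \<phi> x = 0 \<and> g x = 0" for x
    using c unfolding C1c_def by blast
  have out': "\<phi> x = 0 \<and> g x = 0" if "i \<in> Basis" "R \<le> \<bar>x \<bullet> i\<bar>" for x i
    by (rule out) (use that in \<open>auto simp: box_def abs_if split: if_splits intro!: bexI[of _ i]\<close>)
  have phU: "(\<integral>x. \<bar>\<phi> (Eucl x)\<bar> powr (1+\<theta>) \<partial>?U) = (\<integral>x. \<bar>\<phi> x\<bar> powr (1+\<theta>) \<partial>lborel) / (2*R)^DIM('a)"
    by (rule integral_PiM_unif[OF R]) (use out' in auto)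
  have gU: "(\<integral>x. norm (g (Eucl x)) \<partial>?U) = (\<integral>x. norm (g x) \<partial>lborel) / (2*R)^DIM('a)"
    by (rule integral_PiM_unif[OF R]) (use out' in auto)
  have key: "(\<integral>x. \<bar>\<phi> (Eucl x)\<bar> powr (1+\<theta>) \<partial>?U) \<le> (2*R) powr (1+\<theta>) * ((\<integral>x. norm (g (Eucl x)) \<partial>?U) + \<epsilon>) powr (1+\<theta>)" if e: "0 < \<epsilon>" for \<epsilon>
  proof -
    define F where "F x = norm (g (Eucl x)) + \<epsilon>" for x
    have F[measurable]: "F \<in> borel_measurable ?U" unfolding F_def by measurable
    have Fb: "\<epsilon> \<le> F x \<and> F x \<le> B + \<epsilon>" for x using B by (auto simp: F_def)
    define L where "L i x = (\<integral>t. F (x(i:=t)) \<partial>unif R)" for i x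
    have L0: "0 \<le> L i x" for i x unfolding L_def using e by (auto intro!: integral_nonneg_AE simp: F_def)
    have Lm: "L i \<in> borel_measurable ?U" if "i \<in> Basis" for i
    proof -
      have "(\<lambda>p. (fst p)(i := snd p)) \<in> ?U \<Otimes>\<^sub>M unif R \<rightarrow>\<^sub>M ?U"
        by (rule measurable_fun_upd[where J="Basis"]) (use that in auto)
      then have "(\<lambda>(x,s). F (x(i:=s))) \<in> borel_measurable (?U \<Otimes>\<^sub>M unif R)"
        unfolding case_prod_beta by (rule measurable_compose[OF _ F])
      then show ?thesis unfolding L_def using sigma_finite_measure.borel_measurable_lebesgue_integral[OF U.sigma_finite_measures] by auto
    qed
    have Lb: "L i x \<le> B + \<epsilon>" if "i \<in> Basis" "x \<in> space ?U" for i x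
    proof -
      have "(\<lambda>t. x(i:=t)) \<in> unif R \<rightarrow>\<^sub>M ?U"
        by (rule measurable_fun_upd[where J="Basis"]) (use that in auto)
      then have "(\<lambda>t. F (x(i:=t))) \<in> borel_measurable (unif R)" by (rule measurable_compose[OF _ F])
      then show ?thesis unfolding L_def using prob_space.expectation_bounds(3)[OF prob_space_unif[OF R]] Fb by blast
    qed
    have phb: "\<bar>\<phi> (Eucl x)\<bar> \<le> 2*R * L i x" if "i \<in> Basis" for x i
      unfolding L_def F_def by (rule line_integral_bound[OF c that R]) (use e in auto)
    have Pb: "0 \<le> (\<Prod>i\<in>Basis. L i x powr \<theta>) \<and> (\<Prod>i\<in>Basis. L i x powr \<theta>) \<le> (\<Prod>i\<in>(Basis::'a set). (B+\<epsilon>) powr \<theta>)" if "x \<in> space ?U" for x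
      using that Lb L0 th by (intro conjI prod_mono prod_nonneg powr_mono2) auto
    have Pm: "(\<lambda>x. \<Prod>i\<in>Basis. L i x powr \<theta>) \<in> borel_measurable ?U"
      by (intro borel_measurable_prod powr_real_measurable Lm borel_measurable_const)
    have Pint: "integrable ?U (\<lambda>x. \<Prod>i\<in>Basis. L i x powr \<theta>)"
      by (rule prob_space.expectation_bounds(1)[OF PU Pm Pb])
    have "(\<integral>x. \<bar>\<phi> (Eucl x)\<bar> powr (1+\<theta>) \<partial>?U) \<le> (\<integral>x. (2*R) powr (1+\<theta>) * (\<Prod>i\<in>Basis. L i x powr \<theta>) \<partial>?U)"
    proof (rule integral_mono)
      show "integrable ?U (\<lambda>x. \<bar>\<phi> (Eucl x)\<bar> powr (1+\<theta>))"
        by (rule prob_space.expectation_bounds(1)[OF PU, where \<epsilon>=0 and K="B powr (1+\<theta>)"])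
           (use B th in \<open>auto intro!: powr_mono2\<close>)
      show "integrable ?U (\<lambda>x. (2*R) powr (1+\<theta>) * (\<Prod>i\<in>Basis. L i x powr \<theta>))" using Pint by simp
      fix x
      have "\<bar>\<phi> (Eucl x)\<bar> powr (1+\<theta>) = (\<Prod>i\<in>(Basis::'a set). \<bar>\<phi> (Eucl x)\<bar> powr \<theta>)"
        by (simp add: pw)
      also have "\<dots> \<le> (\<Prod>i\<in>Basis. (2*R * L i x) powr \<theta>)"
        using phb th by (intro prod_mono conjI powr_mono2) auto
      also have "\<dots> = (\<Prod>i\<in>(Basis::'a set). (2*R) powr \<theta>) * (\<Prod>i\<in>Basis. L i x powr \<theta>)"
        using R L0 by (subst prod.distrib[symmetric]) (auto intro!: prod.cong simp: powr_mult)
      also have "(\<Prod>i\<in>(Basis::'a set). (2*R) powr \<theta>) = (2*R) powr (1+\<theta>)"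
        by (simp add: pw)
      finally show "\<bar>\<phi> (Eucl x)\<bar> powr (1+\<theta>) \<le> (2*R) powr (1+\<theta>) * (\<Prod>i\<in>Basis. L i x powr \<theta>)" .
    qed
    also have "\<dots> = (2*R) powr (1+\<theta>) * (\<integral>x. (\<Prod>i\<in>Basis. L i x powr \<theta>) \<partial>?U)" by simp
    also have "(\<integral>x. (\<Prod>i\<in>Basis. L i x powr \<theta>) \<partial>?U) \<le> (\<integral>x. F x \<partial>?U) powr (1+\<theta>)"
    proof -
      \<comment> \<open>With (n-1) * \<theta> = 1 the exponent of \<open>F\<close> is zero. As
        \<open>0 powr 0 = 0\<close>, this factor is 1 only because the shift by \<epsilon> makes
        \<open>F\<close> positive.\<close>
      have "(\<integral>x. (\<Prod>i\<in>Basis. L i x powr \<theta>) \<partial>?U) = (\<integral>x. F x powr (1 - (real DIM('a) - 1) * \<theta>) * (\<Prod>i\<in>Basis. (\<integral>t. F (x(i:=t)) \<partial>unif R) powr \<theta>) \<partial>?U)"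
        using th(2) e by (simp add: n_def L_def F_def add_nonneg_eq_0_iff)
      also have "\<dots> \<le> (\<integral>x. F x \<partial>?U) powr (1+\<theta>)"
        by (rule U.gagliardo_line_integrals[OF _ _ _ e F Fb]) (use th in \<open>auto simp: n_def\<close>)
      finally show ?thesis .
    qed
    also have "(\<integral>x. F x \<partial>?U) = (\<integral>x. norm (g (Eucl x)) \<partial>?U) + \<epsilon>"
    proof -
      have "integrable ?U (\<lambda>x. norm (g (Eucl x)))"
        by (rule prob_space.expectation_bounds(1)[OF PU, where \<epsilon>=0 and K=B]) (use B in auto)
      then show ?thesis unfolding F_def by (subst Bochner_Integration.integral_add) (auto simp: prob_space.prob_space[OF PU])
    qed
    finally show ?thesis using R by simp
  qed
  have lim: "((\<lambda>\<epsilon>. (2*R) powr (1+\<theta>) * ((\<integral>x. norm (g (Eucl x)) \<partial>?U) + \<epsilon>) powr (1+\<theta>)) \<longlongrightarrow> (2*R) powr (1+\<theta>) * ((\<integral>x. norm (g (Eucl x)) \<partial>?U) + 0) powr (1+\<theta>)) (at_right 0)"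
    using th by (intro tendsto_mult tendsto_const tendsto_powr' tendsto_add tendsto_ident_at)
      (auto intro!: eventually_at_right_less[THEN eventually_mono] add_nonneg_nonneg)
  have "(\<integral>x. \<bar>\<phi> (Eucl x)\<bar> powr (1+\<theta>) \<partial>?U) \<le> (2*R) powr (1+\<theta>) * ((\<integral>x. norm (g (Eucl x)) \<partial>?U) + 0) powr (1+\<theta>)"
    by (rule tendsto_lowerbound[OF lim])
      (use key in \<open>auto intro!: eventually_at_right_less[THEN eventually_mono]\<close>)
  then show ?thesis unfolding phU gU th(3) using R by (simp add: field_simps)
qed

section \<open>Young's and Hoelder's inequalities\<close>

lemma Youngs_inequality_0':
  fixes a s t :: real
  assumes "0 < a" "a < 1" "0 \<le> s" "0 \<le> t"
  shows "s powr a * t powr (1-a) \<le> a * s + (1-a) * t"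
proof (cases "s = 0 \<or> t = 0")
  case False
  then show ?thesis using Youngs_inequality_0[of a "1-a" s t] assms by auto
qed (use assms in auto)

text \<open>Young's inequality for the functions divided by their integrals. Integrability of the
  product is a separate conclusion, since the Bochner integral of a non-integrable function is 0 and
  the bound alone would say nothing about it.\<close>

lemma Holder_powr:
  fixes f g :: "'a \<Rightarrow> real"
  assumes a: "0 < a" "a < 1" and f: "integrable M f" "\<And>x. 0 \<le> f x" and g: "integrable M g" "\<And>x. 0 \<le> g x"
  shows "integrable M (\<lambda>x. f x powr a * g x powr (1-a))"
    and "(\<integral>x. f x powr a * g x powr (1-a) \<partial>M) \<le> (\<integral>x. f x \<partial>M) powr a * (\<integral>x. g x \<partial>M) powr (1-a)"
proof -
  have [measurable]: "f \<in> borel_measurable M" "g \<in> borel_measurable M" using f g by auto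
  show int: "integrable M (\<lambda>x. f x powr a * g x powr (1-a))"
  proof (rule Bochner_Integration.integrable_bound)
    show "integrable M (\<lambda>x. a * f x + (1-a) * g x)" using f g by auto
    show "AE x in M. norm (f x powr a * g x powr (1-a)) \<le> norm (a * f x + (1-a) * g x)"
      using Youngs_inequality_0'[OF a] f g a by (intro AE_I2) (auto intro: order.trans[OF _ abs_ge_self])
  qed measurable
  let ?F = "\<integral>x. f x \<partial>M" and ?G = "\<integral>x. g x \<partial>M"
  have F0: "0 \<le> ?F" "0 \<le> ?G" using f g by auto
  show "(\<integral>x. f x powr a * g x powr (1-a) \<partial>M) \<le> ?F powr a * ?G powr (1-a)"
  proof (cases "?F = 0 \<or> ?G = 0")
    case True
    then have "AE x in M. f x = 0 \<or> g x = 0"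
      using integral_nonneg_eq_0_iff_AE[of M f] integral_nonneg_eq_0_iff_AE[of M g] f g by auto
    then have "(\<integral>x. f x powr a * g x powr (1-a) \<partial>M) = (\<integral>x. 0 \<partial>M)"
      by (intro integral_cong_AE) auto
    then show ?thesis by simp
  next
    case False
    then have F: "?F > 0" "?G > 0" using F0 by auto
    have "(\<integral>x. f x powr a * g x powr (1-a) \<partial>M) \<le> (\<integral>x. ?F powr a * ?G powr (1-a) * (a * (f x / ?F) + (1-a) * (g x / ?G)) \<partial>M)"
    proof (rule integral_mono[OF int])
      show "integrable M (\<lambda>x. ?F powr a * ?G powr (1-a) * (a * (f x / ?F) + (1-a) * (g x / ?G)))" using f g by auto
      fix x
      have "(f x / ?F) powr a * (g x / ?G) powr (1-a) \<le> a * (f x / ?F) + (1-a) * (g x / ?G)"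
        by (rule Youngs_inequality_0'[OF a]) (use f g F in auto)
      moreover have "(f x / ?F) powr a * (g x / ?G) powr (1-a) = f x powr a * g x powr (1-a) / (?F powr a * ?G powr (1-a))"
        using F f g by (simp add: powr_divide)
      ultimately show "f x powr a * g x powr (1-a) \<le> ?F powr a * ?G powr (1-a) * (a * (f x / ?F) + (1-a) * (g x / ?G))"
        using F by (simp add: divide_le_eq mult.commute)
    qed
    also have "\<dots> = ?F powr a * ?G powr (1-a) * (a * (?F / ?F) + (1-a) * (?G / ?G))"
    proof -
      have "(\<integral>x. a * (f x / ?F) + (1-a) * (g x / ?G) \<partial>M) = a * (?F / ?F) + (1-a) * (?G / ?G)"
        using f g by (subst Bochner_Integration.integral_add) auto
      then show ?thesis by simp
    qed
    also have "\<dots> = ?F powr a * ?G powr (1-a)" using F by simp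
    finally show ?thesis .
  qed
qed

lemma Holder_norm:
  fixes f :: "'a \<Rightarrow> 'b::real_normed_vector" and g :: "'a \<Rightarrow> 'c::real_normed_vector"
  assumes p: "1 < p" and f: "integrable M (\<lambda>x. norm (f x) powr p)" and g: "integrable M (\<lambda>x. norm (g x) powr (p/(p-1)))"
  shows "integrable M (\<lambda>x. norm (f x) * norm (g x))"
    and "(\<integral>x. norm (f x) * norm (g x) \<partial>M) \<le> (\<integral>x. norm (f x) powr p \<partial>M) powr (1/p) * (\<integral>x. norm (g x) powr (p/(p-1)) \<partial>M) powr (1 - 1/p)"
proof -
  have a: "0 < 1/p" "1/p < 1" using p by auto
  have "p/(p-1) * (1-1/p) = 1" using p by (simp add: field_simps)
  then have eq: "(norm (f x) powr p) powr (1/p) * (norm (g x) powr (p/(p-1))) powr (1-1/p) = norm (f x) * norm (g x)" for x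
    using p by (simp add: powr_powr)
  show "integrable M (\<lambda>x. norm (f x) * norm (g x))"
    and "(\<integral>x. norm (f x) * norm (g x) \<partial>M) \<le> (\<integral>x. norm (f x) powr p \<partial>M) powr (1/p) * (\<integral>x. norm (g x) powr (p/(p-1)) \<partial>M) powr (1 - 1/p)"
    using Holder_powr[OF a f _ g, unfolded eq] by auto
qed

section \<open>Powers of the norm and the Sobolev inequality for exponents below the
  dimension\<close>

lemma has_derivative_abs_powr:
  fixes t :: real
  assumes "1 < \<gamma>"
  shows "((\<lambda>t. \<bar>t\<bar> powr \<gamma>) has_real_derivative (\<gamma> * sgn t * \<bar>t\<bar> powr (\<gamma>-1))) (at t)"
proof (cases "t = 0")
  case True
  have "((\<lambda>h. \<bar>h\<bar> powr (\<gamma>-1) * sgn h) \<longlongrightarrow> 0) (at (0::real))"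
  proof (rule Lim_null_comparison)
    show "\<forall>\<^sub>F h in at (0::real). norm (\<bar>h\<bar> powr (\<gamma>-1) * sgn h) \<le> \<bar>h\<bar> powr (\<gamma>-1)"
      by (intro always_eventually) (auto simp: abs_mult abs_sgn_eq)
    have "((\<lambda>h. \<bar>h\<bar> powr (\<gamma>-1)) \<longlongrightarrow> \<bar>0\<bar> powr (\<gamma>-1)) (at (0::real))"
      using assms by (intro tendsto_powr' tendsto_intros) auto
    then show "((\<lambda>h. \<bar>h\<bar> powr (\<gamma>-1)) \<longlongrightarrow> 0) (at (0::real))" by simp
  qed
  moreover have "\<bar>h\<bar> powr (\<gamma>-1) * sgn h = (\<bar>0+h\<bar> powr \<gamma> - \<bar>0\<bar> powr \<gamma>) / h" if "h \<noteq> 0" for h :: real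
    using that assms by (cases "h > 0") (auto simp: powr_diff sgn_if divide_simps)
  ultimately have "((\<lambda>h. (\<bar>0+h\<bar> powr \<gamma> - \<bar>0\<bar> powr \<gamma>) / h) \<longlongrightarrow> 0) (at (0::real))"
    by (rule Lim_transform_eventually[OF _ eventually_mono[OF eventually_neq_at_within]]) auto
  then show ?thesis using True assms by (simp add: DERIV_def)
next
  case False
  have "((\<lambda>t. \<bar>t\<bar> powr \<gamma>) has_real_derivative (\<gamma> * \<bar>t\<bar> powr (\<gamma> - 1) * sgn t)) (at t)"
  proof -
    have "(abs has_real_derivative sgn t) (at t)"
      using has_derivative_norm[OF False] by (simp add: has_field_derivative_def real_norm_def[abs_def] mult.commute[of _ "sgn t"])
    then show ?thesis using False by (auto intro!: derivative_eq_intros simp: powr_diff)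
  qed
  then show ?thesis by (simp add: mult_ac)
qed

text \<open>For r < 2 the scalar factor is unbounded near the origin, but the product has norm
  |a|^{r-1}, which tends to 0.\<close>

lemma continuous_on_norm_powr_scaleR:
  assumes "1 < r"
  shows "continuous_on UNIV (\<lambda>a::'b::real_normed_vector. norm a powr (r-2) *\<^sub>R a)"
proof -
  have "isCont (\<lambda>a::'b. norm a powr (r-2) *\<^sub>R a) b" for b
  proof (cases "b = 0")
    case True
    have "((\<lambda>a::'b. norm a powr (r-2) *\<^sub>R a) \<longlongrightarrow> 0) (at 0)"
    proof (rule Lim_null_comparison)
      show "\<forall>\<^sub>F a in at (0::'b). norm (norm a powr (r-2) *\<^sub>R a) \<le> norm a powr (r-1)"
      proof (intro always_eventually allI)
        fix a :: 'b
        show "norm (norm a powr (r-2) *\<^sub>R a) \<le> norm a powr (r-1)"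
          using powr_add[of "norm a" "r-2" 1] by (cases "a = 0") auto
      qed
      have "((\<lambda>a::'b. norm a powr (r-1)) \<longlongrightarrow> norm (0::'b) powr (r-1)) (at 0)"
        using assms by (intro tendsto_powr' tendsto_intros) auto
      then show "((\<lambda>a::'b. norm a powr (r-1)) \<longlongrightarrow> 0) (at 0)" by simp
    qed
    then show ?thesis using True by (simp add: isCont_def)
  next
    case False
    then show ?thesis unfolding isCont_def by (intro tendsto_intros) auto
  qed
  then show ?thesis by (simp add: continuous_at_imp_continuous_on)
qed

lemma integrable_continuous_compact_support:
  fixes h :: "'a::euclidean_space \<Rightarrow> 'b::{banach, second_countable_topology}"
  assumes "continuous_on UNIV h" "compact K" "\<And>x. x \<notin> K \<Longrightarrow> h x = 0"
  shows "integrable lborel h" "integrable lebesgue h"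
proof -
  have "integrable lborel (\<lambda>x. indicator K x *\<^sub>R h x)"
    by (rule borel_integrable_compact) (use assms(2) in \<open>auto intro: continuous_on_subset[OF assms(1)]\<close>)
  moreover have "indicator K x *\<^sub>R h x = h x" for x using assms(3)[of x] by (auto simp: indicator_def)
  ultimately show "integrable lborel h" by simp
  moreover have "h \<in> borel_measurable borel" using assms(1) by (rule borel_measurable_continuous_onI)
  ultimately show "integrable lebesgue h" by (subst integrable_completion) auto
qed

lemma C1c_integrable:
  assumes "C1c S \<phi> g" and p: "0 < p"
  shows "integrable lebesgue (\<lambda>x. \<bar>\<phi> x\<bar> powr p)" "integrable lebesgue (\<lambda>x. norm (g x) powr p)"
proof -
  obtain K where K: "compact K" "\<And>x. x \<notin> K \<Longrightarrow> \<phi> x = 0 \<and> g x = 0" using assms by (auto simp: C1c_def)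
  show "integrable lebesgue (\<lambda>x. \<bar>\<phi> x\<bar> powr p)"
    by (rule integrable_continuous_compact_support(2)[OF _ K(1)])
      (use C1c_continuous[OF assms(1)] K p in \<open>auto intro!: continuous_on_powr' continuous_on_rabs continuous_on_norm continuous_on_const\<close>)
  show "integrable lebesgue (\<lambda>x. norm (g x) powr p)"
    by (rule integrable_continuous_compact_support(2)[OF _ K(1)])
      (use C1c_continuous[OF assms(1)] K p in \<open>auto intro!: continuous_on_powr' continuous_on_rabs continuous_on_norm continuous_on_const\<close>)
qed

lemma C1c_compose:
  assumes c: "C1c S \<phi> g" and F: "\<And>t. (F has_real_derivative F' t) (at t)" "continuous_on UNIV F'" "F 0 = 0"
  shows "C1c S (\<lambda>x. F (\<phi> x)) (\<lambda>x. F' (\<phi> x) *\<^sub>R g x)"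
proof -
  obtain K where K: "compact K" "K \<subseteq> S" "\<And>x. x \<notin> K \<Longrightarrow> \<phi> x = 0 \<and> g x = 0" using c by (auto simp: C1c_def)
  have "((\<lambda>x. F (\<phi> x)) has_derivative (\<lambda>h. (F' (\<phi> x) *\<^sub>R g x) \<bullet> h)) (at x)" for x
    unfolding inner_scaleR_left by (rule has_derivative_compose[OF _ F(1)[unfolded has_field_derivative_def]])
       (use c in \<open>auto simp: C1c_def is_grad_def\<close>)
  moreover have "continuous_on UNIV (\<lambda>x. F' (\<phi> x))"
    using continuous_on_compose2[OF F(2) C1c_continuous(1)[OF c]] by auto
  ultimately show ?thesis unfolding C1c_def is_grad_def using K F(3) C1c_continuous(2)[OF c]
    by (auto intro!: continuous_intros exI[of _ K] simp del: inner_scaleR_left)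
qed

text \<open>The L^1 gradient bound is applied to |\<phi>|^\<gamma>, whose gradient is split by
  Hoelder's inequality. The choice \<gamma> = p(n-1)/(n-p) is the one for which \<gamma> n/(n-1) and
  (\<gamma>-1) p/(p-1) both equal \<open>r\<close>, so the same integral of |\<phi>|^r stands on
  both sides.\<close>

lemma sobolev_C1c:
  fixes S :: "'a::euclidean_space set"
  assumes N: "DIM('a) \<ge> 2" and S: "bounded S" and p: "1 < p" "p < real DIM('a)"
  defines "r \<equiv> pstar (real DIM('a)) p"
  shows "\<exists>C\<ge>0. \<forall>\<phi> g. C1c S \<phi> g \<longrightarrow>
    (\<integral>x. \<bar>\<phi> x\<bar> powr r \<partial>lebesgue) \<le> C * (\<integral>x. norm (g x) powr p \<partial>lebesgue) powr (r/p)"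
proof -
  define n where "n = real DIM('a)"
  have n: "n \<ge> 2" "p < n" using N p by (auto simp: n_def)
  define n' where "n' = n/(n-1)"
  define \<gamma> where "\<gamma> = p*(n-1)/(n-p)"
  \<comment> \<open>Hoelder's inequality returns the integral of |\<phi>|^r with exponent (1-1/p) n'
    on the right; \<open>e\<close> is what remains after division, and it is positive because p <
    n.\<close>
  define e where "e = 1 - (1-1/p)*n'"
  have r: "r = n*p/(n-p)" by (simp add: r_def pstar_def n_def)
  have np: "n' > 0" using n by (simp add: n'_def)
  have \<gamma>: "\<gamma> > 1" "\<gamma> * n' = r" "(\<gamma>-1)*(p/(p-1)) = r"
  proof -
    have g1: "\<gamma> - 1 = n*(p-1)/(n-p)" using n by (simp add: \<gamma>_def field_simps)
    have "n*(p-1)/(n-p) > 0" using n p(1) by simp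
    then show "\<gamma> > 1" using g1 by linarith
    show "\<gamma> * n' = r" using n by (simp add: \<gamma>_def n'_def r)
    show "(\<gamma>-1)*(p/(p-1)) = r" unfolding g1 r using p(1) by simp
  qed
  have e: "e > 0" "n'/(p*e) = r/p"
  proof -
    have e': "e = (n-p)/(p*(n-1))" unfolding e_def n'_def using n p(1) by (simp add: field_simps)
    then show "e > 0" using n p(1) by simp
    have "p*e = (n-p)/(n-1)" unfolding e' using p(1) by simp
    then show "n'/(p*e) = r/p" unfolding n'_def r using n p(1) by simp
  qed
  obtain R where R: "0 < R" "\<And>x. x \<in> S \<Longrightarrow> norm x < R"
    using S unfolding bounded_pos_less by blast
  have SB: "S \<subseteq> box (- R *\<^sub>R One) (R *\<^sub>R One)"
  proof
    fix x assume "x \<in> S"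
    have "\<bar>x \<bullet> i\<bar> < R" if "i \<in> Basis" for i
      using Basis_le_norm[OF that, of x] R(2)[OF \<open>x \<in> S\<close>] by linarith
    then show "x \<in> box (- R *\<^sub>R One) (R *\<^sub>R One)" by (auto simp: box_def abs_less_iff minus_less_iff)
  qed
  define C1 where "C1 = (2*R)^DIM('a) * (2*R) powr n' / ((2*R)^DIM('a)) powr n'"
  define C where "C = (C1 * \<gamma> powr n') powr (1/e)"
  have C1: "C1 \<ge> 0" using R by (simp add: C1_def)
  have "(\<integral>x. \<bar>\<phi> x\<bar> powr r \<partial>lebesgue) \<le> C * (\<integral>x. norm (g x) powr p \<partial>lebesgue) powr (r/p)" if c: "C1c S \<phi> g" for \<phi> g
  proof -
    define X where "X = (\<integral>x. \<bar>\<phi> x\<bar> powr r \<partial>lebesgue)"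
    define Y where "Y = (\<integral>x. norm (g x) powr p \<partial>lebesgue)"
    have XY0: "X \<ge> 0" "Y \<ge> 0" by (auto simp: X_def Y_def)
    have c': "C1c (box (- R *\<^sub>R One) (R *\<^sub>R One)) \<phi> g" using c SB unfolding C1c_def by blast
    let ?s = "\<lambda>t. \<gamma> * sgn t * \<bar>t\<bar> powr (\<gamma>-1)"
    have eq: "\<gamma> * (norm t powr (\<gamma>-2) *\<^sub>R t) = ?s t" for t :: real
      using powr_add[of "\<bar>t\<bar>" "\<gamma>-2" 1] by (cases "t = 0") (auto simp: sgn_if)
    have "continuous_on UNIV (\<lambda>t::real. \<gamma> * (norm t powr (\<gamma>-2) *\<^sub>R t))"
      using \<gamma>(1) by (intro continuous_on_mult_left continuous_on_norm_powr_scaleR)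
    then have cont_s: "continuous_on UNIV ?s" by (rule continuous_on_eq) (rule eq)
    have cs: "C1c (box (- R *\<^sub>R One) (R *\<^sub>R One)) (\<lambda>x. \<bar>\<phi> x\<bar> powr \<gamma>) (\<lambda>x. ?s (\<phi> x) *\<^sub>R g x)"
      by (rule C1c_compose[OF c' has_derivative_abs_powr[OF \<gamma>(1)] cont_s]) simp
    have [measurable]: "\<phi> \<in> borel_measurable borel" "g \<in> borel_measurable borel"
      using C1c_continuous[OF c] by (auto intro: borel_measurable_continuous_onI)
    have Z: "norm (?s (\<phi> x) *\<^sub>R g x) = \<gamma> * (norm (g x) * norm (\<bar>\<phi> x\<bar> powr (\<gamma>-1)))" for x
      using \<gamma>(1) by (auto simp: abs_mult abs_sgn_eq)
    define Z where "Z = (\<integral>x. norm (g x) * norm (\<bar>\<phi> x\<bar> powr (\<gamma>-1)) \<partial>lebesgue)"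
    have Z0: "Z \<ge> 0" by (simp add: Z_def)
    have Zleb: "(\<integral>x. norm (?s (\<phi> x) *\<^sub>R g x) \<partial>lborel) = \<gamma> * Z"
      unfolding Z Z_def by (simp add: integral_completion)
    have "X = (\<integral>x. \<bar>\<bar>\<phi> x\<bar> powr \<gamma>\<bar> powr (n/(n-1)) \<partial>lborel)"
      unfolding X_def using \<gamma>(2) by (subst integral_completion) (auto simp: powr_powr n'_def)
    also have "\<dots> \<le> (2*R)^DIM('a) * (2*R) powr (n/(n-1)) * ((\<integral>x. norm (?s (\<phi> x) *\<^sub>R g x) \<partial>lborel) / (2*R)^DIM('a)) powr (n/(n-1))"
      unfolding n_def by (rule gagliardo_nirenberg_box[OF N R(1) cs])
    also have "\<dots> = C1 * (\<gamma> * Z) powr n'" unfolding Zleb using Z0 R \<gamma> by (simp add: powr_divide C1_def n'_def)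
    finally have X1: "X \<le> C1 * (\<gamma> * Z) powr n'" .
    have "Z \<le> Y powr (1/p) * X powr (1-1/p)"
    proof -
      have eq: "norm (\<bar>\<phi> x\<bar> powr (\<gamma>-1)) powr (p/(p-1)) = \<bar>\<phi> x\<bar> powr r" for x
        using \<gamma>(3) by (simp add: powr_powr)
      have r0: "r > 0" using n p by (simp add: r)
      show ?thesis unfolding Z_def Y_def X_def
        using Holder_norm(2)[OF p(1) C1c_integrable(2)[OF c, of p], of "\<lambda>x. \<bar>\<phi> x\<bar> powr (\<gamma>-1)", unfolded eq]
          C1c_integrable(1)[OF c r0] p by auto
    qed
    then have "C1 * (\<gamma> * Z) powr n' \<le> C1 * (\<gamma> * (Y powr (1/p) * X powr (1-1/p))) powr n'"
      using C1 \<gamma> Z0 np by (intro mult_left_mono powr_mono2) auto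
    also have "\<dots> = C1 * \<gamma> powr n' * Y powr (n'/p) * X powr (1-e)"
      using \<gamma> by (simp add: powr_mult powr_powr e_def)
    finally have X2: "X \<le> C1 * \<gamma> powr n' * Y powr (n'/p) * X powr (1-e)" using X1 by simp
    \<comment> \<open>The integral \<open>X\<close> is a genuine one, \<phi> being continuous with
      compact support, so its lower power on the right may be divided out unless it is zero.\<close>
    have "X \<le> C * Y powr (r/p)"
    proof (cases "X = 0")
      case True then show ?thesis by (simp add: C_def)
    next
      case False
      then have X: "X > 0" using XY0 by auto
      have "X powr e = X / X powr (1-e)" using X by (simp add: powr_diff)
      also have "\<dots> \<le> C1 * \<gamma> powr n' * Y powr (n'/p)" using X X2 by (simp add: divide_le_eq)
      finally have "(X powr e) powr (1/e) \<le> (C1 * \<gamma> powr n' * Y powr (n'/p)) powr (1/e)"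
        using e by (intro powr_mono2) auto
      also have "\<dots> = C * Y powr (n'/(p*e))"
        using C1 by (simp add: powr_mult powr_powr C_def)
      finally show ?thesis using X e by (simp add: powr_powr)
    qed
    then show ?thesis by (simp add: X_def Y_def)
  qed
  then show ?thesis by (intro exI[of _ C]) (auto simp: C_def)
qed

section \<open>Smooth test functions\<close>

text \<open>Coinduction for smoothness: partial derivatives inside \<open>S\<close> are chosen once
  for each member, and iterating this choice along a list of directions produces the whole family
  that \<open>Cinf\<close> asks for.\<close>

lemma Cinf_coinduct:
  fixes S :: "('a::euclidean_space \<Rightarrow> real) set"
  assumes "f \<in> S"
    and step: "\<And>f. f \<in> S \<Longrightarrow> \<exists>d. (\<forall>i. d i \<in> S) \<and> (\<forall>x. (f has_derivative (\<lambda>h. \<Sum>i\<in>Basis. (h \<bullet> i) * d i x)) (at x))"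
  shows "Cinf f"
proof -
  have "\<forall>f\<in>S. \<exists>d. (\<forall>i. d i \<in> S) \<and> (\<forall>x. (f has_derivative (\<lambda>h. \<Sum>i\<in>Basis. (h \<bullet> i) * d i x)) (at x))"
    using step by blast
  from bchoice[OF this] obtain d where d: "\<And>f i. f \<in> S \<Longrightarrow> d f i \<in> S"
    "\<And>f x. f \<in> S \<Longrightarrow> (f has_derivative (\<lambda>h. \<Sum>i\<in>Basis. (h \<bullet> i) * d f i x)) (at x)"
    by auto
  define D where "D es = foldr (\<lambda>i F. d F i) es f" for es
  have DS: "D es \<in> S" for es by (induction es) (auto simp: D_def \<open>f \<in> S\<close> d(1))
  show ?thesis unfolding Cinf_def
  proof (intro exI[of _ D] conjI allI)
    show "D [] = f" by (simp add: D_def)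
    fix es x
    show "(D es has_derivative (\<lambda>h. \<Sum>i\<in>Basis. (h \<bullet> i) * D (i # es) x)) (at x)"
      using d(2)[OF DS[of es], of x] by (simp add: D_def)
  qed
qed

lemma Cinf_partials:
  assumes "Cinf f"
  obtains d where "\<And>i. Cinf (d i)" "\<And>x. (f has_derivative (\<lambda>h. \<Sum>i\<in>Basis. (h \<bullet> i) * d i x)) (at x)"
proof -
  obtain D where D: "D [] = f" "\<And>es x. (D es has_derivative (\<lambda>h. \<Sum>i\<in>Basis. (h \<bullet> i) * D (i # es) x)) (at x)"
    using assms unfolding Cinf_def by blast
  show ?thesis
  proof (rule that[of "\<lambda>i. D [i]"])
    \<comment> \<open>New directions are added at the head of the list, so the family belonging to
      the derivative in direction \<open>i\<close> keeps \<open>i\<close> at the end.\<close>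
    show "Cinf (D [i])" for i unfolding Cinf_def
      by (rule exI[of _ "\<lambda>es. D (es @ [i])"]) (use D(2) in auto)
    show "(f has_derivative (\<lambda>h. \<Sum>i\<in>Basis. (h \<bullet> i) * D [i] x)) (at x)" for x
      using D(2)[of "[]" x] D(1) by simp
  qed
qed

text \<open>Product and quotient rules for iterated derivatives are avoided: this algebra is closed
  under first partial derivatives by structural induction, so coinduction makes all its members
  smooth.\<close>

inductive_set Cinf_algebra :: "('a::euclidean_space \<Rightarrow> real) set" where
  Cinf: "Cinf f \<Longrightarrow> f \<in> Cinf_algebra"
| const: "(\<lambda>x. c) \<in> Cinf_algebra"
| add: "f \<in> Cinf_algebra \<Longrightarrow> g \<in> Cinf_algebra \<Longrightarrow> (\<lambda>x. f x + g x) \<in> Cinf_algebra"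
| mult: "f \<in> Cinf_algebra \<Longrightarrow> g \<in> Cinf_algebra \<Longrightarrow> (\<lambda>x. f x * g x) \<in> Cinf_algebra"
| inverse: "f \<in> Cinf_algebra \<Longrightarrow> (\<And>x. f x \<noteq> 0) \<Longrightarrow> (\<lambda>x. inverse (f x)) \<in> Cinf_algebra"

lemma Cinf_algebra_partials:
  assumes "f \<in> Cinf_algebra"
  shows "\<exists>d. (\<forall>i. d i \<in> Cinf_algebra) \<and> (\<forall>x. (f has_derivative (\<lambda>h. \<Sum>i\<in>Basis. (h \<bullet> i) * d i x)) (at x))"
  using assms
proof induction
  case (Cinf f)
  obtain d where d: "\<And>i. Cinf (d i)" "\<And>x. (f has_derivative (\<lambda>h. \<Sum>i\<in>Basis. (h \<bullet> i) * d i x)) (at x)"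
    by (rule Cinf_partials[OF Cinf], rule that)
  show ?case by (intro exI[of _ d] conjI allI Cinf_algebra.Cinf d)
next
  case (const c)
  then show ?case by (intro exI[of _ "\<lambda>i x. 0"]) (auto intro: Cinf_algebra.const)
next
  case (add f g)
  then obtain d e where d: "\<And>i. d i \<in> Cinf_algebra" "\<And>x. (f has_derivative (\<lambda>h. \<Sum>i\<in>Basis. (h \<bullet> i) * d i x)) (at x)"
    and e: "\<And>i. e i \<in> Cinf_algebra" "\<And>x. (g has_derivative (\<lambda>h. \<Sum>i\<in>Basis. (h \<bullet> i) * e i x)) (at x)" by blast
  show ?case
    by (intro exI[of _ "\<lambda>i x. d i x + e i x"] conjI allI Cinf_algebra.add d e has_derivative_eq_rhs[OF has_derivative_add[OF d(2) e(2)]])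
      (simp add: sum.distrib algebra_simps)
next
  case (mult f g)
  then obtain d e where d: "\<And>i. d i \<in> Cinf_algebra" "\<And>x. (f has_derivative (\<lambda>h. \<Sum>i\<in>Basis. (h \<bullet> i) * d i x)) (at x)"
    and e: "\<And>i. e i \<in> Cinf_algebra" "\<And>x. (g has_derivative (\<lambda>h. \<Sum>i\<in>Basis. (h \<bullet> i) * e i x)) (at x)" by blast
  show ?case
    by (intro exI[of _ "\<lambda>i x. f x * e i x + d i x * g x"] conjI allI Cinf_algebra.add Cinf_algebra.mult mult.hyps d e
        has_derivative_eq_rhs[OF has_derivative_mult[OF d(2) e(2)]])
      (simp add: sum.distrib algebra_simps sum_distrib_left)
next
  case (inverse f)
  then obtain d where d: "\<And>i. d i \<in> Cinf_algebra" "\<And>x. (f has_derivative (\<lambda>h. \<Sum>i\<in>Basis. (h \<bullet> i) * d i x)) (at x)" by blast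
  show ?case
    by (intro exI[of _ "\<lambda>i x. (-1) * ((inverse (f x) * inverse (f x)) * d i x)"] conjI allI Cinf_algebra.mult Cinf_algebra.const
        Cinf_algebra.inverse inverse.hyps d has_derivative_eq_rhs[OF Deriv.has_derivative_inverse[OF _ d(2)]])
      (auto simp: sum_distrib_left sum_distrib_right sum_negf algebra_simps inverse.hyps)
qed

lemma Cinf_algebra_Cinf: "f \<in> Cinf_algebra \<Longrightarrow> Cinf f"
  by (rule Cinf_coinduct[OF _ Cinf_algebra_partials])

lemma Cinf_algebra_power: "f \<in> Cinf_algebra \<Longrightarrow> (\<lambda>x. f x ^ m) \<in> Cinf_algebra"
  by (induction m) (auto intro: Cinf_algebra.intros)

lemma Cinf_affine:
  fixes f :: "'a::euclidean_space \<Rightarrow> real"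
  assumes "Cinf f" shows "Cinf (\<lambda>x. f (b + c *\<^sub>R x))"
proof -
  obtain D where D: "D [] = f" "\<And>es x. (D es has_derivative (\<lambda>h. \<Sum>i\<in>Basis. (h \<bullet> i) * D (i # es) x)) (at x)"
    using assms unfolding Cinf_def by blast
  have "((\<lambda>x. c ^ length es * D es (b + c *\<^sub>R x)) has_derivative
    (\<lambda>h. \<Sum>i\<in>Basis. (h \<bullet> i) * (c ^ length (i # es) * D (i # es) (b + c *\<^sub>R x)))) (at x)" for es x
  proof -
    have "((\<lambda>x. D es (b + c *\<^sub>R x)) has_derivative (\<lambda>h. \<Sum>i\<in>Basis. ((c *\<^sub>R h) \<bullet> i) * D (i # es) (b + c *\<^sub>R x))) (at x)"
      by (rule has_derivative_compose[OF _ D(2)]) (auto intro!: derivative_eq_intros)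
    then show ?thesis
      by (rule has_derivative_eq_rhs[OF has_derivative_mult_right]) (simp add: sum_distrib_left algebra_simps)
  qed
  then show ?thesis unfolding Cinf_def using D(1)
    by (intro exI[of _ "\<lambda>es x. c ^ length es * D es (b + c *\<^sub>R x)"]) auto
qed

lemma test_funI:
  assumes "Cinf \<psi>" "compact K" "K \<subseteq> \<Omega>" "\<And>x. x \<notin> K \<Longrightarrow> \<psi> x = 0"
  shows "test_fun \<Omega> \<psi>"
proof -
  have "{x. \<psi> x \<noteq> 0} \<subseteq> K" using assms(4) by auto
  then have "closure {x. \<psi> x \<noteq> 0} \<subseteq> K"
    using assms(2) by (simp add: closure_minimal compact_imp_closed)
  moreover have "compact (closure {x. \<psi> x \<noteq> 0})"
    using calculation assms(2) by (metis closed_closure compact_Int_closed inf.absorb_iff2)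
  ultimately show ?thesis unfolding test_fun_def using assms by auto
qed

lemma test_funE:
  assumes "test_fun \<Omega> \<psi>"
  obtains K where "Cinf \<psi>" "compact K" "K \<subseteq> \<Omega>" "\<And>x. x \<notin> K \<Longrightarrow> \<psi> x = 0"
  using assms closure_subset unfolding test_fun_def by (metis (mono_tags, lifting) mem_Collect_eq subsetD)

text \<open>The coordinates of the gradient are again \<open>Cinf\<close>, hence differentiable and
  continuous; off the support the function is locally zero and so is its gradient.\<close>

lemma test_fun_C1c:
  assumes t: "test_fun \<Omega> \<phi>" and g: "is_grad \<phi> g"
  shows "C1c \<Omega> \<phi> g"
proof -
  obtain K where K: "Cinf \<phi>" "compact K" "K \<subseteq> \<Omega>" "\<And>x. x \<notin> K \<Longrightarrow> \<phi> x = 0" by (rule test_funE[OF t], rule that)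
  obtain d where d: "\<And>i. Cinf (d i)" "\<And>x. (\<phi> has_derivative (\<lambda>h. \<Sum>i\<in>Basis. (h \<bullet> i) * d i x)) (at x)"
    by (rule Cinf_partials[OF K(1)], rule that)
  have gd: "g x \<bullet> i = d i x" if "i \<in> Basis" for x i
  proof -
    have "(\<lambda>h. g x \<bullet> h) = (\<lambda>h. \<Sum>i\<in>Basis. (h \<bullet> i) * d i x)"
      using g d(2)[of x] unfolding is_grad_def by (metis has_derivative_unique)
    then have "g x \<bullet> i = (\<Sum>j\<in>Basis. (i \<bullet> j) * d j x)" by metis
    also have "\<dots> = d i x" using that by (simp add: inner_Basis if_distrib if_distribR sum.delta cong: if_cong)
    finally show ?thesis .
  qed
  have dc: "continuous_on UNIV (d i)" for i
  proof -
    obtain e where "\<And>x. (d i has_derivative (\<lambda>h. \<Sum>j\<in>Basis. (h \<bullet> j) * e j x)) (at x)"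
      by (rule Cinf_partials[OF d(1)[of i]], rule that)
    then show ?thesis by (meson continuous_at_imp_continuous_on has_derivative_continuous)
  qed
  have "g = (\<lambda>x. \<Sum>i\<in>Basis. d i x *\<^sub>R i)"
    by (rule ext, subst euclidean_representation[symmetric]) (auto simp: gd intro!: sum.cong)
  then have gc: "continuous_on UNIV g" using dc by (auto intro!: continuous_intros)
  have "g x = 0" if "x \<notin> K" for x
  proof -
    have "(\<phi> has_derivative (\<lambda>h. 0)) (at x)"
      by (rule has_derivative_transform_within_open[of "\<lambda>_. 0" _ _ UNIV "- K"])
        (use that K compact_imp_closed in auto)
    then have "(\<lambda>h. g x \<bullet> h) = (\<lambda>h. 0)"
      using g unfolding is_grad_def by (metis has_derivative_unique)
    then show ?thesis by (metis inner_eq_zero_iff)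
  qed
  then show ?thesis unfolding C1c_def using g gc K by blast
qed

lemma is_grad_diff: "is_grad f g \<Longrightarrow> is_grad f' g' \<Longrightarrow> is_grad (\<lambda>x. f x - t * f' x) (\<lambda>x. g x - t *\<^sub>R g' x)"
  unfolding is_grad_def
  by (auto intro!: derivative_eq_intros simp: inner_diff_left)

lemma test_fun_diff:
  assumes "test_fun \<Omega> f" "test_fun \<Omega> f'" shows "test_fun \<Omega> (\<lambda>x. f x - t * f' x)"
proof -
  obtain K where K: "Cinf f" "compact K" "K \<subseteq> \<Omega>" "\<And>x. x \<notin> K \<Longrightarrow> f x = 0" by (rule test_funE[OF assms(1)], rule that)
  obtain K' where K': "Cinf f'" "compact K'" "K' \<subseteq> \<Omega>" "\<And>x. x \<notin> K' \<Longrightarrow> f' x = 0" by (rule test_funE[OF assms(2)], rule that)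
  have "(\<lambda>x. f x + (-t) * f' x) \<in> Cinf_algebra"
    using K(1) K'(1) by (intro Cinf_algebra.intros)
  then have "Cinf (\<lambda>x. f x - t * f' x)" by (simp add: Cinf_algebra_Cinf)
  then show ?thesis
    by (rule test_funI[of _ "K \<union> K'"]) (use K K' in auto)
qed

text \<open>Translation invariance of Lebesgue measure makes every difference quotient integrate to
  zero; dominated convergence, with the mean value inequality as bound, passes to the
  derivative.\<close>

lemma integral_partial_eq_0:
  fixes \<eta> :: "'a::euclidean_space \<Rightarrow> real"
  assumes c: "C1c S \<eta> g" and i: "i \<in> Basis"
  shows "(\<integral>x. g x \<bullet> i \<partial>lebesgue) = 0"
proof -
  obtain K where K: "compact K" "\<And>x. x \<notin> K \<Longrightarrow> \<eta> x = 0 \<and> g x = 0" using c by (auto simp: C1c_def)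
  obtain B where B: "\<And>x. norm (g x) \<le> B" "0 \<le> B" using C1c_bounded[OF c] by blast
  have grad: "\<And>x. (\<eta> has_derivative (\<lambda>h. g x \<bullet> h)) (at x)" using c by (auto simp: C1c_def is_grad_def)
  have [measurable]: "\<eta> \<in> borel_measurable borel" "g \<in> borel_measurable borel"
    using C1c_continuous[OF c] by (auto intro: borel_measurable_continuous_onI)
  define t where "t n = inverse (real (Suc n))" for n
  have t: "t n > 0" "t n \<le> 1" for n by (auto simp: t_def divide_simps)
  have t0: "t \<longlonglongrightarrow> 0" unfolding t_def by (rule LIMSEQ_inverse_real_of_nat)
  have chi_int: "integrable lborel \<eta>"
    using integrable_continuous_compact_support(1)[OF C1c_continuous(1)[OF c] K(1)] K(2) by auto
  have trans: "(\<integral>x. \<eta> (s *\<^sub>R i + x) \<partial>lborel) = (\<integral>x. \<eta> x \<partial>lborel)" "integrable lborel (\<lambda>x. \<eta> (s *\<^sub>R i + x))" for s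
  proof -
    have d: "lborel = distr lborel borel (\<lambda>x. s *\<^sub>R i + x)"
      using lborel_distr_plus[of "s *\<^sub>R i"] by simp
    have i2: "integrable (distr lborel borel (\<lambda>x. s *\<^sub>R i + x)) \<eta>" using chi_int d by simp
    show "integrable lborel (\<lambda>x. \<eta> (s *\<^sub>R i + x))" using i2 by (subst (asm) integrable_distr_eq) auto
    have "(\<integral>x. \<eta> x \<partial>distr lborel borel (\<lambda>x. s *\<^sub>R i + x)) = (\<integral>x. \<eta> (s *\<^sub>R i + x) \<partial>lborel)"
      by (subst integral_distr) auto
    then show "(\<integral>x. \<eta> (s *\<^sub>R i + x) \<partial>lborel) = (\<integral>x. \<eta> x \<partial>lborel)" using d by simp
  qed
  \<comment> \<open>This enlargement contains the supports of all difference quotients with step at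
    most 1 and therefore carries the dominating function.\<close>
  define K' where "K' = {x - y | x y. x \<in> K \<and> y \<in> cball 0 1}"
  have K': "compact K'" unfolding K'_def by (rule compact_differences[OF K(1) compact_cball])
  have K'I: "x - y \<in> K'" if "x \<in> K" "norm y \<le> 1" for x y
    unfolding K'_def using that by (intro CollectI exI[of _ x] exI[of _ y]) auto
  have lim: "(\<lambda>n. (\<integral>x. (\<eta> (t n *\<^sub>R i + x) - \<eta> x) / t n \<partial>lborel)) \<longlonglongrightarrow> (\<integral>x. g x \<bullet> i \<partial>lborel)"
  proof (rule integral_dominated_convergence)
    show "integrable lborel (\<lambda>x. indicator K' x * B)"
      using borel_integrable_compact[OF K', of "\<lambda>_. B"] by simp
    show "AE x in lborel. (\<lambda>n. (\<eta> (t n *\<^sub>R i + x) - \<eta> x) / t n) \<longlonglongrightarrow> g x \<bullet> i"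
    proof (rule AE_I2)
      fix x
      have "((\<lambda>s. \<eta> (s *\<^sub>R i + x)) has_real_derivative (g x \<bullet> i)) (at 0)"
      proof -
        have "((\<lambda>s. \<eta> (s *\<^sub>R i + x)) has_derivative (\<lambda>h. g x \<bullet> (h *\<^sub>R i))) (at 0)"
          by (rule has_derivative_compose[where g=\<eta> and g'="\<lambda>h. g x \<bullet> h"])
            (use grad[of x] in \<open>auto intro!: derivative_eq_intros\<close>)
        then show ?thesis by (simp add: has_field_derivative_def mult.commute[of _ "g x \<bullet> i"])
      qed
      then have "((\<lambda>s. (\<eta> (s *\<^sub>R i + x) - \<eta> x) / s) \<longlongrightarrow> g x \<bullet> i) (at 0)"
        by (simp add: DERIV_def)
      then show "(\<lambda>n. (\<eta> (t n *\<^sub>R i + x) - \<eta> x) / t n) \<longlonglongrightarrow> g x \<bullet> i"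
        by (rule filterlim_compose[of _ _ "at 0"]) (use t0 t in \<open>auto simp: filterlim_at less_imp_neq[THEN not_sym]\<close>)
    qed
    show "AE x in lborel. norm ((\<eta> (t n *\<^sub>R i + x) - \<eta> x) / t n) \<le> indicator K' x * B" for n
    proof (rule AE_I2)
      fix x
      show "norm ((\<eta> (t n *\<^sub>R i + x) - \<eta> x) / t n) \<le> indicator K' x * B"
      proof (cases "x \<in> K'")
        case True
        have "norm (\<eta> (t n *\<^sub>R i + x) - \<eta> x) \<le> B * norm (t n *\<^sub>R i + x - x)"
        proof (rule differentiable_bound[of UNIV \<eta> "\<lambda>x h. g x \<bullet> h"])
          show "onorm (\<lambda>h. g x \<bullet> h) \<le> B" for x
          proof (rule onorm_le)
            fix h
            have "\<bar>g x \<bullet> h\<bar> \<le> norm (g x) * norm h" by (rule Cauchy_Schwarz_ineq2)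
            also have "\<dots> \<le> B * norm h" using B by (intro mult_right_mono) auto
            finally show "norm (g x \<bullet> h) \<le> B * norm h" by simp
          qed
        qed (use grad in auto)
        then show ?thesis using True i t[of n] by (simp add: field_simps)
      next
        case False
        have "x \<notin> K"
        proof
          assume "x \<in> K" then have "x - 0 \<in> K'" by (rule K'I) simp
          then show False using False by simp
        qed
        moreover have "t n *\<^sub>R i + x \<notin> K"
        proof
          assume "t n *\<^sub>R i + x \<in> K"
          then have "(t n *\<^sub>R i + x) - t n *\<^sub>R i \<in> K'" by (rule K'I) (use t[of n] i in auto)
          then show False using False by simp
        qed
        ultimately show ?thesis using K(2) B by simp
      qed
    qed
  qed auto
  have "(\<integral>x. (\<eta> (t n *\<^sub>R i + x) - \<eta> x) / t n \<partial>lborel) = 0" for n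
    using trans chi_int by simp
  from lim[unfolded this] have "(\<integral>x. g x \<bullet> i \<partial>lborel) = 0" by (simp add: LIMSEQ_const_iff)
  then show ?thesis by (subst integral_completion) auto
qed

lemma C1c_integral_by_parts:
  fixes \<phi> :: "'a::euclidean_space \<Rightarrow> real"
  assumes c: "C1c S \<phi> g" and c': "C1c S' \<psi> h" and i: "i \<in> Basis"
  shows "(\<integral>x. \<phi> x * (h x \<bullet> i) \<partial>lebesgue) = - (\<integral>x. (g x \<bullet> i) * \<psi> x \<partial>lebesgue)"
proof -
  obtain K where K: "compact K" "\<And>x. x \<notin> K \<Longrightarrow> \<phi> x = 0 \<and> g x = 0" using c by (auto simp: C1c_def)
  have grad: "\<And>x. (\<phi> has_derivative (\<lambda>h. g x \<bullet> h)) (at x)" "\<And>x. (\<psi> has_derivative (\<lambda>k. h x \<bullet> k)) (at x)"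
    using c c' by (auto simp: C1c_def is_grad_def)
  have "C1c UNIV (\<lambda>x. \<phi> x * \<psi> x) (\<lambda>x. \<phi> x *\<^sub>R h x + \<psi> x *\<^sub>R g x)"
    unfolding C1c_def is_grad_def
  proof (intro conjI allI exI[of _ K])
    show "((\<lambda>x. \<phi> x * \<psi> x) has_derivative (\<bullet>) (\<phi> x *\<^sub>R h x + \<psi> x *\<^sub>R g x)) (at x)" for x
      by (rule has_derivative_eq_rhs[OF has_derivative_mult[OF grad]]) (auto simp: inner_add_left)
  qed (use K C1c_continuous[OF c] C1c_continuous[OF c'] in \<open>auto intro!: continuous_intros\<close>)
  from integral_partial_eq_0[OF this i]
  have "(\<integral>x. \<phi> x * (h x \<bullet> i) + (g x \<bullet> i) * \<psi> x \<partial>lebesgue) = 0"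
    by (simp add: inner_add_left mult.commute)
  moreover have "integrable lebesgue (\<lambda>x. \<phi> x * (h x \<bullet> i))" "integrable lebesgue (\<lambda>x. (g x \<bullet> i) * \<psi> x)"
    using K C1c_continuous[OF c] C1c_continuous[OF c']
    by (auto intro!: integrable_continuous_compact_support(2)[OF _ K(1)] continuous_intros)
  ultimately show ?thesis by simp
qed

section \<open>Convergence in \<open>L\<^sup>p\<close> and Sobolev functions vanishing on the boundary\<close>

text \<open>A crude substitute for Minkowski's inequality, valid for every p \<ge> 0. It serves for
  integrability, for convergence to zero and for bounds whose constants are immaterial.\<close>

lemma norm_add_powr_le:
  fixes a b :: "'b::real_normed_vector"
  assumes "0 \<le> p"
  shows "norm (a + b) powr p \<le> 2 powr p * (norm a powr p + norm b powr p)"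
proof -
  have "norm (a + b) powr p \<le> (2 * max (norm a) (norm b)) powr p"
    using assms norm_triangle_ineq[of a b] by (intro powr_mono2) auto
  also have "\<dots> = 2 powr p * max (norm a) (norm b) powr p"
    by (subst powr_mult) (auto simp: max_def)
  also have "max (norm a) (norm b) powr p \<le> norm a powr p + norm b powr p"
    by (auto simp: max_def)
  finally show ?thesis by simp
qed

definition in_Lp :: "real \<Rightarrow> ('a::euclidean_space \<Rightarrow> 'b::euclidean_space) \<Rightarrow> bool" where
  "in_Lp p f \<longleftrightarrow> f \<in> borel_measurable lebesgue \<and> integrable lebesgue (\<lambda>x. norm (f x) powr p)"

lemma in_Lp_bound:
  assumes g: "in_Lp p g" and f: "f \<in> borel_measurable lebesgue" and le: "\<And>x. norm (f x) \<le> C * norm (g x)" and p: "0 \<le> p" "0 \<le> C"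
  shows "in_Lp p f"
  unfolding in_Lp_def
proof
  show "integrable lebesgue (\<lambda>x. norm (f x) powr p)"
  proof (rule Bochner_Integration.integrable_bound)
    show "integrable lebesgue (\<lambda>x. C powr p * norm (g x) powr p)" using g by (simp add: in_Lp_def)
    show "AE x in lebesgue. norm (norm (f x) powr p) \<le> norm (C powr p * norm (g x) powr p)"
    proof (rule AE_I2)
      fix x
      have "norm (f x) powr p \<le> (C * norm (g x)) powr p" using le p by (intro powr_mono2) auto
      then show "norm (norm (f x) powr p) \<le> norm (C powr p * norm (g x) powr p)"
        using p by (simp add: powr_mult)
    qed
  qed (use f in measurable)
qed fact

lemma in_Lp_scaleR:
  assumes "in_Lp p g" "h \<in> borel_measurable lebesgue" "\<And>x. \<bar>h x\<bar> \<le> C" "0 \<le> p"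
  shows "in_Lp p (\<lambda>x. h x *\<^sub>R g x)"
proof (rule in_Lp_bound[OF assms(1), where C=C])
  have [measurable]: "g \<in> borel_measurable lebesgue" using assms by (simp add: in_Lp_def)
  show "(\<lambda>x. h x *\<^sub>R g x) \<in> borel_measurable lebesgue" using assms by measurable
  show "0 \<le> C" using assms(3)[of 0] by linarith
qed (use assms in \<open>auto intro!: mult_right_mono\<close>)

lemma in_Lp_add:
  assumes f: "in_Lp p f" and g: "in_Lp p g" and p: "0 \<le> p"
  shows "in_Lp p (\<lambda>x. f x + g x)"
proof -
  have [measurable]: "f \<in> borel_measurable lebesgue" "g \<in> borel_measurable lebesgue" using f g by (auto simp: in_Lp_def)
  have "integrable lebesgue (\<lambda>x. norm (f x + g x) powr p)"
  proof (rule Bochner_Integration.integrable_bound)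
    show "integrable lebesgue (\<lambda>x. 2 powr p * (norm (f x) powr p + norm (g x) powr p))" using f g by (simp add: in_Lp_def)
  qed (use norm_add_powr_le[OF p] in auto)
  then show ?thesis unfolding in_Lp_def by auto
qed

lemma in_Lp_diff_scaleR:
  assumes f: "in_Lp p f" and g: "in_Lp p g" and p: "0 \<le> p"
  shows "in_Lp p (\<lambda>x. f x - t *\<^sub>R g x)"
  using in_Lp_add[OF f in_Lp_scaleR[OF g, of "\<lambda>_. -t" "\<bar>t\<bar>"] p] p by simp

lemma in_Lp_diff: "in_Lp p f \<Longrightarrow> in_Lp p g \<Longrightarrow> 0 \<le> p \<Longrightarrow> in_Lp p (\<lambda>x. f x - g x)"
  using in_Lp_diff_scaleR[of p f g 1] by simp

lemma Lp_norm_le: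
  assumes f: "in_Lp p f" and h: "in_Lp p h" and p: "0 < p"
  shows "(\<integral>x. norm (f x) powr p \<partial>lebesgue) \<le> 2 powr p * ((\<integral>x. norm (f x - h x) powr p \<partial>lebesgue) + (\<integral>x. norm (h x) powr p \<partial>lebesgue))"
proof -
  have i: "integrable lebesgue (\<lambda>x. norm (f x - h x) powr p)" "integrable lebesgue (\<lambda>x. norm (h x) powr p)"
    using in_Lp_diff[OF f h] h p by (auto simp: in_Lp_def)
  have "(\<integral>x. norm (f x) powr p \<partial>lebesgue) \<le> (\<integral>x. 2 powr p * (norm (f x - h x) powr p + norm (h x) powr p) \<partial>lebesgue)"
  proof (rule integral_mono)
    show "integrable lebesgue (\<lambda>x. norm (f x) powr p)" using f by (simp add: in_Lp_def)
    show "integrable lebesgue (\<lambda>x. 2 powr p * (norm (f x - h x) powr p + norm (h x) powr p))" using i by auto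
    show "norm (f x) powr p \<le> 2 powr p * (norm (f x - h x) powr p + norm (h x) powr p)" for x
      using norm_add_powr_le[of p "f x - h x" "h x"] p by simp
  qed
  then show ?thesis using i by simp
qed

lemma C1c_in_Lp:
  assumes "C1c S \<phi> g" "0 < p" shows "in_Lp p \<phi>" "in_Lp p g"
  using C1c_integrable[OF assms] C1c_continuous[OF assms(1)]
  by (auto simp: in_Lp_def intro!: measurable_completion borel_measurable_continuous_onI)

text \<open>Membership in the space is part of the notion: the integral of a non-integrable function
  is 0, so convergence of the integrals alone would not mean convergence.\<close>

definition Lp_tendsto :: "real \<Rightarrow> (nat \<Rightarrow> 'a::euclidean_space \<Rightarrow> 'b::euclidean_space) \<Rightarrow> ('a \<Rightarrow> 'b) \<Rightarrow> bool" where
  "Lp_tendsto p fs f \<longleftrightarrow> (\<forall>k. in_Lp p (fs k)) \<and> in_Lp p f \<and>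
     (\<lambda>k. \<integral>x. norm (fs k x - f x) powr p \<partial>lebesgue) \<longlonglongrightarrow> 0"

lemma Lp_tendsto_subseq: "Lp_tendsto p fs f \<Longrightarrow> strict_mono r \<Longrightarrow> Lp_tendsto p (\<lambda>k. fs (r k)) f"
  unfolding Lp_tendsto_def using LIMSEQ_subseq_LIMSEQ by (fastforce simp: o_def)

lemma Lp_tendsto_AE:
  assumes L: "Lp_tendsto p fs f" and p: "0 < p"
  shows "\<exists>r. strict_mono r \<and> (AE x in lebesgue. (\<lambda>k. fs (r k) x) \<longlonglongrightarrow> f x)"
proof -
  have "integrable lebesgue (\<lambda>x. norm (fs k x - f x) powr p)" for k
    using in_Lp_diff[of p "fs k" f] L p by (auto simp: Lp_tendsto_def in_Lp_def)
  moreover have "(\<lambda>k. \<integral>x. norm (norm (fs k x - f x) powr p) \<partial>lebesgue) \<longlonglongrightarrow> 0"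
    using L by (simp add: Lp_tendsto_def)
  ultimately obtain r where r: "strict_mono (r :: nat \<Rightarrow> nat)" "AE x in lebesgue. (\<lambda>k. norm (fs (r k) x - f x) powr p) \<longlonglongrightarrow> 0"
    using tendsto_L1_AE_subseq[of lebesgue "\<lambda>k x. norm (fs k x - f x) powr p"] by blast
  have "AE x in lebesgue. (\<lambda>k. fs (r k) x) \<longlonglongrightarrow> f x"
    using r(2)
  proof eventually_elim
    case (elim x)
    have "(\<lambda>k. (norm (fs (r k) x - f x) powr p) powr (1/p)) \<longlonglongrightarrow> 0 powr (1/p)"
      using elim p by (intro tendsto_powr') auto
    then have "(\<lambda>k. norm (fs (r k) x - f x)) \<longlonglongrightarrow> 0" using p by (simp add: powr_powr)
    then show ?case by (simp add: LIM_zero_iff tendsto_norm_zero_iff)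
  qed
  then show ?thesis using r(1) by blast
qed

lemma Lp_tendsto_bound:
  assumes L: "Lp_tendsto p gs g" and fs: "\<And>k. in_Lp p (fs k)" "in_Lp p f" and p: "0 < p" "0 \<le> C"
    and le: "\<And>k x. norm (fs k x - f x) \<le> C * norm (gs k x - g x)"
  shows "Lp_tendsto p fs f"
  unfolding Lp_tendsto_def
proof (intro conjI allI fs)
  have ig: "integrable lebesgue (\<lambda>x. norm (gs k x - g x) powr p)" for k
    using in_Lp_diff[of p "gs k" g] L p by (auto simp: Lp_tendsto_def in_Lp_def)
  have "norm (\<integral>x. norm (fs k x - f x) powr p \<partial>lebesgue) \<le> C powr p * (\<integral>x. norm (gs k x - g x) powr p \<partial>lebesgue)" for k
  proof -
    have "(\<integral>x. norm (fs k x - f x) powr p \<partial>lebesgue) \<le> (\<integral>x. C powr p * norm (gs k x - g x) powr p \<partial>lebesgue)"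
    proof (rule integral_mono)
      show "integrable lebesgue (\<lambda>x. norm (fs k x - f x) powr p)"
        using in_Lp_diff[of p "fs k" f] fs p by (auto simp: in_Lp_def)
      fix x
      have "norm (fs k x - f x) powr p \<le> (C * norm (gs k x - g x)) powr p" using le p by (intro powr_mono2) auto
      then show "norm (fs k x - f x) powr p \<le> C powr p * norm (gs k x - g x) powr p"
        using p by (simp add: powr_mult)
    qed (use ig in simp)
    then show ?thesis by simp
  qed
  moreover have "(\<lambda>k. C powr p * (\<integral>x. norm (gs k x - g x) powr p \<partial>lebesgue)) \<longlonglongrightarrow> 0"
    using L by (auto simp: Lp_tendsto_def intro!: tendsto_mult_right_zero)
  ultimately show "(\<lambda>k. \<integral>x. norm (fs k x - f x) powr p \<partial>lebesgue) \<longlonglongrightarrow> 0"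
    by (rule Lim_null_comparison[OF always_eventually[OF allI]])
qed

lemma Lp_tendsto_diff_scaleR:
  assumes F: "Lp_tendsto p fs f" and G: "Lp_tendsto p gs g" and p: "0 < p"
  shows "Lp_tendsto p (\<lambda>k x. fs k x - t *\<^sub>R gs k x) (\<lambda>x. f x - t *\<^sub>R g x)"
  unfolding Lp_tendsto_def
proof (intro conjI allI)
  show 1: "in_Lp p (\<lambda>x. fs k x - t *\<^sub>R gs k x)" for k using F G p by (intro in_Lp_diff_scaleR) (auto simp: Lp_tendsto_def)
  show 2: "in_Lp p (\<lambda>x. f x - t *\<^sub>R g x)" using F G p by (intro in_Lp_diff_scaleR) (auto simp: Lp_tendsto_def)
  have i: "integrable lebesgue (\<lambda>x. norm (fs k x - f x) powr p)" "integrable lebesgue (\<lambda>x. norm (gs k x - g x) powr p)" for k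
    using in_Lp_diff[of p "gs k" g] in_Lp_diff[of p "fs k" f] F G p by (auto simp: Lp_tendsto_def in_Lp_def)
  have "norm (\<integral>x. norm (fs k x - t *\<^sub>R gs k x - (f x - t *\<^sub>R g x)) powr p \<partial>lebesgue)
     \<le> 2 powr p * ((\<integral>x. norm (fs k x - f x) powr p \<partial>lebesgue) + \<bar>t\<bar> powr p * (\<integral>x. norm (gs k x - g x) powr p \<partial>lebesgue))" for k
  proof -
    have "(\<integral>x. norm (fs k x - t *\<^sub>R gs k x - (f x - t *\<^sub>R g x)) powr p \<partial>lebesgue)
       \<le> (\<integral>x. 2 powr p * (norm (fs k x - f x) powr p + \<bar>t\<bar> powr p * norm (gs k x - g x) powr p) \<partial>lebesgue)"
    proof (rule integral_mono)
      show "integrable lebesgue (\<lambda>x. norm (fs k x - t *\<^sub>R gs k x - (f x - t *\<^sub>R g x)) powr p)"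
        using in_Lp_diff[OF 1 2] p by (auto simp: in_Lp_def)
      show "integrable lebesgue (\<lambda>x. 2 powr p * (norm (fs k x - f x) powr p + \<bar>t\<bar> powr p * norm (gs k x - g x) powr p))"
        using i by auto
      fix x
      have eq: "fs k x - t *\<^sub>R gs k x - (f x - t *\<^sub>R g x) = (fs k x - f x) + (- t) *\<^sub>R (gs k x - g x)"
        by (simp add: algebra_simps)
      have "norm (fs k x - t *\<^sub>R gs k x - (f x - t *\<^sub>R g x)) powr p
          \<le> 2 powr p * (norm (fs k x - f x) powr p + norm ((- t) *\<^sub>R (gs k x - g x)) powr p)"
        unfolding eq by (rule norm_add_powr_le) (use p in simp)
      then show "norm (fs k x - t *\<^sub>R gs k x - (f x - t *\<^sub>R g x)) powr p \<le> 2 powr p * (norm (fs k x - f x) powr p + \<bar>t\<bar> powr p * norm (gs k x - g x) powr p)"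
        unfolding norm_scaleR by (simp add: powr_mult)
    qed
    also have "\<dots> = 2 powr p * ((\<integral>x. norm (fs k x - f x) powr p \<partial>lebesgue) + \<bar>t\<bar> powr p * (\<integral>x. norm (gs k x - g x) powr p \<partial>lebesgue))"
      using i by simp
    finally show ?thesis by simp
  qed
  moreover have "(\<lambda>k. 2 powr p * ((\<integral>x. norm (fs k x - f x) powr p \<partial>lebesgue) + \<bar>t\<bar> powr p * (\<integral>x. norm (gs k x - g x) powr p \<partial>lebesgue))) \<longlonglongrightarrow> 0"
    using F G by (auto simp: Lp_tendsto_def intro!: tendsto_mult_right_zero tendsto_add_zero)
  ultimately show "(\<lambda>k. \<integral>x. norm (fs k x - t *\<^sub>R gs k x - (f x - t *\<^sub>R g x)) powr p \<partial>lebesgue) \<longlonglongrightarrow> 0"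
    by (rule Lim_null_comparison[OF always_eventually[OF allI]])
qed

lemma in_Lp_mult_integrable:
  fixes f h :: "'a::euclidean_space \<Rightarrow> real"
  assumes p: "1 < p" and f: "in_Lp p f" and h: "in_Lp (p/(p-1)) h"
  shows "integrable lebesgue (\<lambda>x. f x * h x)"
    and "\<bar>\<integral>x. f x * h x \<partial>lebesgue\<bar> \<le> (\<integral>x. norm (f x) powr p \<partial>lebesgue) powr (1/p) * (\<integral>x. norm (h x) powr (p/(p-1)) \<partial>lebesgue) powr (1-1/p)"
proof -
  have [measurable]: "f \<in> borel_measurable lebesgue" "h \<in> borel_measurable lebesgue" using f h by (auto simp: in_Lp_def)
  have H: "integrable lebesgue (\<lambda>x. norm (f x) * norm (h x))"
    "(\<integral>x. norm (f x) * norm (h x) \<partial>lebesgue) \<le> (\<integral>x. norm (f x) powr p \<partial>lebesgue) powr (1/p) * (\<integral>x. norm (h x) powr (p/(p-1)) \<partial>lebesgue) powr (1 - 1/p)"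
    using Holder_norm[OF p, of lebesgue f h] f h by (auto simp: in_Lp_def)
  show "integrable lebesgue (\<lambda>x. f x * h x)"
    by (rule Bochner_Integration.integrable_bound[OF H(1)]) (auto simp: abs_mult)
  have "\<bar>\<integral>x. f x * h x \<partial>lebesgue\<bar> \<le> (\<integral>x. norm (f x) * norm (h x) \<partial>lebesgue)"
    using integral_norm_bound[of lebesgue "\<lambda>x. f x * h x"] by (simp add: abs_mult)
  then show "\<bar>\<integral>x. f x * h x \<partial>lebesgue\<bar> \<le> (\<integral>x. norm (f x) powr p \<partial>lebesgue) powr (1/p) * (\<integral>x. norm (h x) powr (p/(p-1)) \<partial>lebesgue) powr (1-1/p)"
    using H(2) by linarith
qed

lemma Lp_tendsto_pairing:
  fixes f h :: "'a::euclidean_space \<Rightarrow> real"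
  assumes p: "1 < p" and F: "Lp_tendsto p fs f" and h: "in_Lp (p/(p-1)) h"
  shows "(\<lambda>k. \<integral>x. fs k x * h x \<partial>lebesgue) \<longlonglongrightarrow> (\<integral>x. f x * h x \<partial>lebesgue)"
proof -
  have i: "in_Lp p (fs k)" "in_Lp p f" for k using F by (auto simp: Lp_tendsto_def)
  have "norm ((\<integral>x. fs k x * h x \<partial>lebesgue) - (\<integral>x. f x * h x \<partial>lebesgue))
      \<le> (\<integral>x. norm (fs k x - f x) powr p \<partial>lebesgue) powr (1/p) * (\<integral>x. norm (h x) powr (p/(p-1)) \<partial>lebesgue) powr (1-1/p)" for k
  proof -
    have "(\<integral>x. fs k x * h x \<partial>lebesgue) - (\<integral>x. f x * h x \<partial>lebesgue) = (\<integral>x. (fs k x - f x) * h x \<partial>lebesgue)"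
      using in_Lp_mult_integrable(1)[OF p _ h] i by (simp add: left_diff_distrib)
    then show ?thesis using in_Lp_mult_integrable(2)[OF p in_Lp_diff[OF i] h, of k] p by simp
  qed
  moreover
  have "(\<lambda>k. (\<integral>x. norm (fs k x - f x) powr p \<partial>lebesgue) powr (1/p) * (\<integral>x. norm (h x) powr (p/(p-1)) \<partial>lebesgue) powr (1-1/p)) \<longlonglongrightarrow> 0 powr (1/p) * (\<integral>x. norm (h x) powr (p/(p-1)) \<partial>lebesgue) powr (1-1/p)"
    using F p by (intro tendsto_mult tendsto_const tendsto_powr') (auto simp: Lp_tendsto_def)
  then have "(\<lambda>k. (\<integral>x. norm (fs k x - f x) powr p \<partial>lebesgue) powr (1/p) * (\<integral>x. norm (h x) powr (p/(p-1)) \<partial>lebesgue) powr (1-1/p)) \<longlonglongrightarrow> 0"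
    by simp
  ultimately have "(\<lambda>k. (\<integral>x. fs k x * h x \<partial>lebesgue) - (\<integral>x. f x * h x \<partial>lebesgue)) \<longlonglongrightarrow> 0"
    by (rule Lim_null_comparison[OF always_eventually[OF allI]])
  then show ?thesis by (simp add: LIM_zero_iff)
qed

text \<open>Functions of \<open>W\<^sub>0\<^sup>1\<^sup>,\<^sup>p(\<Omega>)\<close> and their gradients are handled through their
  extensions by zero to the whole space.\<close>
definition sobolev0 :: "'a::euclidean_space set \<Rightarrow> real \<Rightarrow> ('a \<Rightarrow> real) \<Rightarrow> ('a \<Rightarrow> 'a) \<Rightarrow> bool" where
  "sobolev0 \<Omega> p u G \<longleftrightarrow> (\<forall>x. x \<notin> \<Omega> \<longrightarrow> u x = 0 \<and> G x = 0) \<and>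
     (\<exists>\<phi>s gs. (\<forall>k. test_fun \<Omega> (\<phi>s k) \<and> is_grad (\<phi>s k) (gs k)) \<and> Lp_tendsto p \<phi>s u \<and> Lp_tendsto p gs G)"

lemma sobolev0_in_Lp: "sobolev0 \<Omega> p u G \<Longrightarrow> in_Lp p u" "sobolev0 \<Omega> p u G \<Longrightarrow> in_Lp p G"
  by (auto simp: sobolev0_def Lp_tendsto_def)

lemma sobolev0_approx:
  assumes W: "sobolev0 \<Omega> p u G" and p: "0 < p"
  obtains \<phi>s gs where "\<And>k. test_fun \<Omega> (\<phi>s k)" "\<And>k. is_grad (\<phi>s k) (gs k)" "\<And>k. C1c \<Omega> (\<phi>s k) (gs k)"
    "Lp_tendsto p \<phi>s u" "Lp_tendsto p gs G"
    "AE x in lebesgue. (\<lambda>k. \<phi>s k x) \<longlonglongrightarrow> u x" "AE x in lebesgue. (\<lambda>k. gs k x) \<longlonglongrightarrow> G x"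
proof -
  obtain \<phi>s gs where A: "\<And>k. test_fun \<Omega> (\<phi>s k)" "\<And>k. is_grad (\<phi>s k) (gs k)"
    "Lp_tendsto p \<phi>s u" "Lp_tendsto p gs G" using W unfolding sobolev0_def by blast
  obtain r where r: "strict_mono r" "AE x in lebesgue. (\<lambda>k. \<phi>s (r k) x) \<longlonglongrightarrow> u x"
    using Lp_tendsto_AE[OF A(3) p] by blast
  obtain s where s: "strict_mono s" "AE x in lebesgue. (\<lambda>k. gs (r (s k)) x) \<longlonglongrightarrow> G x"
    using Lp_tendsto_AE[OF Lp_tendsto_subseq[OF A(4) r(1)] p] by blast
  show ?thesis
  proof (rule that[of "\<lambda>k. \<phi>s (r (s k))" "\<lambda>k. gs (r (s k))"])
    show "Lp_tendsto p (\<lambda>k. \<phi>s (r (s k))) u"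
      using Lp_tendsto_subseq[OF Lp_tendsto_subseq[OF A(3) r(1)] s(1)] .
    show "Lp_tendsto p (\<lambda>k. gs (r (s k))) G"
      using Lp_tendsto_subseq[OF Lp_tendsto_subseq[OF A(4) r(1)] s(1)] .
    show "AE x in lebesgue. (\<lambda>k. \<phi>s (r (s k)) x) \<longlonglongrightarrow> u x"
      using r(2) by eventually_elim (use LIMSEQ_subseq_LIMSEQ[OF _ s(1)] in \<open>fastforce simp: o_def\<close>)
    show "C1c \<Omega> (\<phi>s (r (s k))) (gs (r (s k)))" for k by (rule test_fun_C1c[OF A(1,2)])
  qed (use A s(2) in auto)
qed

section \<open>Passage between functions on the domain and their extensions by zero\<close>

lemma set_integral_zero_ext:
  fixes f :: "'a::euclidean_space \<Rightarrow> 'b::euclidean_space"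
  assumes "\<And>x. x \<notin> \<Omega> \<Longrightarrow> f x = 0"
  shows "(LINT x:\<Omega>|lebesgue. f x) = (\<integral>x. f x \<partial>lebesgue)"
    and "set_integrable lebesgue \<Omega> f \<longleftrightarrow> integrable lebesgue f"
proof -
  have "indicator \<Omega> x *\<^sub>R f x = f x" for x using assms[of x] by (auto simp: indicator_def)
  then show "(LINT x:\<Omega>|lebesgue. f x) = (\<integral>x. f x \<partial>lebesgue)" "set_integrable lebesgue \<Omega> f \<longleftrightarrow> integrable lebesgue f"
    by (simp_all add: set_lebesgue_integral_def set_integrable_def)
qed

lemma W1p0_imp_sobolev0:
  fixes u :: "'a::euclidean_space \<Rightarrow> real"
  assumes W: "W1p0 \<Omega> p u G" and \<Omega>: "open \<Omega>" and p: "0 < p"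
  shows "sobolev0 \<Omega> p (\<lambda>x. if x \<in> \<Omega> then u x else 0) (\<lambda>x. if x \<in> \<Omega> then G x else 0)"
proof -
  have S: "\<Omega> \<in> sets lebesgue" using \<Omega> by simp
  define u' G' where "u' x = (if x \<in> \<Omega> then u x else 0)" and "G' x = (if x \<in> \<Omega> then G x else 0)" for x
  have lp: "Lp \<Omega> p u" "Lp_vec \<Omega> p G" using W by (auto simp: W1p0_def W1p_def)
  obtain \<phi>s gs where A: "\<And>k. test_fun \<Omega> (\<phi>s k)" "\<And>k. is_grad (\<phi>s k) (gs k)"
      and L: "(\<lambda>k. LINT x:\<Omega>|lebesgue. \<bar>\<phi>s k x - u x\<bar> powr p) \<longlonglongrightarrow> 0"
        "(\<lambda>k. LINT x:\<Omega>|lebesgue. norm (gs k x - G x) powr p) \<longlonglongrightarrow> 0"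
    using W unfolding W1p0_def by blast
  have out: "\<phi>s k x = 0" "gs k x = 0" if "x \<notin> \<Omega>" for k x
    using test_fun_C1c[OF A] that unfolding C1c_def by blast+
  have u': "u' = (\<lambda>x. indicator \<Omega> x *\<^sub>R u x)" and G': "G' = (\<lambda>x. indicator \<Omega> x *\<^sub>R G x)"
    by (auto simp: u'_def G'_def indicator_def)
  have "(\<lambda>x. indicator \<Omega> x *\<^sub>R u x) \<in> borel_measurable lebesgue" "(\<lambda>x. indicator \<Omega> x *\<^sub>R G x) \<in> borel_measurable lebesgue"
    using lp S by (auto simp: Lp_def Lp_vec_def borel_measurable_restrict_space_iff)
  then have m: "u' \<in> borel_measurable lebesgue" "G' \<in> borel_measurable lebesgue" by (simp_all only: u' G')
  have iu: "indicator \<Omega> x * (\<bar>u x\<bar> powr p) = norm (u' x) powr p" "indicator \<Omega> x * (norm (G x) powr p) = norm (G' x) powr p" for x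
    using p by (auto simp: u'_def G'_def indicator_def)
  have in_u: "in_Lp p u'" "in_Lp p G'"
    using lp m by (auto simp: Lp_def Lp_vec_def in_Lp_def set_integrable_def iu simp del: real_norm_def)
  have ik: "indicator \<Omega> x * (\<bar>\<phi>s k x - u x\<bar> powr p) = norm (\<phi>s k x - u' x) powr p"
    "indicator \<Omega> x * (norm (gs k x - G x) powr p) = norm (gs k x - G' x) powr p" for x k
    using p out by (auto simp: u'_def G'_def indicator_def)
  have "Lp_tendsto p \<phi>s u'" "Lp_tendsto p gs G'"
    using in_u L C1c_in_Lp[OF test_fun_C1c[OF A] p]
    by (auto simp: Lp_tendsto_def set_lebesgue_integral_def ik simp del: real_norm_def)
  then have "sobolev0 \<Omega> p u' G'"
    unfolding sobolev0_def using A by (auto simp: u'_def G'_def)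
  then show ?thesis by (simp add: u'_def[abs_def] G'_def[abs_def])
qed

text \<open>The defining relation of the weak gradient is integration by parts for the approximating
  test functions; both sides are L^p pairings with a fixed function in the dual space and pass to
  the limit.\<close>

lemma sobolev0_imp_W1p0:
  fixes u :: "'a::euclidean_space \<Rightarrow> real"
  assumes W: "sobolev0 \<Omega> p u G" and \<Omega>: "open \<Omega>" and p: "1 < p"
  shows "W1p0 \<Omega> p u G"
proof -
  have p0: "0 < p" using p by simp
  have S: "\<Omega> \<in> sets lebesgue" using \<Omega> by simp
  have out: "x \<notin> \<Omega> \<Longrightarrow> u x = 0" "x \<notin> \<Omega> \<Longrightarrow> G x = 0" for x using W by (auto simp: sobolev0_def)
  obtain \<phi>s gs where A: "\<And>k. test_fun \<Omega> (\<phi>s k)" "\<And>k. is_grad (\<phi>s k) (gs k)"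
    "Lp_tendsto p \<phi>s u" "Lp_tendsto p gs G" using W unfolding sobolev0_def by blast
  have outk: "\<phi>s k x = 0" "gs k x = 0" if "x \<notin> \<Omega>" for k x
    using test_fun_C1c[OF A(1,2)] that unfolding C1c_def by blast+
  note Lu = sobolev0_in_Lp[OF W]
  have "Lp \<Omega> p u" "Lp_vec \<Omega> p G"
    using Lu out p by (auto simp: Lp_def Lp_vec_def in_Lp_def set_integral_zero_ext(2) intro: measurable_restrict_space1)
  moreover have "weak_grad \<Omega> u G"
    unfolding weak_grad_def
  proof (intro allI impI, elim conjE)
    fix \<psi> :: "'a \<Rightarrow> real" and g and i :: 'a assume \<psi>: "test_fun \<Omega> \<psi>" "is_grad \<psi> g" and i: "i \<in> Basis"
    have c: "C1c \<Omega> \<psi> g" using test_fun_C1c[OF \<psi>] .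
    have q: "0 < p/(p-1)" using p by simp
    have \<psi>q: "in_Lp (p/(p-1)) \<psi>" using C1c_in_Lp[OF c q] by simp
    have gq: "in_Lp (p/(p-1)) (\<lambda>x. g x \<bullet> i)"
    proof (rule in_Lp_bound[OF C1c_in_Lp(2)[OF c q], where C=1])
      have "g \<in> borel_measurable lebesgue" using C1c_in_Lp(2)[OF c q] by (simp add: in_Lp_def)
      then show "(\<lambda>x. g x \<bullet> i) \<in> borel_measurable lebesgue" by measurable
    qed (use q i Basis_le_norm in auto)
    have gi: "in_Lp p (\<lambda>x. f x \<bullet> i)" if "in_Lp p f" for f :: "'a \<Rightarrow> 'a"
    proof (rule in_Lp_bound[OF that, where C=1])
      have "f \<in> borel_measurable lebesgue" using that by (simp add: in_Lp_def)
      then show "(\<lambda>x. f x \<bullet> i) \<in> borel_measurable lebesgue" by measurable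
    qed (use p i Basis_le_norm in auto)
    have Gi: "Lp_tendsto p (\<lambda>k x. gs k x \<bullet> i) (\<lambda>x. G x \<bullet> i)"
      by (rule Lp_tendsto_bound[OF A(4), where C=1])
        (use A(4) p gi i in \<open>auto simp: Lp_tendsto_def inner_diff_left[symmetric] Basis_le_norm\<close>)
    have 1: "(\<lambda>k. \<integral>x. \<phi>s k x * (g x \<bullet> i) \<partial>lebesgue) \<longlonglongrightarrow> (\<integral>x. u x * (g x \<bullet> i) \<partial>lebesgue)"
      by (rule Lp_tendsto_pairing[OF p A(3) gq])
    have 2: "(\<lambda>k. \<integral>x. (gs k x \<bullet> i) * \<psi> x \<partial>lebesgue) \<longlonglongrightarrow> (\<integral>x. (G x \<bullet> i) * \<psi> x \<partial>lebesgue)"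
      by (rule Lp_tendsto_pairing[OF p Gi \<psi>q])
    have "(\<integral>x. \<phi>s k x * (g x \<bullet> i) \<partial>lebesgue) = - (\<integral>x. (gs k x \<bullet> i) * \<psi> x \<partial>lebesgue)" for k
      by (rule C1c_integral_by_parts[OF test_fun_C1c[OF A(1,2)] c i])
    then have "(\<integral>x. u x * (g x \<bullet> i) \<partial>lebesgue) = - (\<integral>x. (G x \<bullet> i) * \<psi> x \<partial>lebesgue)"
      using 1 tendsto_minus[OF 2] by (simp add: LIMSEQ_unique)
    then show "set_integrable lebesgue \<Omega> (\<lambda>x. u x * (g x \<bullet> i)) \<and> set_integrable lebesgue \<Omega> (\<lambda>x. (G x \<bullet> i) * \<psi> x) \<and>
      (LINT x:\<Omega>|lebesgue. u x * (g x \<bullet> i)) = - (LINT x:\<Omega>|lebesgue. (G x \<bullet> i) * \<psi> x)"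
      using out in_Lp_mult_integrable(1)[OF p Lu(1) gq] in_Lp_mult_integrable(1)[OF p gi[OF Lu(2)] \<psi>q]
      by (simp add: set_integral_zero_ext)
  qed
  moreover have "(\<lambda>k. LINT x:\<Omega>|lebesgue. \<bar>\<phi>s k x - u x\<bar> powr p) \<longlonglongrightarrow> 0" "(\<lambda>k. LINT x:\<Omega>|lebesgue. norm (gs k x - G x) powr p) \<longlonglongrightarrow> 0"
    using A(3,4) out outk by (simp_all add: set_integral_zero_ext Lp_tendsto_def)
  ultimately show ?thesis unfolding W1p0_def W1p_def using A(1,2) by blast
qed

lemma sobolev0_diff:
  assumes U: "sobolev0 \<Omega> p u G" and V: "sobolev0 \<Omega> p v H" and p: "0 < p"
  shows "sobolev0 \<Omega> p (\<lambda>x. u x - t * v x) (\<lambda>x. G x - t *\<^sub>R H x)"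
proof -
  obtain \<phi>s gs where A: "\<And>k. test_fun \<Omega> (\<phi>s k)" "\<And>k. is_grad (\<phi>s k) (gs k)"
    "Lp_tendsto p \<phi>s u" "Lp_tendsto p gs G" using U unfolding sobolev0_def by blast
  obtain \<psi>s hs where B: "\<And>k. test_fun \<Omega> (\<psi>s k)" "\<And>k. is_grad (\<psi>s k) (hs k)"
    "Lp_tendsto p \<psi>s v" "Lp_tendsto p hs H" using V unfolding sobolev0_def by blast
  have "Lp_tendsto p (\<lambda>k x. \<phi>s k x - t * \<psi>s k x) (\<lambda>x. u x - t * v x)"
    using Lp_tendsto_diff_scaleR[OF A(3) B(3) p, of t] by simp
  moreover have "Lp_tendsto p (\<lambda>k x. gs k x - t *\<^sub>R hs k x) (\<lambda>x. G x - t *\<^sub>R H x)"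
    using Lp_tendsto_diff_scaleR[OF A(4) B(4) p, of t] .
  moreover have "test_fun \<Omega> (\<lambda>x. \<phi>s k x - t * \<psi>s k x)" "is_grad (\<lambda>x. \<phi>s k x - t * \<psi>s k x) (\<lambda>x. gs k x - t *\<^sub>R hs k x)" for k
    using test_fun_diff[OF A(1) B(1)] is_grad_diff[OF A(2) B(2)] by auto
  moreover have "\<forall>x. x \<notin> \<Omega> \<longrightarrow> u x - t * v x = 0 \<and> G x - t *\<^sub>R H x = 0"
    using U V by (auto simp: sobolev0_def)
  ultimately show ?thesis unfolding sobolev0_def
    by (intro conjI exI[of _ "\<lambda>k x. \<phi>s k x - t * \<psi>s k x"] exI[of _ "\<lambda>k x. gs k x - t *\<^sub>R hs k x"]) auto
qed

text \<open>The chain rule in the limit. The error splits into F'(phi_k)(g_k - G), controlled by the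
  bound on F', and (F'(phi_k) - F'(u)) G, which tends to zero by dominated convergence. The second
  part is why convergence almost everywhere is assumed.\<close>

lemma Lp_tendsto_compose:
  fixes u :: "'a::euclidean_space \<Rightarrow> real" and G :: "'a \<Rightarrow> 'a"
  assumes U: "Lp_tendsto p \<phi>s u" and g: "Lp_tendsto p gs G" and ae: "AE x in lebesgue. (\<lambda>k. \<phi>s k x) \<longlonglongrightarrow> u x"
    and p: "0 < p"
    and F: "\<And>t. (F has_real_derivative F' t) (at t)" "continuous_on UNIV F'" "F 0 = 0" and B: "\<And>t. \<bar>F' t\<bar> \<le> B"
  shows "Lp_tendsto p (\<lambda>k x. F (\<phi>s k x)) (\<lambda>x. F (u x))"
    and "Lp_tendsto p (\<lambda>k x. F' (\<phi>s k x) *\<^sub>R gs k x) (\<lambda>x. F' (u x) *\<^sub>R G x)"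
proof -
  have B0: "0 \<le> B" using B[of 0] by linarith
  have FL: "\<bar>F s - F t\<bar> \<le> B * \<bar>s - t\<bar>" for s t
    using field_differentiable_bound[of UNIV F F' B s t] F(1) B by (auto simp: has_field_derivative_at_within)
  have cF: "continuous_on UNIV F" using F(1) by (meson DERIV_isCont continuous_at_imp_continuous_on)
  have Fm[measurable]: "F \<in> borel_measurable borel" "F' \<in> borel_measurable borel"
    using cF F(2) by (auto intro: borel_measurable_continuous_onI)
  have iu: "in_Lp p (\<phi>s k)" "in_Lp p u" "in_Lp p (gs k)" "in_Lp p G" for k using U g by (auto simp: Lp_tendsto_def)
  have [measurable]: "\<phi>s k \<in> borel_measurable lebesgue" "u \<in> borel_measurable lebesgue"
    "gs k \<in> borel_measurable lebesgue" "G \<in> borel_measurable lebesgue" for k using iu by (auto simp: in_Lp_def)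
  have inF: "in_Lp p (\<lambda>x. F (f x))" if f: "in_Lp p f" for f :: "'a \<Rightarrow> real"
  proof (rule in_Lp_bound[OF f, where C=B])
    have "f \<in> borel_measurable lebesgue" using f by (simp add: in_Lp_def)
    then show "(\<lambda>x. F (f x)) \<in> borel_measurable lebesgue" by measurable
  qed (use FL[of _ 0] F(3) p B0 in auto)
  show "Lp_tendsto p (\<lambda>k x. F (\<phi>s k x)) (\<lambda>x. F (u x))"
    by (rule Lp_tendsto_bound[OF U, where C=B]) (use inF iu FL p B0 in auto)
  have inG: "in_Lp p (\<lambda>x. F' (f x) *\<^sub>R h x)" if f: "in_Lp p f" "in_Lp p h" for f :: "'a \<Rightarrow> real" and h :: "'a \<Rightarrow> 'a"
  proof (rule in_Lp_scaleR[OF f(2)])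
    have "f \<in> borel_measurable lebesgue" using f by (simp add: in_Lp_def)
    then show "(\<lambda>x. F' (f x)) \<in> borel_measurable lebesgue" by measurable
  qed (use B p in auto)
  show "Lp_tendsto p (\<lambda>k x. F' (\<phi>s k x) *\<^sub>R gs k x) (\<lambda>x. F' (u x) *\<^sub>R G x)"
    unfolding Lp_tendsto_def
  proof (intro conjI allI inG iu)
    let ?d = "\<lambda>k x. (F' (\<phi>s k x) - F' (u x)) *\<^sub>R G x"
    have DD: "in_Lp p (?d k)" for k
      using in_Lp_diff[OF inG[OF iu(1,4)] inG[OF iu(2,4)]] p by (simp add: scaleR_left_diff_distrib)
    have lim2: "(\<lambda>k. \<integral>x. norm (?d k x) powr p \<partial>lebesgue) \<longlonglongrightarrow> (\<integral>x. 0 \<partial>(lebesgue :: 'a measure))"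
    proof (rule integral_dominated_convergence)
      show "integrable lebesgue (\<lambda>x. (2*B) powr p * norm (G x) powr p)" using iu by (simp add: in_Lp_def)
      show "AE x in lebesgue. (\<lambda>k. norm (?d k x) powr p) \<longlonglongrightarrow> 0"
        using ae
      proof eventually_elim
        case (elim x)
        have "(\<lambda>k. F' (\<phi>s k x)) \<longlonglongrightarrow> F' (u x)"
          using elim F(2) by (metis UNIV_I continuous_on_eq_continuous_at isCont_tendsto_compose open_UNIV)
        then have "(\<lambda>k. norm ((F' (\<phi>s k x) - F' (u x)) *\<^sub>R G x)) \<longlonglongrightarrow> norm ((F' (u x) - F' (u x)) *\<^sub>R G x)"
          by (intro tendsto_intros)
        then have "(\<lambda>k. norm (?d k x) powr p) \<longlonglongrightarrow> 0 powr p"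
          using p by (intro tendsto_powr') auto
        then show ?case by simp
      qed
      show "AE x in lebesgue. norm (norm (?d k x) powr p) \<le> (2*B) powr p * norm (G x) powr p" for k
      proof (rule AE_I2)
        fix x
        have "\<bar>F' (\<phi>s k x) - F' (u x)\<bar> \<le> 2*B" using B[of "\<phi>s k x"] B[of "u x"] by linarith
        then have "norm (?d k x) powr p \<le> (2*B * norm (G x)) powr p" using p by (intro powr_mono2) (auto intro!: mult_right_mono)
        then show "norm (norm (?d k x) powr p) \<le> (2*B) powr p * norm (G x) powr p" using B0 by (simp add: powr_mult)
      qed
    qed auto
    have i1: "integrable lebesgue (\<lambda>x. norm (gs k x - G x) powr p)" for k
      using in_Lp_diff[OF iu(3,4)] p by (simp add: in_Lp_def)
    have i2: "integrable lebesgue (\<lambda>x. norm (?d k x) powr p)" for k using DD by (simp add: in_Lp_def)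
    have "norm (\<integral>x. norm (F' (\<phi>s k x) *\<^sub>R gs k x - F' (u x) *\<^sub>R G x) powr p \<partial>lebesgue)
      \<le> 2 powr p * (B powr p * (\<integral>x. norm (gs k x - G x) powr p \<partial>lebesgue) + (\<integral>x. norm (?d k x) powr p \<partial>lebesgue))" for k
    proof -
      have "(\<integral>x. norm (F' (\<phi>s k x) *\<^sub>R gs k x - F' (u x) *\<^sub>R G x) powr p \<partial>lebesgue)
        \<le> (\<integral>x. 2 powr p * (B powr p * norm (gs k x - G x) powr p + norm (?d k x) powr p) \<partial>lebesgue)"
      proof (rule integral_mono)
        show "integrable lebesgue (\<lambda>x. norm (F' (\<phi>s k x) *\<^sub>R gs k x - F' (u x) *\<^sub>R G x) powr p)"
          using in_Lp_diff[OF inG[OF iu(1,3)] inG[OF iu(2,4)]] p by (simp add: in_Lp_def)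
        show "integrable lebesgue (\<lambda>x. 2 powr p * (B powr p * norm (gs k x - G x) powr p + norm (?d k x) powr p))"
          using i1 i2 by (intro integrable_mult_right Bochner_Integration.integrable_add)
        fix x
        have eq: "F' (\<phi>s k x) *\<^sub>R gs k x - F' (u x) *\<^sub>R G x = F' (\<phi>s k x) *\<^sub>R (gs k x - G x) + ?d k x"
          by (simp add: algebra_simps)
        have "norm (F' (\<phi>s k x) *\<^sub>R gs k x - F' (u x) *\<^sub>R G x) powr p
          \<le> 2 powr p * (norm (F' (\<phi>s k x) *\<^sub>R (gs k x - G x)) powr p + norm (?d k x) powr p)"
          unfolding eq by (rule norm_add_powr_le) (use p in simp)
        also have "norm (F' (\<phi>s k x) *\<^sub>R (gs k x - G x)) powr p \<le> (B * norm (gs k x - G x)) powr p"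
          using p B by (intro powr_mono2) (auto intro!: mult_right_mono)
        also have "\<dots> = B powr p * norm (gs k x - G x) powr p" using B0 by (simp add: powr_mult)
        finally show "norm (F' (\<phi>s k x) *\<^sub>R gs k x - F' (u x) *\<^sub>R G x) powr p
          \<le> 2 powr p * (B powr p * norm (gs k x - G x) powr p + norm (?d k x) powr p)" by simp
      qed
      also have "\<dots> = 2 powr p * (B powr p * (\<integral>x. norm (gs k x - G x) powr p \<partial>lebesgue) + (\<integral>x. norm (?d k x) powr p \<partial>lebesgue))"
        using i1[of k] i2[of k] by (subst integral_mult_right_zero, subst Bochner_Integration.integral_add) auto
      finally show ?thesis by simp
    qed
    moreover have "(\<lambda>k. 2 powr p * (B powr p * (\<integral>x. norm (gs k x - G x) powr p \<partial>lebesgue) + (\<integral>x. norm (?d k x) powr p \<partial>lebesgue))) \<longlonglongrightarrow> 0"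
      using g lim2 by (auto simp: Lp_tendsto_def intro!: tendsto_mult_right_zero tendsto_add_zero)
    ultimately show "(\<lambda>k. \<integral>x. norm (F' (\<phi>s k x) *\<^sub>R gs k x - F' (u x) *\<^sub>R G x) powr p \<partial>lebesgue) \<longlonglongrightarrow> 0"
      by (rule Lim_null_comparison[OF always_eventually[OF allI]])
  qed
qed

text \<open>Beyond the C^1 chain rule, F must preserve smoothness: membership in
  \<open>sobolev0\<close>, and hence admissibility in the weak equation, requires approximation by
  genuine test functions.\<close>

lemma sobolev0_compose:
  fixes u :: "'a::euclidean_space \<Rightarrow> real"
  assumes W: "sobolev0 \<Omega> p u G" and p: "0 < p"
    and F: "\<And>t. (F has_real_derivative F' t) (at t)" "continuous_on UNIV F'" "F 0 = 0" and B: "\<And>t. \<bar>F' t\<bar> \<le> B"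
    and smooth: "\<And>\<phi>::'a \<Rightarrow> real. Cinf \<phi> \<Longrightarrow> Cinf (\<lambda>x. F (\<phi> x))"
  shows "sobolev0 \<Omega> p (\<lambda>x. F (u x)) (\<lambda>x. F' (u x) *\<^sub>R G x)"
proof -
  obtain \<phi>s gs where A: "\<And>k. test_fun \<Omega> (\<phi>s k)" "\<And>k. is_grad (\<phi>s k) (gs k)" "\<And>k. C1c \<Omega> (\<phi>s k) (gs k)"
    "Lp_tendsto p \<phi>s u" "Lp_tendsto p gs G" "AE x in lebesgue. (\<lambda>k. \<phi>s k x) \<longlonglongrightarrow> u x"
    by (rule sobolev0_approx[OF W p], rule that)
  have "test_fun \<Omega> (\<lambda>x. F (\<phi>s k x))" for k
  proof -
    obtain K where K: "Cinf (\<phi>s k)" "compact K" "K \<subseteq> \<Omega>" "\<And>x. x \<notin> K \<Longrightarrow> \<phi>s k x = 0"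
      by (rule test_funE[OF A(1)[of k]], rule that)
    show ?thesis by (rule test_funI[OF smooth[OF K(1)] K(2,3)]) (use K(4) F(3) in auto)
  qed
  moreover have "is_grad (\<lambda>x. F (\<phi>s k x)) (\<lambda>x. F' (\<phi>s k x) *\<^sub>R gs k x)" for k
    using C1c_compose[OF A(3) F] by (simp add: C1c_def)
  ultimately show ?thesis unfolding sobolev0_def
    using Lp_tendsto_compose[OF A(4,5,6) p F B] W F(3)
    by (intro conjI exI[of _ "\<lambda>k x. F (\<phi>s k x)"] exI[of _ "\<lambda>k x. F' (\<phi>s k x) *\<^sub>R gs k x"]) (auto simp: sobolev0_def)
qed

text \<open>Fatou's lemma along an almost everywhere convergent subsequence. It is phrased for
  arbitrary \<open>C1c\<close> approximations, because it is later applied to compositions u w(u)^b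
  with a real exponent b, whose approximations are only treated as \<open>C1c\<close>.\<close>

lemma sobolev_limit:
  fixes \<Omega> :: "'a::euclidean_space set"
  assumes N: "DIM('a) \<ge> 2" and S: "bounded \<Omega>" and p: "1 < p" "p < real DIM('a)"
  defines "r \<equiv> pstar (real DIM('a)) p"
  shows "\<exists>C\<ge>0. \<forall>\<phi>s gs v H. (\<forall>k. C1c \<Omega> (\<phi>s k) (gs k)) \<longrightarrow> Lp_tendsto p \<phi>s v \<longrightarrow> Lp_tendsto p gs H \<longrightarrow>
    in_Lp r v \<and> (\<integral>x. norm (v x) powr r \<partial>lebesgue) \<le> C * (\<integral>x. norm (H x) powr p \<partial>lebesgue) powr (r/p)"
proof -
  obtain C where C: "C \<ge> 0" "\<And>\<phi> g. C1c \<Omega> \<phi> g \<Longrightarrow> (\<integral>x. \<bar>\<phi> x\<bar> powr r \<partial>lebesgue) \<le> C * (\<integral>x. norm (g x) powr p \<partial>lebesgue) powr (r/p)"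
    using sobolev_C1c[OF N S p] unfolding r_def by blast
  have r0: "r > 0" "r/p > 0" using p by (auto simp: r_def pstar_def)
  \<comment> \<open>The factor \<open>2 powr p\<close> is the price of bounding the norms of the
    approximating gradients by \<open>Lp_norm_le\<close> instead of showing that they
    converge.\<close>
  define D where "D = C * (2 powr p) powr (r/p)"
  have "in_Lp r v \<and> (\<integral>x. norm (v x) powr r \<partial>lebesgue) \<le> D * (\<integral>x. norm (H x) powr p \<partial>lebesgue) powr (r/p)"
    if c0: "\<forall>k. C1c \<Omega> (\<phi>s k) (gs k)" and L0: "Lp_tendsto p \<phi>s v" "Lp_tendsto p gs H" for \<phi>s gs v H
  proof -
    obtain s where s: "strict_mono s" "AE x in lebesgue. (\<lambda>k. \<phi>s (s k) x) \<longlonglongrightarrow> v x"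
      using Lp_tendsto_AE[OF L0(1)] p by auto
    define f where "f k = \<phi>s (s k)" for k
    define g where "g k = gs (s k)" for k
    have c: "C1c \<Omega> (f k) (g k)" for k using c0 by (simp add: f_def g_def)
    have L: "Lp_tendsto p g H" unfolding g_def by (rule Lp_tendsto_subseq[OF L0(2) s(1)])
    have ae: "AE x in lebesgue. (\<lambda>k. f k x) \<longlonglongrightarrow> v x" using s(2) by (simp add: f_def)
    define d where "d k = (\<integral>x. norm (g k x - H x) powr p \<partial>lebesgue)" for k
    define Y where "Y = (\<integral>x. norm (H x) powr p \<partial>lebesgue)"
    have Y0: "0 \<le> Y" by (simp add: Y_def)
    have d: "d \<longlonglongrightarrow> 0" "\<And>k. 0 \<le> d k" using L by (auto simp: d_def[abs_def] Lp_tendsto_def)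
    have iL: "in_Lp p (g k)" "in_Lp p H" for k using L by (auto simp: Lp_tendsto_def)
    have vm[measurable]: "v \<in> borel_measurable lebesgue" using L0(1) by (auto simp: Lp_tendsto_def in_Lp_def)
    have fm[measurable]: "f k \<in> borel_measurable lebesgue" for k using C1c_in_Lp(1)[OF c r0(1)] by (auto simp: in_Lp_def)
    have gb: "(\<integral>x. norm (g k x) powr p \<partial>lebesgue) \<le> 2 powr p * (d k + Y)" for k
      unfolding d_def Y_def using p by (intro Lp_norm_le iL) auto
    define a where "a k = C * (2 powr p * (d k + Y)) powr (r/p)" for k
    have fa: "(\<integral>x. \<bar>f k x\<bar> powr r \<partial>lebesgue) \<le> a k" for k
    proof -
      have "(\<integral>x. \<bar>f k x\<bar> powr r \<partial>lebesgue) \<le> C * (\<integral>x. norm (g k x) powr p \<partial>lebesgue) powr (r/p)" by (rule C(2)[OF c])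
      also have "\<dots> \<le> a k" unfolding a_def using C(1) gb r0 by (intro mult_left_mono powr_mono2) auto
      finally show ?thesis .
    qed
    have "a \<longlonglongrightarrow> C * (2 powr p * (0 + Y)) powr (r/p)"
      unfolding a_def using d Y0 r0 by (intro tendsto_mult tendsto_const tendsto_powr' tendsto_add d(1)) auto
    then have alim: "a \<longlonglongrightarrow> D * Y powr (r/p)" using Y0 by (simp add: powr_mult D_def mult.assoc)
    have "(\<integral>\<^sup>+x. ennreal (norm (v x) powr r) \<partial>lebesgue) = (\<integral>\<^sup>+x. liminf (\<lambda>k. ennreal (\<bar>f k x\<bar> powr r)) \<partial>lebesgue)"
    proof (rule nn_integral_cong_AE)
      show "AE x in lebesgue. ennreal (norm (v x) powr r) = liminf (\<lambda>k. ennreal (\<bar>f k x\<bar> powr r))"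
        using ae
      proof eventually_elim
        case (elim x)
        have "(\<lambda>k. \<bar>f k x\<bar> powr r) \<longlonglongrightarrow> \<bar>v x\<bar> powr r"
          using elim r0 by (intro tendsto_powr' tendsto_intros) auto
        then have "(\<lambda>k. ennreal (\<bar>f k x\<bar> powr r)) \<longlonglongrightarrow> ennreal (\<bar>v x\<bar> powr r)" by (rule tendsto_ennrealI)
        then show ?case using lim_imp_Liminf[of sequentially] by fastforce
      qed
    qed
    also have "\<dots> \<le> liminf (\<lambda>k. \<integral>\<^sup>+x. ennreal (\<bar>f k x\<bar> powr r) \<partial>lebesgue)"
      by (rule nn_integral_liminf) measurable
    also have "\<dots> \<le> liminf (\<lambda>k. ennreal (a k))"
    proof (rule Liminf_mono[OF always_eventually[OF allI]])
      fix k
      have "(\<integral>\<^sup>+x. ennreal (\<bar>f k x\<bar> powr r) \<partial>lebesgue) = ennreal (\<integral>x. \<bar>f k x\<bar> powr r \<partial>lebesgue)"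
        using C1c_integrable(1)[OF c r0(1)] by (intro nn_integral_eq_integral) auto
      then show "(\<integral>\<^sup>+x. ennreal (\<bar>f k x\<bar> powr r) \<partial>lebesgue) \<le> ennreal (a k)" using fa by (simp add: ennreal_leI)
    qed
    also have "\<dots> = ennreal (D * Y powr (r/p))"
      by (rule lim_imp_Liminf[OF _ tendsto_ennrealI[OF alim]]) simp
    finally have fin: "(\<integral>\<^sup>+x. ennreal (norm (v x) powr r) \<partial>lebesgue) \<le> ennreal (D * Y powr (r/p))" .
    have int: "integrable lebesgue (\<lambda>x. norm (v x) powr r)"
    proof (rule integrableI_bounded)
      show "(\<integral>\<^sup>+x. ennreal (norm (norm (v x) powr r)) \<partial>lebesgue) < \<infinity>"
        using fin by (simp add: le_less_trans)
    qed measurable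
    moreover have "(\<integral>x. norm (v x) powr r \<partial>lebesgue) \<le> D * Y powr (r/p)"
    proof -
      have "ennreal (\<integral>x. norm (v x) powr r \<partial>lebesgue) \<le> ennreal (D * Y powr (r/p))"
        using fin nn_integral_eq_integral[OF int] by simp
      moreover have "0 \<le> D * Y powr (r/p)" using C(1) by (simp add: D_def)
      ultimately show ?thesis by (simp add: ennreal_le_iff)
    qed
    ultimately show ?thesis by (simp add: in_Lp_def Y_def)
  qed
  then show ?thesis using C(1) by (intro exI[of _ D]) (auto simp: D_def)
qed

section \<open>Inclusions between exponents on bounded domains\<close>

lemma in_Lp_mono:
  fixes f :: "'a::euclidean_space \<Rightarrow> 'b::euclidean_space"
  assumes f: "in_Lp p f" and out: "\<And>x. x \<notin> \<Omega> \<Longrightarrow> f x = 0" and \<Omega>: "bounded \<Omega>" "\<Omega> \<in> sets lebesgue" and q: "0 < q" "q < p"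
  shows "in_Lp q f"
    and "(\<integral>x. norm (f x) powr q \<partial>lebesgue) \<le> (\<integral>x. norm (f x) powr p \<partial>lebesgue) powr (q/p) * measure lebesgue \<Omega> powr (1 - q/p)"
proof -
  have \<Omega>l: "\<Omega> \<in> lmeasurable" using \<Omega> by (simp add: bounded_set_imp_lmeasurable)
  have a: "0 < q/p" "q/p < 1" using q by auto
  have eq: "(norm (f x) powr p) powr (q/p) * indicator \<Omega> x powr (1 - q/p) = norm (f x) powr q" for x
    using q out[of x] by (auto simp: indicator_def powr_powr)
  have i: "integrable lebesgue (indicator \<Omega> :: 'a \<Rightarrow> real)" using \<Omega>l by (intro integrable_real_indicator) (auto simp: fmeasurable_def)
  have "integrable lebesgue (\<lambda>x. norm (f x) powr q)
     \<and> (\<integral>x. norm (f x) powr q \<partial>lebesgue) \<le> (\<integral>x. norm (f x) powr p \<partial>lebesgue) powr (q/p) * measure lebesgue \<Omega> powr (1 - q/p)"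
    using Holder_powr[OF a _ _ i, of "\<lambda>x. norm (f x) powr p", unfolded eq] f by (simp add: in_Lp_def)
  then show "in_Lp q f" "(\<integral>x. norm (f x) powr q \<partial>lebesgue) \<le> (\<integral>x. norm (f x) powr p \<partial>lebesgue) powr (q/p) * measure lebesgue \<Omega> powr (1 - q/p)"
    using f by (auto simp: in_Lp_def)
qed

lemma Lp_tendsto_mono:
  assumes L: "Lp_tendsto p fs f" and out: "\<And>k x. x \<notin> \<Omega> \<Longrightarrow> fs k x = 0" "\<And>x. x \<notin> \<Omega> \<Longrightarrow> f x = 0"
    and \<Omega>: "bounded \<Omega>" "\<Omega> \<in> sets lebesgue" and q: "0 < q" "q < p"
  shows "Lp_tendsto q fs f"
  unfolding Lp_tendsto_def
proof (intro conjI allI)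
  have i: "in_Lp p (fs k)" "in_Lp p f" for k using L by (auto simp: Lp_tendsto_def)
  show "in_Lp q (fs k)" for k by (rule in_Lp_mono(1)[OF i(1) _ \<Omega> q]) (use out in auto)
  show "in_Lp q f" by (rule in_Lp_mono(1)[OF i(2) _ \<Omega> q]) (use out in auto)
  have "norm (\<integral>x. norm (fs k x - f x) powr q \<partial>lebesgue) \<le> (\<integral>x. norm (fs k x - f x) powr p \<partial>lebesgue) powr (q/p) * measure lebesgue \<Omega> powr (1 - q/p)" for k
    using in_Lp_mono(2)[OF in_Lp_diff[OF i] _ \<Omega> q, of k] out q by auto
  moreover have "(\<lambda>k. (\<integral>x. norm (fs k x - f x) powr p \<partial>lebesgue) powr (q/p) * measure lebesgue \<Omega> powr (1 - q/p)) \<longlonglongrightarrow> 0"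
  proof -
    have "(\<lambda>k. (\<integral>x. norm (fs k x - f x) powr p \<partial>lebesgue) powr (q/p)) \<longlonglongrightarrow> 0 powr (q/p)"
      using L q by (intro tendsto_powr') (auto simp: Lp_tendsto_def)
    then show ?thesis by (auto intro!: tendsto_mult_left_zero)
  qed
  ultimately show "(\<lambda>k. \<integral>x. norm (fs k x - f x) powr q \<partial>lebesgue) \<longlonglongrightarrow> 0"
    by (rule Lim_null_comparison[OF always_eventually[OF allI]])
qed

lemma sobolev0_mono:
  assumes W: "sobolev0 \<Omega> p u G" and \<Omega>: "bounded \<Omega>" "open \<Omega>" and q: "0 < q" "q < p"
  shows "sobolev0 \<Omega> q u G"
proof -
  obtain \<phi>s gs where A: "\<And>k. test_fun \<Omega> (\<phi>s k)" "\<And>k. is_grad (\<phi>s k) (gs k)"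
    "Lp_tendsto p \<phi>s u" "Lp_tendsto p gs G" using W unfolding sobolev0_def by blast
  have S: "\<Omega> \<in> sets lebesgue" using \<Omega> by simp
  have out: "x \<notin> \<Omega> \<Longrightarrow> u x = 0" "x \<notin> \<Omega> \<Longrightarrow> G x = 0" for x using W by (auto simp: sobolev0_def)
  have outk: "\<phi>s k x = 0" "gs k x = 0" if "x \<notin> \<Omega>" for k x
    using test_fun_C1c[OF A(1,2)] that unfolding C1c_def by blast+
  show ?thesis unfolding sobolev0_def
    using Lp_tendsto_mono[OF A(3) outk(1) out(1) \<Omega>(1) S q] Lp_tendsto_mono[OF A(4) outk(2) out(2) \<Omega>(1) S q] A(1,2) out
    by blast
qed

section \<open>Dilations\<close>

lemma norm_powr_minus_2:
  fixes a :: "'b::real_inner"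
  assumes "1 < r"
  shows "norm a powr (r-2) * norm a = norm a powr (r-1)" "norm a powr (r-2) * (a \<bullet> a) = norm a powr r"
    "norm a powr (r-1) * norm a = norm a powr r"
proof -
  show 1: "norm a powr (r-2) * norm a = norm a powr (r-1)"
    using powr_add[of "norm a" "r-2" 1] assms by (cases "a = 0") auto
  show 2: "norm a powr (r-1) * norm a = norm a powr r"
    using powr_add[of "norm a" "r-1" 1] assms by (cases "a = 0") auto
  show "norm a powr (r-2) * (a \<bullet> a) = norm a powr r"
    unfolding dot_square_norm power2_eq_square mult.assoc[symmetric] 1 2 ..
qed

text \<open>The tangent inequality of the convex function |.|^r / r, obtained from Cauchy-Schwarz
  and Young. Every comparison of energies below, under dilation or under variation of
  \<open>u\<close>, is an integrated instance of it, so no energy functional has to be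
  differentiated.\<close>

lemma norm_powr_convex:
  fixes a b :: "'b::real_inner"
  assumes r: "1 < r"
  shows "norm a powr (r-2) * (a \<bullet> (b - a)) \<le> (norm b powr r - norm a powr r) / r"
proof -
  have "norm a powr (r-2) * (a \<bullet> b) \<le> norm a powr (r-2) * (norm a * norm b)"
    by (intro mult_left_mono norm_cauchy_schwarz) auto
  also have "\<dots> = norm a powr (r-1) * norm b" using norm_powr_minus_2(1)[OF r, of a] by (simp add: mult.assoc[symmetric])
  also have "\<dots> = (norm b powr r) powr (1/r) * (norm a powr r) powr (1 - 1/r)"
    using r by (simp add: powr_powr right_diff_distrib)
  also have "\<dots> \<le> (1/r) * norm b powr r + (1 - 1/r) * norm a powr r"
    using r by (intro Youngs_inequality_0') auto
  finally show ?thesis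
    using norm_powr_minus_2(2)[OF r, of a] by (simp add: inner_diff_right algebra_simps diff_divide_distrib)
qed

section \<open>Scaling of integrals and of Sobolev functions\<close>

definition dil :: "'a::euclidean_space \<Rightarrow> real \<Rightarrow> 'a \<Rightarrow> 'a" where
  "dil a l x = a + l *\<^sub>R (x - a)"

lemma lebesgue_dil:
  fixes a :: "'a::euclidean_space"
  assumes l: "0 < l"
  shows "(lebesgue :: 'a measure) = density (distr lebesgue lebesgue (dil a l)) (\<lambda>_. ennreal (l ^ DIM('a)))"
    and measurable_dil: "dil a l \<in> lebesgue \<rightarrow>\<^sub>M lebesgue"
proof -
  have "(a - l *\<^sub>R a) + (\<Sum>j\<in>Basis. (l * (x \<bullet> j)) *\<^sub>R j) = dil a l x" for x
    by (simp add: dil_def scaleR_scaleR[symmetric] scaleR_sum_right[symmetric] euclidean_representation algebra_simps del: scaleR_scaleR)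
  then show "(lebesgue :: 'a measure) = density (distr lebesgue lebesgue (dil a l)) (\<lambda>_. ennreal (l ^ DIM('a)))"
    "dil a l \<in> lebesgue \<rightarrow>\<^sub>M lebesgue"
    using lebesgue_affine_euclidean[of "\<lambda>_. l" "a - l *\<^sub>R a"] lebesgue_affine_measurable[of "\<lambda>_. l" "a - l *\<^sub>R a"] l
    by (simp_all add: fun_eq_iff[symmetric])
qed

lemma dil_borel_measurable: "0 < l \<Longrightarrow> f \<in> borel_measurable lebesgue \<Longrightarrow> (\<lambda>x. f (dil a l x)) \<in> borel_measurable lebesgue"
  using measurable_compose[OF measurable_dil] by blast

lemma integral_dil:
  fixes f :: "'a::euclidean_space \<Rightarrow> real"
  assumes l: "0 < l" and f: "f \<in> borel_measurable lebesgue"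
  shows "(\<integral>x. f (dil a l x) \<partial>lebesgue) = l powr (- real DIM('a)) * (\<integral>x. f x \<partial>lebesgue)"
    and "integrable lebesgue (\<lambda>x. f (dil a l x)) \<longleftrightarrow> integrable lebesgue f"
proof -
  let ?D = "distr (lebesgue::'a measure) lebesgue (dil a l)"
  note m = measurable_dil[OF l, of a]
  have f': "f \<in> borel_measurable ?D" using f by simp
  have lN: "0 < l ^ DIM('a)" using l by simp
  have "(\<integral>x. f x \<partial>lebesgue) = (\<integral>x. f x \<partial>density ?D (\<lambda>_. ennreal (l ^ DIM('a))))"
    using lebesgue_dil[OF l, of a] by simp
  also have "\<dots> = (\<integral>x. l ^ DIM('a) *\<^sub>R f x \<partial>?D)"
    using l f' by (intro integral_density) auto
  also have "\<dots> = l ^ DIM('a) * (\<integral>x. f (dil a l x) \<partial>lebesgue)"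
    using integral_distr[OF m f] by simp
  finally show "(\<integral>x. f (dil a l x) \<partial>lebesgue) = l powr (- real DIM('a)) * (\<integral>x. f x \<partial>lebesgue)"
    using l by (simp add: powr_minus powr_realpow)
  have "integrable lebesgue f \<longleftrightarrow> integrable (density ?D (\<lambda>_. ennreal (l ^ DIM('a)))) f"
    using lebesgue_dil[OF l, of a] by simp
  also have "\<dots> \<longleftrightarrow> integrable ?D (\<lambda>x. l ^ DIM('a) *\<^sub>R f x)"
    using l f' by (intro integrable_density) auto
  also have "\<dots> \<longleftrightarrow> integrable lebesgue (\<lambda>x. f (dil a l x))"
    using integrable_distr_eq[OF m f] l by simp
  finally show "integrable lebesgue (\<lambda>x. f (dil a l x)) \<longleftrightarrow> integrable lebesgue f" by simp
qed

lemma in_Lp_dil: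
  fixes f :: "'a::euclidean_space \<Rightarrow> 'b::euclidean_space"
  assumes f: "in_Lp p f" and l: "0 < l"
  shows "in_Lp p (\<lambda>x. f (dil a l x))"
    and "(\<integral>x. norm (f (dil a l x)) powr p \<partial>lebesgue) = l powr (- real DIM('a)) * (\<integral>x. norm (f x) powr p \<partial>lebesgue)"
proof -
  have m: "f \<in> borel_measurable lebesgue" using f by (simp add: in_Lp_def)
  have n: "(\<lambda>x. norm (f x) powr p) \<in> borel_measurable lebesgue" using m by measurable
  show "in_Lp p (\<lambda>x. f (dil a l x))"
    unfolding in_Lp_def using dil_borel_measurable[OF l m] integral_dil(2)[OF l n] f by (simp add: in_Lp_def)
  show "(\<integral>x. norm (f (dil a l x)) powr p \<partial>lebesgue) = l powr (- real DIM('a)) * (\<integral>x. norm (f x) powr p \<partial>lebesgue)"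
    by (rule integral_dil(1)[OF l n])
qed

lemma Lp_tendsto_dil:
  assumes L: "Lp_tendsto p fs f" and l: "0 < l" and p: "0 < p"
  shows "Lp_tendsto p (\<lambda>k x. fs k (dil a l x)) (\<lambda>x. f (dil a l x))"
proof -
  have i: "in_Lp p (fs k)" "in_Lp p f" for k using L by (auto simp: Lp_tendsto_def)
  show ?thesis unfolding Lp_tendsto_def
    using in_Lp_dil(1)[OF i(1) l] in_Lp_dil(1)[OF i(2) l] in_Lp_dil(2)[OF in_Lp_diff[OF i] l] L p
    by (auto simp: Lp_tendsto_def intro!: tendsto_mult_right_zero)
qed

text \<open>For l > 1 the point lies on the segment from the centre to its dilate. Read
  contrapositively, dilates of outside points stay outside, so u_l vanishes off the domain.
  Star-shapedness enters through this, and it is the reason for dilating with l > 1 only.\<close>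

lemma dil_in_star:
  assumes star: "\<And>x. x \<in> \<Omega> \<Longrightarrow> closed_segment a x \<subseteq> \<Omega>" and l: "1 < l" and x: "dil a l x \<in> \<Omega>"
  shows "x \<in> \<Omega>"
proof -
  have "x \<in> closed_segment a (dil a l x)" unfolding in_segment
    using l by (intro exI[of _ "1/l"]) (auto simp: dil_def algebra_simps)
  then show ?thesis using star[OF x] by blast
qed

lemma sobolev0_dil:
  fixes \<Omega> :: "'a::euclidean_space set"
  assumes W: "sobolev0 \<Omega> p u G" and star: "\<And>x. x \<in> \<Omega> \<Longrightarrow> closed_segment a x \<subseteq> \<Omega>" and l: "1 < l" and p: "0 < p"
  shows "sobolev0 \<Omega> p (\<lambda>x. u (dil a l x)) (\<lambda>x. l *\<^sub>R G (dil a l x))"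
proof -
  have l0: "0 < l" using l by simp
  obtain \<phi>s gs where A: "\<And>k. test_fun \<Omega> (\<phi>s k)" "\<And>k. is_grad (\<phi>s k) (gs k)"
    "Lp_tendsto p \<phi>s u" "Lp_tendsto p gs G" using W unfolding sobolev0_def by blast
  have out: "x \<notin> \<Omega> \<Longrightarrow> u x = 0" "x \<notin> \<Omega> \<Longrightarrow> G x = 0" for x using W by (auto simp: sobolev0_def)
  have t: "test_fun \<Omega> (\<lambda>x. \<phi>s k (dil a l x))" for k
  proof -
    obtain K where K: "Cinf (\<phi>s k)" "compact K" "K \<subseteq> \<Omega>" "\<And>x. x \<notin> K \<Longrightarrow> \<phi>s k x = 0"
      by (rule test_funE[OF A(1)[of k]], rule that)
    have "Cinf (\<lambda>x. \<phi>s k ((a - l *\<^sub>R a) + l *\<^sub>R x))" by (rule Cinf_affine[OF K(1)])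
    then have C: "Cinf (\<lambda>x. \<phi>s k (dil a l x))" by (simp add: dil_def algebra_simps)
    let ?K = "dil a (1/l) ` K"
    have inv: "dil a (1/l) (dil a l x) = x" "dil a l (dil a (1/l) x) = x" for x using l by (auto simp: dil_def)
    have "compact ?K" unfolding dil_def by (intro compact_continuous_image continuous_intros K(2))
    moreover have "?K \<subseteq> \<Omega>" using dil_in_star[OF star l] K(3) inv by auto
    moreover have "\<phi>s k (dil a l x) = 0" if "x \<notin> ?K" for x
    proof (rule K(4))
      show "dil a l x \<notin> K" using that inv(1)[of x] by (metis imageI)
    qed
    ultimately show ?thesis by (rule test_funI[OF C])
  qed
  have g: "is_grad (\<lambda>x. \<phi>s k (dil a l x)) (\<lambda>x. l *\<^sub>R gs k (dil a l x))" for k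
    unfolding is_grad_def
  proof
    fix x
    have "((\<lambda>x. \<phi>s k (dil a l x)) has_derivative (\<lambda>h. gs k (dil a l x) \<bullet> (l *\<^sub>R h))) (at x)"
      by (rule has_derivative_compose[where g="\<phi>s k" and g'="\<lambda>h. gs k (dil a l x) \<bullet> h"])
        (use A(2)[of k] in \<open>auto simp: is_grad_def dil_def intro!: derivative_eq_intros\<close>)
    then show "((\<lambda>x. \<phi>s k (dil a l x)) has_derivative (\<lambda>h. l *\<^sub>R gs k (dil a l x) \<bullet> h)) (at x)" by simp
  qed
  have "in_Lp p (gs k)" "in_Lp p G" for k using A(4) by (auto simp: Lp_tendsto_def)
  then have "Lp_tendsto p (\<lambda>k x. l *\<^sub>R gs k (dil a l x)) (\<lambda>x. l *\<^sub>R G (dil a l x))"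
    using l0 p by (intro Lp_tendsto_bound[OF Lp_tendsto_dil[OF A(4) l0 p, of a], where C=l] in_Lp_scaleR[where C=l] in_Lp_dil(1))
      (auto simp: scaleR_right_diff_distrib[symmetric])
  moreover have "u (dil a l x) = 0" "G (dil a l x) = 0" if "x \<notin> \<Omega>" for x
    using out[of "dil a l x"] dil_in_star[OF star l] that by blast+
  ultimately show ?thesis unfolding sobolev0_def
    using t g Lp_tendsto_dil[OF A(3) l0 p, of a]
    by (intro conjI exI[of _ "\<lambda>k x. \<phi>s k (dil a l x)"] exI[of _ "\<lambda>k x. l *\<^sub>R gs k (dil a l x)"]) auto
qed

text \<open>The fundamental theorem along the radial path s -> \<open>dil a s x\<close> for 1 \<le>
  s \<le> l, then Hoelder in s and an exchange of integrals. The change of variables costs s^{-N}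
  \<le> 1. Hoelder contributes (l-1)^{p-1} and the length of the interval another factor
  l-1.\<close>

lemma dil_diff_C1c:
  fixes \<phi> :: "'a::euclidean_space \<Rightarrow> real"
  assumes c: "C1c \<Omega> \<phi> g" and \<Omega>: "\<Omega> \<subseteq> cball a R" "0 < R" and l: "1 < l" and p: "1 < p"
  shows "(\<integral>x. norm (\<phi> (dil a l x) - \<phi> x) powr p \<partial>lebesgue) \<le> R powr p * (l-1) powr p * (\<integral>x. norm (g x) powr p \<partial>lebesgue)"
proof -
  have p0: "0 < p" using p by simp
  have cg: "continuous_on UNIV g" and grad: "is_grad \<phi> g" using c by (auto simp: C1c_def)
  have out: "x \<notin> \<Omega> \<Longrightarrow> \<phi> x = 0 \<and> g x = 0" for x using c unfolding C1c_def by blast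
  have [measurable]: "\<phi> \<in> borel_measurable borel" "g \<in> borel_measurable borel"
    using C1c_continuous[OF c] by (auto intro: borel_measurable_continuous_onI)
  have [measurable]: "(\<lambda>(x,s). dil a s x) \<in> borel \<Otimes>\<^sub>M borel \<rightarrow>\<^sub>M borel" unfolding dil_def by measurable
  have [measurable]: "dil a s \<in> borel \<rightarrow>\<^sub>M borel" for s unfolding dil_def[abs_def] by measurable
  define Y where "Y = (\<integral>x. norm (g x) powr p \<partial>lebesgue)"
  have Y0: "0 \<le> Y" by (simp add: Y_def)
  define I where "I x = (\<integral>s. indicator {1..l} s * norm (g (dil a s x)) powr p \<partial>lborel)" for x
  have cgs: "continuous_on UNIV (\<lambda>s. g (dil a s x))" for x
    unfolding dil_def by (rule continuous_on_compose2[OF cg]) (auto intro!: continuous_intros)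
  have ip: "integrable lborel (\<lambda>s. indicator {1..l} s * norm (g (dil a s x)) powr p)" for x
  proof -
    have "integrable lborel (\<lambda>s. indicator {1..l} s *\<^sub>R (norm (g (dil a s x)) powr p))"
      by (rule borel_integrable_compact) (use p in \<open>auto intro!: continuous_on_powr' continuous_on_norm continuous_on_const continuous_on_subset[OF cgs]\<close>)
    then show ?thesis by simp
  qed
  have pw: "norm (\<phi> (dil a l x) - \<phi> x) powr p \<le> R powr p * (l-1) powr (p-1) * I x" for x
  proof -
    have i1: "integrable lborel (\<lambda>s. indicator {1..l} s * norm (g (dil a s x)))"
    proof -
      have "integrable lborel (\<lambda>s. indicator {1..l} s *\<^sub>R (norm (g (dil a s x))))"
        by (rule borel_integrable_compact) (auto intro!: continuous_on_norm continuous_on_subset[OF cgs])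
      then show ?thesis by simp
    qed
    have "(\<integral>s. indicator {1..l} s *\<^sub>R (g (dil a s x) \<bullet> (x - a)) \<partial>lborel) = \<phi> (dil a l x) - \<phi> (dil a 1 x)"
    proof (rule integral_FTC_Icc)
      show "1 \<le> l" using l by simp
      show "continuous_on {1..l} (\<lambda>s. g (dil a s x) \<bullet> (x - a))"
        by (intro continuous_intros continuous_on_subset[OF cgs]) auto
      fix s
      have "((\<lambda>s. \<phi> (dil a s x)) has_derivative (\<lambda>h. g (dil a s x) \<bullet> (h *\<^sub>R (x - a)))) (at s)"
        by (rule has_derivative_compose[where g=\<phi> and g'="\<lambda>h. g (dil a s x) \<bullet> h"])
          (use grad in \<open>auto simp: is_grad_def dil_def intro!: derivative_eq_intros\<close>)
      then have "((\<lambda>s. \<phi> (dil a s x)) has_vector_derivative (g (dil a s x) \<bullet> (x - a))) (at s)"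
        by (simp add: has_vector_derivative_def)
      then show "((\<lambda>s. \<phi> (dil a s x)) has_vector_derivative (g (dil a s x) \<bullet> (x - a))) (at s within {1..l})"
        by (rule has_vector_derivative_at_within)
    qed
    then have "norm (\<phi> (dil a l x) - \<phi> x) = norm (\<integral>s. indicator {1..l} s *\<^sub>R (g (dil a s x) \<bullet> (x - a)) \<partial>lborel)"
      by (simp add: dil_def)
    also have "\<dots> \<le> (\<integral>s. R * (indicator {1..l} s * norm (g (dil a s x))) \<partial>lborel)"
    proof (rule Bochner_Integration.integral_norm_bound_integral)
      show "integrable lborel (\<lambda>s. indicator {1..l} s *\<^sub>R (g (dil a s x) \<bullet> (x - a)))"
        by (rule borel_integrable_compact) (auto intro!: continuous_intros continuous_on_subset[OF cgs])
      show "integrable lborel (\<lambda>s. R * (indicator {1..l} s * norm (g (dil a s x))))" using i1 by simp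
      fix s
      have "\<bar>g (dil a s x) \<bullet> (x - a)\<bar> \<le> R * norm (g (dil a s x))" if s: "s \<in> {1..l}"
      proof (cases "dil a s x \<in> \<Omega>")
        case True
        \<comment> \<open>Where the gradient does not vanish the dilated point lies in the domain,
          hence within R of the centre; since s \<ge> 1, the point \<open>x\<close> itself is no
          farther away.\<close>
        have "norm (x - a) \<le> s * norm (x - a)" using s by (simp add: mult_le_cancel_right1)
        also have "\<dots> = dist a (dil a s x)" using s by (simp add: dil_def dist_norm)
        also have "\<dots> \<le> R" using True \<Omega> by (auto simp: subset_iff)
        finally have "norm (g (dil a s x)) * norm (x - a) \<le> norm (g (dil a s x)) * R" by (intro mult_left_mono) auto
        then show ?thesis using Cauchy_Schwarz_ineq2[of "g (dil a s x)" "x - a"] by (simp add: mult.commute)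
      next
        case False then show ?thesis using out by simp
      qed
      then show "norm (indicator {1..l} s *\<^sub>R (g (dil a s x) \<bullet> (x - a))) \<le> R * (indicator {1..l} s * norm (g (dil a s x)))"
        by (auto simp: indicator_def)
    qed
    also have "\<dots> = R * (\<integral>s. indicator {1..l} s * norm (g (dil a s x)) \<partial>lborel)" by simp
    also have "(\<integral>s. indicator {1..l} s * norm (g (dil a s x)) \<partial>lborel) \<le> I x powr (1/p) * (l-1) powr (1-1/p)"
    proof -
      have eq: "(indicator {1..l} s * norm (g (dil a s x)) powr p) powr (1/p) * indicator {1..l} s powr (1-1/p) = indicator {1..l} s * norm (g (dil a s x))" for s
        using p by (auto simp: indicator_def powr_powr)
      have "(\<integral>s. indicator {1..l} s * norm (g (dil a s x)) \<partial>lborel)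
        \<le> (\<integral>s. indicator {1..l} s * norm (g (dil a s x)) powr p \<partial>lborel) powr (1/p) * (\<integral>s. indicator {1..l} s \<partial>lborel) powr (1-1/p)"
        using Holder_powr(2)[of "1/p" lborel "\<lambda>s. indicator {1..l} s * norm (g (dil a s x)) powr p" "indicator {1..l}", unfolded eq] ip p by auto
      then show ?thesis using l by (simp add: I_def)
    qed
    finally have "norm (\<phi> (dil a l x) - \<phi> x) \<le> R * (I x powr (1/p) * (l-1) powr (1-1/p))" using \<Omega>(2) by simp
    then have "norm (\<phi> (dil a l x) - \<phi> x) powr p \<le> (R * (I x powr (1/p) * (l-1) powr (1-1/p))) powr p"
      using p by (intro powr_mono2) auto
    also have "\<dots> = R powr p * (l-1) powr (p-1) * I x"
    proof -
      have I0: "0 \<le> I x" by (simp add: I_def)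
      have "(1-1/p)*p = p-1" using p by (simp add: left_diff_distrib)
      then show ?thesis using p \<Omega>(2) l I0 by (simp add: powr_mult powr_powr)
    qed
    finally show ?thesis .
  qed
  have Yleb: "(\<integral>\<^sup>+x. ennreal (norm (g (dil a s x)) powr p) \<partial>lborel) \<le> ennreal Y" if s: "s \<in> {1..l}" for s
  proof -
    have ig: "in_Lp p g" by (rule C1c_in_Lp(2)[OF c p0])
    have s0: "0 < s" using s by auto
    have "(\<integral>\<^sup>+x. ennreal (norm (g (dil a s x)) powr p) \<partial>lborel) = (\<integral>\<^sup>+x. ennreal (norm (g (dil a s x)) powr p) \<partial>lebesgue)"
      by (simp add: nn_integral_completion)
    also have "\<dots> = ennreal (\<integral>x. norm (g (dil a s x)) powr p \<partial>lebesgue)"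
      using in_Lp_dil(1)[OF ig s0] by (intro nn_integral_eq_integral) (auto simp: in_Lp_def)
    also have "\<dots> = ennreal (s powr (- real DIM('a)) * Y)" by (simp add: in_Lp_dil(2)[OF ig s0] Y_def)
    also have "\<dots> \<le> ennreal Y"
    proof (rule ennreal_leI)
      have "s powr (- real DIM('a)) \<le> s powr 0" using s by (intro powr_mono) auto
      then have "s powr (- real DIM('a)) * Y \<le> 1 * Y" using Y0 s0 by (intro mult_right_mono) auto
      then show "s powr (- real DIM('a)) * Y \<le> Y" by simp
    qed
    finally show ?thesis .
  qed
  define C where "C = R powr p * (l-1) powr (p-1)"
  have C0: "0 \<le> C" by (simp add: C_def)
  \<comment> \<open>Integrals are exchanged over \<open>lborel\<close>, where the continuous
    integrand is jointly measurable without further work; the completion is restored at the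
    end.\<close>
  have mm: "(\<lambda>(x,s). ennreal (indicator {1..l} s * norm (g (dil a s x)) powr p)) \<in> borel_measurable (lborel \<Otimes>\<^sub>M lborel)"
    by measurable
  have "(\<integral>\<^sup>+x. ennreal (norm (\<phi> (dil a l x) - \<phi> x) powr p) \<partial>lborel) \<le> (\<integral>\<^sup>+x. ennreal C * ennreal (I x) \<partial>lborel)"
    using pw C0 by (intro nn_integral_mono) (auto simp: C_def ennreal_mult'[symmetric] intro!: ennreal_leI)
  also have "\<dots> = ennreal C * (\<integral>\<^sup>+x. ennreal (I x) \<partial>lborel)"
    unfolding I_def by (intro nn_integral_cmult) measurable
  also have "(\<integral>\<^sup>+x. ennreal (I x) \<partial>lborel) = (\<integral>\<^sup>+x. \<integral>\<^sup>+s. ennreal (indicator {1..l} s * norm (g (dil a s x)) powr p) \<partial>lborel \<partial>lborel)"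
    unfolding I_def using ip by (intro nn_integral_cong nn_integral_eq_integral[symmetric]) auto
  also have "\<dots> = (\<integral>\<^sup>+s. \<integral>\<^sup>+x. ennreal (indicator {1..l} s * norm (g (dil a s x)) powr p) \<partial>lborel \<partial>lborel)"
    using lborel_pair.Fubini'[OF mm] by simp
  also have "\<dots> \<le> (\<integral>\<^sup>+s. ennreal Y * indicator {1..l} (s::real) \<partial>lborel)"
    by (rule nn_integral_mono) (use Yleb in \<open>auto simp: indicator_def\<close>)
  also have "\<dots> = ennreal (Y * (l-1))" using l Y0 by (simp add: nn_integral_cmult_indicator ennreal_mult)
  finally have "(\<integral>\<^sup>+x. ennreal (norm (\<phi> (dil a l x) - \<phi> x) powr p) \<partial>lborel) \<le> ennreal C * ennreal (Y * (l-1))"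
    by (simp add: mult_left_mono)
  also have "\<dots> = ennreal (C * (Y * (l-1)))" using C0 by (simp add: ennreal_mult')
  finally have fin: "(\<integral>\<^sup>+x. ennreal (norm (\<phi> (dil a l x) - \<phi> x) powr p) \<partial>lborel) \<le> ennreal (C * (Y * (l-1)))" .
  have id: "in_Lp p (\<lambda>x. \<phi> (dil a l x) - \<phi> x)"
    using C1c_in_Lp(1)[OF c p0] l p by (intro in_Lp_diff in_Lp_dil) auto
  have "ennreal (\<integral>x. norm (\<phi> (dil a l x) - \<phi> x) powr p \<partial>lebesgue) = (\<integral>\<^sup>+x. ennreal (norm (\<phi> (dil a l x) - \<phi> x) powr p) \<partial>lebesgue)"
    using id by (intro nn_integral_eq_integral[symmetric]) (auto simp: in_Lp_def)
  also have "\<dots> \<le> ennreal (C * (Y * (l-1)))" using fin by (simp add: nn_integral_completion)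
  finally have "(\<integral>x. norm (\<phi> (dil a l x) - \<phi> x) powr p \<partial>lebesgue) \<le> C * (Y * (l-1))"
    using C0 Y0 l by (simp add: ennreal_le_iff)
  also have "\<dots> = R powr p * ((l-1) powr (p-1) * (l-1)) * Y" by (simp add: C_def)
  also have "(l-1) powr (p-1) * (l-1) = (l-1) powr p" using powr_add[of "l-1" "p-1" 1] l by simp
  finally show ?thesis by (simp add: Y_def)
qed

text \<open>This makes the quotients (u_l - u)/(l - 1) bounded in L^p. The constant 4 stems from two
  uses of \<open>Lp_norm_le\<close>, one for the functions and one for the gradients.\<close>

lemma dil_diff_sobolev0:
  fixes \<Omega> :: "'a::euclidean_space set"
  assumes W: "sobolev0 \<Omega> p u G" and \<Omega>: "\<Omega> \<subseteq> cball a R" "0 < R" and l: "1 < l" and p: "1 < p"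
  shows "(\<integral>x. norm (u (dil a l x) - u x) powr p \<partial>lebesgue) \<le> (4 * R) powr p * (\<integral>x. norm (G x) powr p \<partial>lebesgue) * (l-1) powr p"
proof -
  have p0: "0 < p" and l0: "0 < l" using p l by auto
  obtain \<phi>s gs where A: "\<And>k. C1c \<Omega> (\<phi>s k) (gs k)" "Lp_tendsto p \<phi>s u" "Lp_tendsto p gs G"
    by (rule sobolev0_approx[OF W p0], rule that)
  note iu = sobolev0_in_Lp[OF W]
  define e where "e k = (\<integral>x. norm ((u (dil a l x) - u x) - (\<phi>s k (dil a l x) - \<phi>s k x)) powr p \<partial>lebesgue)" for k
  define d where "d k = (\<integral>x. norm (gs k x - G x) powr p \<partial>lebesgue)" for k
  define Y where "Y = (\<integral>x. norm (G x) powr p \<partial>lebesgue)"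
  have d0: "d \<longlonglongrightarrow> 0" using A(3) by (simp add: Lp_tendsto_def d_def[abs_def])
  have L: "Lp_tendsto p (\<lambda>k x. \<phi>s k (dil a l x) - \<phi>s k x) (\<lambda>x. u (dil a l x) - u x)"
    using Lp_tendsto_diff_scaleR[OF Lp_tendsto_dil[OF A(2) l0 p0] A(2) p0, of a 1] by simp
  have e0: "e \<longlonglongrightarrow> 0" using L unfolding e_def by (simp add: Lp_tendsto_def abs_minus_commute)
  have iL: "in_Lp p (\<lambda>x. \<phi>s k (dil a l x) - \<phi>s k x)" "in_Lp p (\<lambda>x. u (dil a l x) - u x)" "in_Lp p (gs k)" for k
    using L A(3) by (auto simp: Lp_tendsto_def)
  have le: "(\<integral>x. norm (u (dil a l x) - u x) powr p \<partial>lebesgue) \<le> 2 powr p * (e k + R powr p * (l-1) powr p * (2 powr p * (d k + Y)))" for k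
  proof -
    have "(\<integral>x. norm (u (dil a l x) - u x) powr p \<partial>lebesgue) \<le> 2 powr p * (e k + (\<integral>x. norm (\<phi>s k (dil a l x) - \<phi>s k x) powr p \<partial>lebesgue))"
      using Lp_norm_le[OF iL(2) iL(1) p0, of k] by (simp add: e_def)
    also have "(\<integral>x. norm (\<phi>s k (dil a l x) - \<phi>s k x) powr p \<partial>lebesgue) \<le> R powr p * (l-1) powr p * (\<integral>x. norm (gs k x) powr p \<partial>lebesgue)"
      by (rule dil_diff_C1c[OF A(1) \<Omega> l p])
    also have "\<dots> \<le> R powr p * (l-1) powr p * (2 powr p * (d k + Y))"
      unfolding d_def Y_def by (intro mult_left_mono Lp_norm_le iL iu p0) auto
    finally show ?thesis by simp
  qed
  have lim: "(\<lambda>k. 2 powr p * (e k + R powr p * (l-1) powr p * (2 powr p * (d k + Y)))) \<longlonglongrightarrow>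
      2 powr p * (0 + R powr p * (l-1) powr p * (2 powr p * (0 + Y)))"
    by (intro tendsto_mult tendsto_const tendsto_add e0 d0)
  have "(\<integral>x. norm (u (dil a l x) - u x) powr p \<partial>lebesgue) \<le> 2 powr p * (0 + R powr p * (l-1) powr p * (2 powr p * (0 + Y)))"
    by (rule LIMSEQ_le_const[OF lim]) (use le in blast)
  also have "\<dots> = (4 * R) powr p * Y * (l-1) powr p"
    using \<Omega>(2) powr_mult[of 2 2 p] by (simp add: powr_mult)
  finally show ?thesis by (simp add: Y_def)
qed

text \<open>Riesz's argument: Fatou's lemma for the nonnegative functions 2^s (|f_k|^s + |f|^s) -
  |f_k - f|^s. Their integrals differ from a convergent sequence by exactly the quantity that has to
  vanish.\<close>

lemma Lp_tendsto_Riesz: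
  fixes f :: "'a::euclidean_space \<Rightarrow> 'b::euclidean_space"
  assumes s: "0 < s" and i: "\<And>k. in_Lp s (fs k)" "in_Lp s f" and ae: "AE x in lebesgue. (\<lambda>k. fs k x) \<longlonglongrightarrow> f x"
    and n: "(\<lambda>k. \<integral>x. norm (fs k x) powr s \<partial>lebesgue) \<longlonglongrightarrow> (\<integral>x. norm (f x) powr s \<partial>lebesgue)"
  shows "Lp_tendsto s fs f"
proof -
  define d where "d k = (\<integral>x. norm (fs k x - f x) powr s \<partial>lebesgue)" for k
  define w where "w k x = 2 powr s * (norm (fs k x) powr s + norm (f x) powr s) - norm (fs k x - f x) powr s" for k x
  define X where "X = (\<integral>x. norm (f x) powr s \<partial>lebesgue)"
  define b where "b k = 2 powr s * ((\<integral>x. norm (fs k x) powr s \<partial>lebesgue) + X)" for k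
  have [measurable]: "fs k \<in> borel_measurable lebesgue" "f \<in> borel_measurable lebesgue" for k using i by (auto simp: in_Lp_def)
  have d0: "0 \<le> d k" for k by (simp add: d_def)
  have id: "integrable lebesgue (\<lambda>x. norm (fs k x - f x) powr s)" "integrable lebesgue (\<lambda>x. norm (fs k x) powr s)"
    "integrable lebesgue (\<lambda>x. norm (f x) powr s)" for k
    using in_Lp_diff[OF i] i s by (auto simp: in_Lp_def)
  have w0: "0 \<le> w k x" for k x
    unfolding w_def using norm_add_powr_le[of s "fs k x" "- f x"] s by simp
  have iw: "integrable lebesgue (w k)" for k unfolding w_def using id by auto
  have Iw: "(\<integral>x. w k x \<partial>lebesgue) = b k - d k" for k
    unfolding w_def b_def d_def X_def using id by simp
  have "b \<longlonglongrightarrow> 2 powr s * (X + X)" unfolding b_def using n by (intro tendsto_intros) (simp add: X_def)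
  then have b: "b \<longlonglongrightarrow> 2 * 2 powr s * X" by (simp add: mult_ac)
  have "ennreal (2 * 2 powr s * X) = (\<integral>\<^sup>+x. ennreal (2 * 2 powr s * norm (f x) powr s) \<partial>lebesgue)"
    using id by (subst nn_integral_eq_integral) (auto simp: X_def)
  also have "\<dots> = (\<integral>\<^sup>+x. liminf (\<lambda>k. ennreal (w k x)) \<partial>lebesgue)"
  proof (rule nn_integral_cong_AE)
    show "AE x in lebesgue. ennreal (2 * 2 powr s * norm (f x) powr s) = liminf (\<lambda>k. ennreal (w k x))"
      using ae
    proof eventually_elim
      case (elim x)
      have "(\<lambda>k. w k x) \<longlonglongrightarrow> 2 powr s * (norm (f x) powr s + norm (f x) powr s) - norm (f x - f x) powr s"
        unfolding w_def using elim s by (intro tendsto_diff tendsto_mult tendsto_const tendsto_add tendsto_powr' tendsto_norm) auto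
      then have "(\<lambda>k. w k x) \<longlonglongrightarrow> 2 * 2 powr s * norm (f x) powr s" by (simp add: mult_ac)
      from lim_imp_Liminf[OF _ tendsto_ennrealI[OF this]] show ?case by simp
    qed
  qed
  also have "\<dots> \<le> liminf (\<lambda>k. \<integral>\<^sup>+x. ennreal (w k x) \<partial>lebesgue)"
    by (rule nn_integral_liminf) (auto simp: w_def)
  also have "(\<lambda>k. \<integral>\<^sup>+x. ennreal (w k x) \<partial>lebesgue) = (\<lambda>k. ennreal (b k - d k))"
    using iw w0 by (auto simp: nn_integral_eq_integral Iw)
  finally have fatou: "ennreal (2 * 2 powr s * X) \<le> liminf (\<lambda>k. ennreal (b k - d k))" .
  have X0: "0 \<le> X" by (simp add: X_def)
  have "d \<longlonglongrightarrow> 0"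
  proof (rule LIMSEQ_I)
    fix \<epsilon> :: real assume \<epsilon>: "0 < \<epsilon>"
    let ?B = "2 * 2 powr s * X"
    have ev1: "eventually (\<lambda>k. b k < ?B + \<epsilon>/2) sequentially"
      using order_tendstoD(2)[OF b, of "?B + \<epsilon>/2"] \<epsilon> by simp
    have ev2: "eventually (\<lambda>k. ?B - \<epsilon>/2 < b k - d k) sequentially"
    \<comment> \<open>\<open>ennreal\<close> sends negative numbers to 0, so a negative threshold
      cannot be compared there; in that case nonnegativity of the integrals suffices.\<close>
    proof (cases "?B - \<epsilon>/2 < 0")
      case True
      have nn: "0 \<le> b k - d k" for k using Iw[of k] w0 by (metis integral_nonneg_AE AE_I2)
      show ?thesis
      proof (intro always_eventually allI)
        show "?B - \<epsilon>/2 < b k - d k" for k using True nn[of k] by linarith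
      qed
    next
      case False
      have "ennreal (?B - \<epsilon>/2) < ennreal ?B" by (rule ennreal_lessI) (use False \<epsilon> in linarith)+
      also note fatou
      finally have "eventually (\<lambda>k. ennreal (?B - \<epsilon>/2) < ennreal (b k - d k)) sequentially"
        by (rule less_LiminfD)
      then show ?thesis
        by eventually_elim (use False in \<open>simp add: ennreal_less_iff\<close>)
    qed
    from ev1 ev2 have "eventually (\<lambda>k. norm (d k - 0) < \<epsilon>) sequentially"
      by eventually_elim (use d0 in \<open>auto simp: abs_less_iff\<close>)
    then show "\<exists>no. \<forall>n\<ge>no. norm (d n - 0) < \<epsilon>" by (simp add: eventually_sequentially)
  qed
  then show ?thesis unfolding Lp_tendsto_def using i by (simp add: d_def[abs_def])
qed

lemma powr_diff_quotient:
  fixes ls :: "nat \<Rightarrow> real"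
  assumes ls: "\<And>k. 1 < ls k" "ls \<longlonglongrightarrow> 1"
  shows "(\<lambda>k. (ls k powr c - 1) / (ls k - 1)) \<longlonglongrightarrow> c"
proof -
  have "((\<lambda>x. x powr c) has_real_derivative c * 1 powr (c - 1)) (at (1::real))"
    by (rule has_real_derivative_powr) simp
  then have "((\<lambda>y. (y powr c - 1 powr c) / (y - 1)) \<longlongrightarrow> c) (at (1::real))"
    by (simp add: has_field_derivative_iff)
  moreover have "filterlim ls (at 1) sequentially"
    using ls by (auto simp: filterlim_at less_imp_neq[THEN not_sym])
  ultimately have "(\<lambda>k. (ls k powr c - 1 powr c) / (ls k - 1)) \<longlonglongrightarrow> c"
    by (rule filterlim_compose)
  then show ?thesis by simp
qed

text \<open>Since u_l - u tends to 0 in L^p, convergence almost everywhere holds along a subsequence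
  of the factors 1 + 1/(k+1). Fixing it once lets all limits of the Pohozaev argument run along the
  same sequence.\<close>

lemma sobolev0_dil_seq:
  fixes \<Omega> :: "'a::euclidean_space set"
  assumes W: "sobolev0 \<Omega> p u G" and \<Omega>: "\<Omega> \<subseteq> cball a R" "0 < R" and p: "1 < p"
  obtains ls :: "nat \<Rightarrow> real" where "\<And>k. 1 < ls k" "ls \<longlonglongrightarrow> 1" "AE x in lebesgue. (\<lambda>k. u (dil a (ls k) x)) \<longlonglongrightarrow> u x"
proof -
  define l where "l k = 1 + inverse (real (Suc k))" for k
  have l1: "1 < l k" for k by (simp add: l_def)
  have "l \<longlonglongrightarrow> 1 + 0" unfolding l_def by (intro tendsto_intros LIMSEQ_inverse_real_of_nat)
  then have l: "l \<longlonglongrightarrow> 1" by simp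
  define M where "M = (4 * R) powr p * (\<integral>x. norm (G x) powr p \<partial>lebesgue)"
  have lim: "(\<lambda>k. M * (l k - 1) powr p) \<longlonglongrightarrow> M * (1 - 1) powr p"
    using p l1 by (intro tendsto_intros tendsto_powr' l) (auto intro!: always_eventually less_imp_le)
  have "Lp_tendsto p (\<lambda>k x. u (dil a (l k) x)) u"
    unfolding Lp_tendsto_def
  proof (intro conjI allI)
    show "in_Lp p u" by (rule sobolev0_in_Lp[OF W])
    then show "in_Lp p (\<lambda>x. u (dil a (l k) x))" for k using l1[of k] by (intro in_Lp_dil) auto
    show "(\<lambda>k. \<integral>x. norm (u (dil a (l k) x) - u x) powr p \<partial>lebesgue) \<longlonglongrightarrow> 0"
      by (rule Lim_null_comparison[OF always_eventually[OF allI], of _ "\<lambda>k. M * (l k - 1) powr p"])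
        (use dil_diff_sobolev0[OF W \<Omega> l1 p] lim in \<open>auto simp: M_def\<close>)
  qed
  then obtain s where s: "strict_mono s" "AE x in lebesgue. (\<lambda>k. u (dil a (l (s k)) x)) \<longlonglongrightarrow> u x"
    using Lp_tendsto_AE[of p "\<lambda>k x. u (dil a (l k) x)" u] p by auto
  show ?thesis
    by (rule that[of "\<lambda>k. l (s k)"]) (use l1 s LIMSEQ_subseq_LIMSEQ[OF l s(1)] in \<open>auto simp: o_def\<close>)
qed

text \<open>This replaces \<open>\<integral> f (x - a) \<bullet> \<nabla>u = -(N/r) \<integral> \<bar>u\<bar>\<^sup>r\<close> for \<open>f = \<bar>u\<bar>\<^sup>r\<^sup>-\<^sup>2 u\<close>: by convexity
  the integral of \<open>f (u\<^sub>l - u)\<close> differs from the explicit increment of \<open>\<integral> \<bar>u\<bar>\<^sup>r / r\<close> by at most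
  \<open>\<integral> (f\<^sub>l - f) (u\<^sub>l - u)\<close>, which is \<open>o(l - 1)\<close>.\<close>
lemma dil_power_limit:
  fixes u :: "'a::euclidean_space \<Rightarrow> real"
  assumes p: "1 < p" and r: "1 < r" and iu: "in_Lp p u" "in_Lp r u" and ih: "in_Lp (p/(p-1)) (\<lambda>x. \<bar>u x\<bar> powr (r-2) * u x)"
    and ls: "\<And>k. 1 < ls k" "ls \<longlonglongrightarrow> 1" "AE x in lebesgue. (\<lambda>k. u (dil a (ls k) x)) \<longlonglongrightarrow> u x"
    and M: "\<And>k. (\<integral>x. norm (u (dil a (ls k) x) - u x) powr p \<partial>lebesgue) \<le> M * (ls k - 1) powr p" "0 \<le> M"
  shows "(\<lambda>k. (\<integral>x. \<bar>u x\<bar> powr (r-2) * u x * (u (dil a (ls k) x) - u x) \<partial>lebesgue) / (ls k - 1))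
    \<longlonglongrightarrow> - real DIM('a) / r * (\<integral>x. \<bar>u x\<bar> powr r \<partial>lebesgue)"
proof -
  define h where "h x = \<bar>u x\<bar> powr (r-2) * u x" for x
  define uk where "uk k x = u (dil a (ls k) x)" for k x
  define hk where "hk k x = h (dil a (ls k) x)" for k x
  have hk: "hk k x = \<bar>uk k x\<bar> powr (r-2) * uk k x" for k x by (simp add: hk_def h_def uk_def)
  have ls0: "0 < ls k" for k using ls(1)[of k] by simp
  define p' where "p' = p/(p-1)"
  have p': "0 < p'" using p by (simp add: p'_def)
  have ih: "in_Lp p' h" using ih by (simp add: p'_def h_def[abs_def])
  have ihk: "in_Lp p' (hk k)" for k unfolding hk_def by (rule in_Lp_dil(1)[OF ih ls0])
  have iuk: "in_Lp p (uk k)" "in_Lp r (uk k)" for k unfolding uk_def using in_Lp_dil(1)[OF _ ls0] iu by blast+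
  define X where "X = (\<integral>x. \<bar>u x\<bar> powr r \<partial>lebesgue)"
  define U where "U k = (ls k powr (- real DIM('a)) * X - X) / r" for k
  define Z where "Z k = (\<integral>x. h x * (uk k x - u x) \<partial>lebesgue)" for k
  define E where "E k = (\<integral>x. (hk k x - h x) * (uk k x - u x) \<partial>lebesgue)" for k
  have XK: "(\<integral>x. \<bar>uk k x\<bar> powr r \<partial>lebesgue) = ls k powr (- real DIM('a)) * X" for k
    using in_Lp_dil(2)[OF iu(2) ls0[of k], of a] by (simp add: uk_def X_def)
  have ir: "integrable lebesgue (\<lambda>x. \<bar>u x\<bar> powr r)" "integrable lebesgue (\<lambda>x. \<bar>uk k x\<bar> powr r)" for k
    using iu(2) iuk(2) by (auto simp: in_Lp_def)
  have iUu: "in_Lp p (\<lambda>x. uk k x - u x)" for k using in_Lp_diff[OF iuk(1) iu(1)] p by simp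
  have iZ: "integrable lebesgue (\<lambda>x. h x * (uk k x - u x))" for k
    using in_Lp_mult_integrable(1)[OF p iUu, of h] ih by (simp add: p'_def mult.commute)
  have iHh: "in_Lp p' (\<lambda>x. hk k x - h x)" for k using in_Lp_diff[OF ihk ih] p' by simp
  have iE: "integrable lebesgue (\<lambda>x. (hk k x - h x) * (uk k x - u x))" for k
    using in_Lp_mult_integrable(1)[OF p iUu, of "\<lambda>x. hk k x - h x"] iHh by (simp add: p'_def mult.commute)
  have conv: "\<bar>s\<bar> powr (r-2) * s * (t - s) \<le> (\<bar>t\<bar> powr r - \<bar>s\<bar> powr r) / r" for s t :: real
    using norm_powr_convex[OF r, of s t] by (simp add: mult.assoc)
  have Uint: "(\<integral>x. (\<bar>uk k x\<bar> powr r - \<bar>u x\<bar> powr r) / r \<partial>lebesgue) = U k" for k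
    using ir XK by (simp add: U_def X_def)
  have up: "Z k \<le> U k" for k
    unfolding Z_def Uint[symmetric]
    by (rule integral_mono[OF iZ]) (use ir conv in \<open>auto simp: h_def\<close>)
  \<comment> \<open>The tangent is now taken at the dilated function instead of at \<open>u\<close>;
    replacing \<open>hk\<close> by \<open>h\<close> afterwards costs \<open>E\<close>.\<close>
  have low: "U k - E k \<le> Z k" for k
  proof -
    have "U k \<le> (\<integral>x. h x * (uk k x - u x) + (hk k x - h x) * (uk k x - u x) \<partial>lebesgue)"
      unfolding Uint[symmetric]
    proof (rule integral_mono)
      show "integrable lebesgue (\<lambda>x. (\<bar>uk k x\<bar> powr r - \<bar>u x\<bar> powr r) / r)" using ir by auto
      show "integrable lebesgue (\<lambda>x. h x * (uk k x - u x) + (hk k x - h x) * (uk k x - u x))" using iZ iE by auto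
      fix x
      have "hk k x * (u x - uk k x) \<le> (\<bar>u x\<bar> powr r - \<bar>uk k x\<bar> powr r) / r"
        using conv[of "uk k x" "u x"] by (simp add: hk)
      then show "(\<bar>uk k x\<bar> powr r - \<bar>u x\<bar> powr r) / r \<le> h x * (uk k x - u x) + (hk k x - h x) * (uk k x - u x)"
        by (simp add: algebra_simps diff_divide_distrib)
    qed
    then show ?thesis using iZ iE by (simp add: Z_def E_def)
  qed
  \<comment> \<open>\<open>E\<close> pairs two small factors: u_l - u is O(l-1) in L^p, and h_l - h
    is o(1) in the dual space, where h_l converges almost everywhere and its norm converges by
    scaling. Hence \<open>E\<close> is o(l-1).\<close>
  define \<epsilon> where "\<epsilon> k = (\<integral>x. norm (hk k x - h x) powr p' \<partial>lebesgue) powr (1-1/p)" for k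
  have "Lp_tendsto p' hk h"
  proof (rule Lp_tendsto_Riesz[OF p' ihk ih])
    show "AE x in lebesgue. (\<lambda>k. hk k x) \<longlonglongrightarrow> h x"
      using ls(3)
    proof eventually_elim
      case (elim x)
      have "isCont (\<lambda>t::real. norm t powr (r-2) *\<^sub>R t) (u x)"
        using continuous_on_norm_powr_scaleR[OF r] by (metis UNIV_I continuous_on_eq_continuous_at open_UNIV)
      from isCont_tendsto_compose[OF this elim]
      show ?case by (simp add: hk uk_def h_def)
    qed
    have "(\<lambda>k. ls k powr (- real DIM('a)) * (\<integral>x. norm (h x) powr p' \<partial>lebesgue)) \<longlonglongrightarrow> 1 powr (- real DIM('a)) * (\<integral>x. norm (h x) powr p' \<partial>lebesgue)"
      using ls by (intro tendsto_intros) auto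
    then show "(\<lambda>k. \<integral>x. norm (hk k x) powr p' \<partial>lebesgue) \<longlonglongrightarrow> (\<integral>x. norm (h x) powr p' \<partial>lebesgue)"
      unfolding hk_def in_Lp_dil(2)[OF ih ls0] by simp
  qed
  then have "(\<lambda>k. (\<integral>x. norm (hk k x - h x) powr p' \<partial>lebesgue) powr (1-1/p)) \<longlonglongrightarrow> 0 powr (1-1/p)"
    using p by (intro tendsto_powr') (auto simp: Lp_tendsto_def)
  then have \<epsilon>: "\<epsilon> \<longlonglongrightarrow> 0" by (simp add: \<epsilon>_def[abs_def])
  have Eb: "\<bar>E k\<bar> \<le> M powr (1/p) * \<epsilon> k * (ls k - 1)" for k
  proof -
    have "\<bar>E k\<bar> \<le> (\<integral>x. norm (uk k x - u x) powr p \<partial>lebesgue) powr (1/p) * \<epsilon> k"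
      unfolding E_def \<epsilon>_def using in_Lp_mult_integrable(2)[OF p iUu, of "\<lambda>x. hk k x - h x" k] iHh
      by (simp add: p'_def mult.commute)
    also have "\<dots> \<le> (M * (ls k - 1) powr p) powr (1/p) * \<epsilon> k"
      using M(1)[of k] p by (intro mult_right_mono powr_mono2) (auto simp: uk_def \<epsilon>_def)
    also have "\<dots> = M powr (1/p) * \<epsilon> k * (ls k - 1)"
      using M(2) ls(1)[of k] p by (simp add: powr_mult powr_powr)
    finally show ?thesis .
  qed
  have "norm (Z k / (ls k - 1) - U k / (ls k - 1)) \<le> M powr (1/p) * \<epsilon> k" for k
  proof -
    have "\<bar>Z k - U k\<bar> \<le> M powr (1/p) * \<epsilon> k * (ls k - 1)" using up[of k] low[of k] Eb[of k] by linarith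
    then have "\<bar>Z k - U k\<bar> / (ls k - 1) \<le> M powr (1/p) * \<epsilon> k" using ls(1)[of k] by (simp add: divide_le_eq)
    then show ?thesis using ls(1)[of k] by (simp add: diff_divide_distrib[symmetric] abs_divide)
  qed
  moreover have "(\<lambda>k. M powr (1/p) * \<epsilon> k) \<longlonglongrightarrow> 0" using \<epsilon> by (intro tendsto_mult_right_zero)
  ultimately have ZU: "(\<lambda>k. Z k / (ls k - 1) - U k / (ls k - 1)) \<longlonglongrightarrow> 0"
    by (rule Lim_null_comparison[OF always_eventually[OF allI]])
  have "U k / (ls k - 1) = (ls k powr (- real DIM('a)) - 1) / (ls k - 1) * X / r" for k
    by (simp add: U_def algebra_simps diff_divide_distrib)
  moreover have "(\<lambda>k. (ls k powr (- real DIM('a)) - 1) / (ls k - 1) * X / r) \<longlonglongrightarrow> - real DIM('a) * X / r"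
    using r by (intro tendsto_intros powr_diff_quotient ls) auto
  ultimately have "(\<lambda>k. U k / (ls k - 1)) \<longlonglongrightarrow> - real DIM('a) * X / r" by simp
  from tendsto_add[OF ZU this] have "(\<lambda>k. Z k / (ls k - 1)) \<longlonglongrightarrow> - real DIM('a) * X / r" by simp
  then show ?thesis by (simp add: Z_def h_def uk_def X_def)
qed

section \<open>Integrability of solutions\<close>

lemma dual_integrable:
  fixes f h :: "'a::euclidean_space \<Rightarrow> 'b::euclidean_space"
  assumes r: "1 < r" and f: "in_Lp r f" and h: "in_Lp r h"
  shows "integrable lebesgue (\<lambda>x. norm (f x) powr (r-2) * (f x \<bullet> h x))"
proof -
  have [measurable]: "f \<in> borel_measurable lebesgue" "h \<in> borel_measurable lebesgue" using f h by (auto simp: in_Lp_def)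
  have "(norm (norm (f x) powr (r-1))) powr (r/(r-1)) = norm (f x) powr r" for x
    using r by (simp add: powr_powr)
  then have "integrable lebesgue (\<lambda>x. norm (h x) * norm (norm (f x) powr (r-1)))"
    using f h by (intro Holder_norm(1)[OF r]) (auto simp: in_Lp_def)
  then show ?thesis
  proof (rule Bochner_Integration.integrable_bound)
    show "AE x in lebesgue. norm (norm (f x) powr (r-2) * (f x \<bullet> h x)) \<le> norm (norm (h x) * norm (norm (f x) powr (r-1)))"
    proof (rule AE_I2)
      fix x
      have "norm (f x) powr (r-2) * \<bar>f x \<bullet> h x\<bar> \<le> norm (f x) powr (r-2) * (norm (f x) * norm (h x))"
        by (intro mult_left_mono Cauchy_Schwarz_ineq2) auto
      also have "\<dots> = norm (f x) powr (r-1) * norm (h x)"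
        using norm_powr_minus_2(1)[OF r, of "f x"] by (simp add: mult.assoc[symmetric])
      finally show "norm (norm (f x) powr (r-2) * (f x \<bullet> h x)) \<le> norm (norm (h x) * norm (norm (f x) powr (r-1)))"
        by (simp add: abs_mult mult.commute)
    qed
  qed measurable
qed

text \<open>A bounded stand-in for 1 + t^2: for 0 < \<epsilon> \<le> 1 it lies between 1 and
  1/\<epsilon>, and it tends to 1 + t^2 as \<epsilon> tends to 0. A truncation by minimum would
  leave the smooth test functions; a rational function without poles does not.\<close>

definition cutoff_weight :: "real \<Rightarrow> real \<Rightarrow> real" where
  "cutoff_weight \<epsilon> t = (1 + t\<^sup>2) / (1 + \<epsilon> * t\<^sup>2)"

definition cutoff_weight' :: "real \<Rightarrow> real \<Rightarrow> real" where
  "cutoff_weight' \<epsilon> t = 2 * t * (1 - \<epsilon>) / (1 + \<epsilon> * t\<^sup>2)\<^sup>2"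

context
  fixes \<epsilon> :: real
  assumes \<epsilon>: "0 < \<epsilon>" "\<epsilon> \<le> 1"
begin

lemma cutoff_denom_pos: "0 < 1 + \<epsilon> * t\<^sup>2"
  using \<epsilon> by (simp add: add_pos_nonneg)

lemma cutoff_weight_bounds: "1 \<le> cutoff_weight \<epsilon> t" "cutoff_weight \<epsilon> t \<le> 1 / \<epsilon>" "cutoff_weight \<epsilon> t \<le> 1 + t\<^sup>2"
proof -
  have "\<epsilon> * t\<^sup>2 \<le> 1 * t\<^sup>2" using \<epsilon> by (intro mult_right_mono) auto
  then show "1 \<le> cutoff_weight \<epsilon> t" using cutoff_denom_pos[of t] by (simp add: cutoff_weight_def le_divide_eq)
  show "cutoff_weight \<epsilon> t \<le> 1 / \<epsilon>" using cutoff_denom_pos[of t] \<epsilon> by (simp add: cutoff_weight_def divide_simps algebra_simps)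
  have "(1 + t\<^sup>2) / (1 + \<epsilon> * t\<^sup>2) \<le> (1 + t\<^sup>2) / 1" using \<epsilon> cutoff_denom_pos[of t] by (intro divide_left_mono) auto
  then show "cutoff_weight \<epsilon> t \<le> 1 + t\<^sup>2" by (simp add: cutoff_weight_def)
qed

lemma cutoff_weight_pos: "0 < cutoff_weight \<epsilon> t" using cutoff_weight_bounds(1)[of t] by linarith

lemma cutoff_weight_deriv: "(cutoff_weight \<epsilon> has_real_derivative cutoff_weight' \<epsilon> t) (at t)"
  unfolding cutoff_weight_def[abs_def] cutoff_weight'_def using cutoff_denom_pos[of t]
  by (auto intro!: derivative_eq_intros simp: power2_eq_square field_simps)

text \<open>A bound on the logarithmic derivative, uniform in \<epsilon>: the weight increases with
  |t| and does so no faster than quadratically. It controls the derivatives of all functions t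
  w(t)^b.\<close>

lemma cutoff_weight'_bounds: "0 \<le> t * cutoff_weight' \<epsilon> t" "t * cutoff_weight' \<epsilon> t \<le> 2 * cutoff_weight \<epsilon> t"
proof -
  show "0 \<le> t * cutoff_weight' \<epsilon> t" using \<epsilon> by (simp add: cutoff_weight'_def power2_eq_square[symmetric] mult.assoc[symmetric])
  let ?d = "1 + \<epsilon> * t\<^sup>2"
  have d: "1 \<le> ?d" using \<epsilon> by simp
  have "t * cutoff_weight' \<epsilon> t = 2 * (t\<^sup>2 * (1 - \<epsilon>)) / ?d\<^sup>2" by (simp add: cutoff_weight'_def power2_eq_square)
  also have "\<dots> \<le> 2 * (1 + t\<^sup>2) / ?d\<^sup>2"
  proof (intro divide_right_mono mult_left_mono)
    have "t\<^sup>2 * (1 - \<epsilon>) \<le> t\<^sup>2 * 1" using \<epsilon> by (intro mult_left_mono) auto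
    then show "t\<^sup>2 * (1 - \<epsilon>) \<le> 1 + t\<^sup>2" by simp
  qed auto
  also have "\<dots> \<le> 2 * (1 + t\<^sup>2) / ?d"
    using d by (intro divide_left_mono) (auto simp: power2_eq_square mult_le_cancel_right1)
  finally show "t * cutoff_weight' \<epsilon> t \<le> 2 * cutoff_weight \<epsilon> t" by (simp add: cutoff_weight_def)
qed

lemma continuous_cutoff: "continuous_on UNIV (cutoff_weight \<epsilon>)" "continuous_on UNIV (cutoff_weight' \<epsilon>)"
  unfolding cutoff_weight_def[abs_def] cutoff_weight'_def[abs_def]
  using cutoff_denom_pos by (auto intro!: continuous_intros) (metis less_irrefl)+

lemma power_cutoff_deriv:
  "((\<lambda>t. t * cutoff_weight \<epsilon> t ^ m) has_real_derivative
     cutoff_weight \<epsilon> t ^ m + real m * cutoff_weight \<epsilon> t ^ (m - 1) * (t * cutoff_weight' \<epsilon> t)) (at t)"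
  by (auto intro!: derivative_eq_intros cutoff_weight_deriv)

text \<open>The lower bound retains the weighted gradient energy in the equation. The upper bound
  degenerates as \<epsilon> tends to 0, but it serves only to make u w(u)^m an admissible test
  function.\<close>

lemma power_cutoff_deriv_bounds:
  "cutoff_weight \<epsilon> t ^ m \<le> cutoff_weight \<epsilon> t ^ m + real m * cutoff_weight \<epsilon> t ^ (m - 1) * (t * cutoff_weight' \<epsilon> t)"
  "\<bar>cutoff_weight \<epsilon> t ^ m + real m * cutoff_weight \<epsilon> t ^ (m - 1) * (t * cutoff_weight' \<epsilon> t)\<bar> \<le> (1 + 2 * real m) * (1/\<epsilon>) ^ m"
proof -
  let ?w = "cutoff_weight \<epsilon> t"
  have w: "0 < ?w" by (rule cutoff_weight_pos)
  show 1: "?w ^ m \<le> ?w ^ m + real m * ?w ^ (m - 1) * (t * cutoff_weight' \<epsilon> t)"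
    using w cutoff_weight'_bounds(1)[of t] by simp
  have "real m * ?w ^ (m - 1) * (t * cutoff_weight' \<epsilon> t) \<le> real m * ?w ^ (m - 1) * (2 * ?w)"
    using w cutoff_weight'_bounds(2)[of t] by (intro mult_left_mono) auto
  also have "\<dots> = 2 * real m * ?w ^ m" by (cases m) auto
  finally have "?w ^ m + real m * ?w ^ (m - 1) * (t * cutoff_weight' \<epsilon> t) \<le> (1 + 2 * real m) * ?w ^ m" by (simp add: algebra_simps)
  also have "\<dots> \<le> (1 + 2 * real m) * (1/\<epsilon>) ^ m" using w cutoff_weight_bounds(2) by (intro mult_left_mono power_mono) auto
  finally show "\<bar>?w ^ m + real m * ?w ^ (m - 1) * (t * cutoff_weight' \<epsilon> t)\<bar> \<le> (1 + 2 * real m) * (1/\<epsilon>) ^ m"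
    using 1 w by (smt (verit) zero_less_power)
qed

lemma powr_cutoff_deriv:
  "((\<lambda>t. t * cutoff_weight \<epsilon> t powr b) has_real_derivative
     cutoff_weight \<epsilon> t powr b + b * cutoff_weight \<epsilon> t powr (b - 1) * (t * cutoff_weight' \<epsilon> t)) (at t)"
  using cutoff_weight_pos[of t]
  by (auto intro!: derivative_eq_intros cutoff_weight_deriv)

text \<open>Here the constant 1 + 2b must be free of \<epsilon>, because it enters the final
  estimate.\<close>

lemma powr_cutoff_deriv_bounds:
  assumes b: "0 \<le> b"
  shows "\<bar>cutoff_weight \<epsilon> t powr b + b * cutoff_weight \<epsilon> t powr (b - 1) * (t * cutoff_weight' \<epsilon> t)\<bar> \<le> (1 + 2 * b) * cutoff_weight \<epsilon> t powr b"
proof -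
  let ?w = "cutoff_weight \<epsilon> t"
  have w: "0 < ?w" by (rule cutoff_weight_pos)
  have "b * ?w powr (b - 1) * (t * cutoff_weight' \<epsilon> t) \<le> b * ?w powr (b - 1) * (2 * ?w)"
    using b cutoff_weight'_bounds(2)[of t] by (intro mult_left_mono) auto
  also have "\<dots> = 2 * b * ?w powr b" using w by (simp add: powr_diff)
  finally have "b * ?w powr (b - 1) * (t * cutoff_weight' \<epsilon> t) \<le> 2 * b * ?w powr b" .
  moreover have "0 \<le> b * ?w powr (b - 1) * (t * cutoff_weight' \<epsilon> t)"
    using b cutoff_weight'_bounds(1)[of t] by simp
  ultimately show ?thesis by (simp add: algebra_simps)
qed

lemma Cinf_power_cutoff: "Cinf \<phi> \<Longrightarrow> Cinf (\<lambda>x. \<phi> x * cutoff_weight \<epsilon> (\<phi> x) ^ m)" for \<phi> :: "'a::euclidean_space \<Rightarrow> real"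
proof -
  assume \<phi>: "Cinf \<phi>"
  have nz: "1 + \<epsilon> * (\<phi> x * \<phi> x) \<noteq> 0" for x using cutoff_denom_pos[of "\<phi> x"] by (simp add: power2_eq_square)
  have "(\<lambda>x. \<phi> x * ((1 + \<phi> x * \<phi> x) * inverse (1 + \<epsilon> * (\<phi> x * \<phi> x))) ^ m) \<in> Cinf_algebra"
    by (intro Cinf_algebra.mult Cinf_algebra.add Cinf_algebra.const Cinf_algebra_power Cinf_algebra.inverse Cinf_algebra.Cinf \<phi> nz)
  then have "Cinf (\<lambda>x. \<phi> x * ((1 + \<phi> x * \<phi> x) * inverse (1 + \<epsilon> * (\<phi> x * \<phi> x))) ^ m)" by (rule Cinf_algebra_Cinf)
  then show ?thesis by (simp add: cutoff_weight_def power2_eq_square divide_inverse)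
qed

end

text \<open>A weak solution after extension by zero. No bound on \<mu> is imposed: higher
  integrability, the energy identity and the Pohozaev inequality hold for every \<mu>.\<close>

locale pq_solution =
  fixes \<Omega> :: "'a::euclidean_space set" and p q \<mu> P :: real and u :: "'a \<Rightarrow> real" and G :: "'a \<Rightarrow> 'a"
  assumes N: "DIM('a) \<ge> 2" and q: "1 < q" "q < p" and p: "p < real DIM('a)"
    and \<Omega>: "open \<Omega>" "bounded \<Omega>" and P: "P = pstar (real DIM('a)) p"
    and W: "sobolev0 \<Omega> p u G"
    and weak: "sobolev0 \<Omega> p v H \<Longrightarrow>
      (\<integral>x. norm (G x) powr (p - 2) * (G x \<bullet> H x) + norm (G x) powr (q - 2) * (G x \<bullet> H x)
          - \<mu> * (\<bar>u x\<bar> powr (q - 2) * u x * v x) - \<bar>u x\<bar> powr (P - 2) * u x * v x \<partial>lebesgue) = 0"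
begin

lemma p1: "1 < p" using q by simp

lemma P_gt: "p < P" "1 < P" "q < P"
proof -
  have "p * real DIM('a) > p * (real DIM('a) - p)" using p1 by (simp add: right_diff_distrib)
  then show "p < P" using p by (simp add: P pstar_def less_divide_eq mult.commute)
  then show "1 < P" "q < P" using p1 q by auto
qed

lemma sobolev0_L_crit: "sobolev0 \<Omega> p v H \<Longrightarrow> in_Lp P v"
proof -
  assume V: "sobolev0 \<Omega> p v H"
  have p0: "0 < p" using p1 by simp
  obtain \<phi>s gs where A: "\<And>k. C1c \<Omega> (\<phi>s k) (gs k)" "Lp_tendsto p \<phi>s v" "Lp_tendsto p gs H"
    by (rule sobolev0_approx[OF V p0], rule that)
  then show "in_Lp P v" using sobolev_limit[OF N \<Omega>(2) p1 p] unfolding P by blast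
qed

lemma sobolev0_q: "sobolev0 \<Omega> p v H \<Longrightarrow> sobolev0 \<Omega> q v H"
  using sobolev0_mono[OF _ \<Omega>(2,1)] q by auto

text \<open>The weak formulation speaks of the integral of one sum; only this justifies treating its
  four terms separately. For the critical term both \<open>u\<close> and the test function must lie
  in L^P, which is Sobolev's inequality.\<close>

lemma term_integrable:
  assumes V: "sobolev0 \<Omega> p v H"
  shows "integrable lebesgue (\<lambda>x. norm (G x) powr (p - 2) * (G x \<bullet> H x))"
    and "integrable lebesgue (\<lambda>x. norm (G x) powr (q - 2) * (G x \<bullet> H x))"
    and "integrable lebesgue (\<lambda>x. \<bar>u x\<bar> powr (q - 2) * u x * v x)"
    and "integrable lebesgue (\<lambda>x. \<bar>u x\<bar> powr (P - 2) * u x * v x)"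
  using dual_integrable[OF p1 sobolev0_in_Lp(2)[OF W] sobolev0_in_Lp(2)[OF V]]
    dual_integrable[OF q(1) sobolev0_in_Lp(2)[OF sobolev0_q[OF W]] sobolev0_in_Lp(2)[OF sobolev0_q[OF V]]]
    dual_integrable[OF q(1) sobolev0_in_Lp(1)[OF sobolev0_q[OF W]] sobolev0_in_Lp(1)[OF sobolev0_q[OF V]]]
    dual_integrable[OF P_gt(2) sobolev0_L_crit[OF W] sobolev0_L_crit[OF V]]
  by (simp_all add: mult.assoc)

lemma weak_split:
  assumes V: "sobolev0 \<Omega> p v H"
  shows "(\<integral>x. norm (G x) powr (p - 2) * (G x \<bullet> H x) \<partial>lebesgue) + (\<integral>x. norm (G x) powr (q - 2) * (G x \<bullet> H x) \<partial>lebesgue)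
     = \<mu> * (\<integral>x. \<bar>u x\<bar> powr (q - 2) * u x * v x \<partial>lebesgue) + (\<integral>x. \<bar>u x\<bar> powr (P - 2) * u x * v x \<partial>lebesgue)"
  using weak[OF V] term_integrable[OF V] by simp

text \<open>The Brezis--Kato step: since \<open>u\<close> is in \<open>L\<^sup>P\<close>, the contribution of \<open>\<bar>u\<bar> > K\<close> to the critical term
  can be absorbed by the Sobolev inequality, uniformly in the truncation parameter \<open>\<epsilon>\<close>.\<close>
lemma brezis_kato_uniform:
  fixes m :: nat
  shows "\<exists>D\<ge>0. \<forall>\<epsilon>. 0 < \<epsilon> \<and> \<epsilon> \<le> 1 \<longrightarrow>
    in_Lp P (\<lambda>x. u x * cutoff_weight \<epsilon> (u x) powr (real m / p)) \<and>
    (\<integral>x. norm (u x * cutoff_weight \<epsilon> (u x) powr (real m / p)) powr P \<partial>lebesgue) \<le> D"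
proof -
  have p0: "0 < p" and pP: "0 < p/P" "p/P < 1" "0 < 1 - p/P" "1 - p/P < 1" using p1 P_gt by auto
  \<comment> \<open>The exponents are matched by b p = m, so that |grad(u w^b)|^p is comparable to
    w^m |grad u|^p, the density produced by the test function u w^m.\<close>
  define b where "b = real m / p"
  have b0: "0 \<le> b" and bp: "b * p = real m" using p0 by (auto simp: b_def)
  obtain C where C: "C \<ge> 0" "\<And>\<phi>s gs v H. (\<And>k. C1c \<Omega> (\<phi>s k) (gs k)) \<Longrightarrow> Lp_tendsto p \<phi>s v \<Longrightarrow> Lp_tendsto p gs H \<Longrightarrow>
    in_Lp P v \<and> (\<integral>x. norm (v x) powr P \<partial>lebesgue) \<le> C * (\<integral>x. norm (H x) powr p \<partial>lebesgue) powr (P/p)"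
    using sobolev_limit[OF N \<Omega>(2) p1 p] unfolding P by blast
  have uP: "in_Lp P u" by (rule sobolev0_L_crit[OF W])
  have um[measurable]: "u \<in> borel_measurable lebesgue" "G \<in> borel_measurable lebesgue"
    using sobolev0_in_Lp[OF W] by (auto simp: in_Lp_def)
  have out: "x \<notin> \<Omega> \<Longrightarrow> u x = 0" for x using W by (auto simp: sobolev0_def)
  \<comment> \<open>The Sobolev constant in the normalization X^{p/P} \<le> C^{p/P} Y, times the
    constant from differentiating t w(t)^b; neither depends on \<epsilon>.\<close>
  define S where "S = C powr (p/P) * (1 + 2 * b) powr p"
  have S0: "0 \<le> S" by (simp add: S_def)
  define tail where "tail K = (\<integral>x. indicator {x. K < \<bar>u x\<bar>} x * \<bar>u x\<bar> powr P \<partial>lebesgue)" for K :: real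
  have itail: "integrable lebesgue (\<lambda>x. indicator {x. K < \<bar>u x\<bar>} x * \<bar>u x\<bar> powr P)" for K
  proof (rule Bochner_Integration.integrable_bound)
    show "integrable lebesgue (\<lambda>x. \<bar>u x\<bar> powr P)" using uP by (simp add: in_Lp_def)
  qed (auto simp: indicator_def)
  have "(\<lambda>k. tail (real k)) \<longlonglongrightarrow> (\<integral>x. 0 \<partial>(lebesgue :: 'a measure))"
    unfolding tail_def
  proof (rule integral_dominated_convergence)
    show "integrable lebesgue (\<lambda>x. \<bar>u x\<bar> powr P)" using uP by (simp add: in_Lp_def)
    show "AE x in lebesgue. (\<lambda>k. indicator {x. real k < \<bar>u x\<bar>} x * \<bar>u x\<bar> powr P) \<longlonglongrightarrow> 0"
    proof (rule AE_I2)
      fix x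
      obtain n where n: "\<bar>u x\<bar> \<le> real n" using real_arch_simple by blast
      have "eventually (\<lambda>k. indicator {x. real k < \<bar>u x\<bar>} x * \<bar>u x\<bar> powr P = 0) sequentially"
        unfolding eventually_sequentially using n by (intro exI[of _ n]) (auto simp: indicator_def)
      then show "(\<lambda>k. indicator {x. real k < \<bar>u x\<bar>} x * \<bar>u x\<bar> powr P) \<longlonglongrightarrow> 0"
        by (rule tendsto_eventually)
    qed
  qed (auto simp: indicator_def)
  then have "(\<lambda>k. S * (\<bar>\<mu>\<bar> + 1) * tail (real k) powr (1 - p/P)) \<longlonglongrightarrow> S * (\<bar>\<mu>\<bar> + 1) * 0 powr (1 - p/P)"
    using pP by (intro tendsto_mult tendsto_const tendsto_powr') (auto simp: tail_def intro!: always_eventually)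
  then have "eventually (\<lambda>k. S * (\<bar>\<mu>\<bar> + 1) * tail (real k) powr (1 - p/P) < 1/2) sequentially"
    by (intro order_tendstoD(2)[where y="S * (\<bar>\<mu>\<bar> + 1) * 0 powr (1 - p/P)"]) auto
  then have "eventually (\<lambda>k. S * (\<bar>\<mu>\<bar> + 1) * tail (real k) powr (1 - p/P) < 1/2 \<and> k \<ge> 1) sequentially"
    using eventually_ge_at_top[of 1] by eventually_elim auto
  then obtain k where k: "S * (\<bar>\<mu>\<bar> + 1) * tail (real k) powr (1 - p/P) < 1/2" "k \<ge> 1"
    using eventually_happens'[OF sequentially_bot] by blast
  \<comment> \<open>The level depends on \<open>u\<close> and m but not on \<epsilon>. Taking K
    \<ge> 1 lets |u|^q be dominated by |u|^P above the level and by K^P below it, where moreover w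
    \<le> 1 + K^2; this gives \<open>D1\<close>.\<close>
  define K where "K = real k"
  have K: "S * (\<bar>\<mu>\<bar> + 1) * tail K powr (1 - p/P) < 1/2" "K \<ge> 1" using k by (auto simp: K_def)
  define D1 where "D1 = (\<bar>\<mu>\<bar> + 1) * K powr P * (1 + K\<^sup>2) ^ m * measure lebesgue \<Omega>"
  have D10: "0 \<le> D1" by (simp add: D1_def)
  define D where "D = (2 * S * D1) powr (P/p)"
  have main: "in_Lp P (\<lambda>x. u x * cutoff_weight \<epsilon> (u x) powr b) \<and>
    (\<integral>x. norm (u x * cutoff_weight \<epsilon> (u x) powr b) powr P \<partial>lebesgue) \<le> D" if \<epsilon>: "0 < \<epsilon>" "\<epsilon> \<le> 1" for \<epsilon>
  proof -
    let ?w = "cutoff_weight \<epsilon>" and ?w' = "cutoff_weight' \<epsilon>"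
    define g' where "g' t = ?w t ^ m + real m * ?w t ^ (m - 1) * (t * ?w' t)" for t
    define \<Psi>' where "\<Psi>' t = ?w t powr b + b * ?w t powr (b - 1) * (t * ?w' t)" for t
    define \<Psi> where "\<Psi> t = t * ?w t powr b" for t
    note w = cutoff_weight_bounds[OF \<epsilon>] and w0 = cutoff_weight_pos[OF \<epsilon>]
    note cw = continuous_cutoff[OF \<epsilon>]
    have wnz: "?w t \<noteq> 0" for t using w0[of t] by simp
    have cg': "continuous_on UNIV g'" unfolding g'_def by (intro continuous_intros cw)
    have c\<Psi>': "continuous_on UNIV \<Psi>'" unfolding \<Psi>'_def using wnz by (intro continuous_intros cw) auto
    have dg: "((\<lambda>t. t * ?w t ^ m) has_real_derivative g' t) (at t)" for t
      unfolding g'_def by (rule power_cutoff_deriv[OF \<epsilon>])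
    have d\<Psi>: "(\<Psi> has_real_derivative \<Psi>' t) (at t)" for t
      unfolding \<Psi>'_def \<Psi>_def[abs_def] by (rule powr_cutoff_deriv[OF \<epsilon>])
    have g'b: "\<bar>g' t\<bar> \<le> (1 + 2 * real m) * (1/\<epsilon>) ^ m" for t
      unfolding g'_def by (rule power_cutoff_deriv_bounds(2)[OF \<epsilon>])
    have g'l: "?w t ^ m \<le> g' t" for t unfolding g'_def by (rule power_cutoff_deriv_bounds(1)[OF \<epsilon>])
    have g'0: "0 \<le> g' t" for t using g'l[of t] w0[of t] by (smt (verit) zero_less_power)
    have \<Psi>'b: "\<bar>\<Psi>' t\<bar> \<le> (1 + 2 * b) * ?w t powr b" for t
      unfolding \<Psi>'_def by (rule powr_cutoff_deriv_bounds[OF \<epsilon> b0])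
    have \<Psi>'b2: "\<bar>\<Psi>' t\<bar> \<le> (1 + 2 * b) * (1/\<epsilon>) powr b" for t
    proof -
      have "?w t powr b \<le> (1/\<epsilon>) powr b" using w(2)[of t] w0[of t] b0 by (intro powr_mono2) auto
      then show ?thesis using \<Psi>'b[of t] b0 by (smt (verit) mult_left_mono)
    qed
    have wp: "(?w t powr b) powr p = ?w t ^ m" for t
      using w0[of t] bp by (simp add: powr_powr powr_realpow)
    have V: "sobolev0 \<Omega> p (\<lambda>x. u x * ?w (u x) ^ m) (\<lambda>x. g' (u x) *\<^sub>R G x)"
      by (rule sobolev0_compose[OF W p0 dg cg' _ g'b]) (use Cinf_power_cutoff[OF \<epsilon>] in auto)
    obtain \<phi>s gs where A: "\<And>k. C1c \<Omega> (\<phi>s k) (gs k)" "Lp_tendsto p \<phi>s u" "Lp_tendsto p gs G"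
        "AE x in lebesgue. (\<lambda>k. \<phi>s k x) \<longlonglongrightarrow> u x"
      by (rule sobolev0_approx[OF W p0], rule that)
    have \<Psi>0: "\<Psi> 0 = 0" by (simp add: \<Psi>_def)
    \<comment> \<open>Sobolev's inequality is applied directly to the composed \<open>C1c\<close>
      approximations, so the real power of the weight need not be shown to be smooth.\<close>
    have sob: "in_Lp P (\<lambda>x. \<Psi> (u x)) \<and> (\<integral>x. norm (\<Psi> (u x)) powr P \<partial>lebesgue) \<le> C * (\<integral>x. norm (\<Psi>' (u x) *\<^sub>R G x) powr p \<partial>lebesgue) powr (P/p)"
      by (rule C(2)[OF C1c_compose[OF A(1) d\<Psi> c\<Psi>' \<Psi>0] Lp_tendsto_compose[OF A(2,3,4) p0 d\<Psi> c\<Psi>' \<Psi>0 \<Psi>'b2]])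
    have i\<Psi>G: "in_Lp p (\<lambda>x. \<Psi>' (u x) *\<^sub>R G x)"
      using Lp_tendsto_compose(2)[OF A(2,3,4) p0 d\<Psi> c\<Psi>' \<Psi>0 \<Psi>'b2] by (simp add: Lp_tendsto_def)
    define X where "X = (\<integral>x. norm (\<Psi> (u x)) powr P \<partial>lebesgue)"
    define Y where "Y = (\<integral>x. norm (\<Psi>' (u x) *\<^sub>R G x) powr p \<partial>lebesgue)"
    have XY0: "0 \<le> X" "0 \<le> Y" by (auto simp: X_def Y_def)
    have iX: "integrable lebesgue (\<lambda>x. norm (\<Psi> (u x)) powr P)" using sob by (simp add: in_Lp_def)
    have AY: "X powr (p/P) \<le> C powr (p/P) * Y"
    proof -
      have "X powr (p/P) \<le> (C * Y powr (P/p)) powr (p/P)"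
        using sob XY0 pP by (intro powr_mono2) (auto simp: X_def Y_def)
      also have "\<dots> = C powr (p/P) * Y" using C(1) XY0 p0 P_gt by (simp add: powr_mult powr_powr)
      finally show ?thesis .
    qed
    let ?T1 = "\<lambda>x. norm (G x) powr (p - 2) * (G x \<bullet> (g' (u x) *\<^sub>R G x))"
    let ?T2 = "\<lambda>x. norm (G x) powr (q - 2) * (G x \<bullet> (g' (u x) *\<^sub>R G x))"
    let ?T3 = "\<lambda>x. \<bar>u x\<bar> powr (q - 2) * u x * (u x * ?w (u x) ^ m)"
    let ?T4 = "\<lambda>x. \<bar>u x\<bar> powr (P - 2) * u x * (u x * ?w (u x) ^ m)"
    note iT = term_integrable[OF V]
    have T1: "?T1 x = g' (u x) * norm (G x) powr p" for x
      using norm_powr_minus_2(2)[OF p1, of "G x"] by simp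
    have T2: "0 \<le> ?T2 x" for x using g'0 by simp
    have T3: "?T3 x = \<bar>u x\<bar> powr q * ?w (u x) ^ m" for x
      using norm_powr_minus_2(2)[OF q(1), of "u x"] by (simp add: mult.assoc[symmetric])
    have T4: "?T4 x = \<bar>u x\<bar> powr P * ?w (u x) ^ m" for x
      using norm_powr_minus_2(2)[OF P_gt(2), of "u x"] by (simp add: mult.assoc[symmetric])
    have "Y \<le> (\<integral>x. (1 + 2 * b) powr p * ?T1 x \<partial>lebesgue)"
      unfolding Y_def
    proof (rule integral_mono)
      show "integrable lebesgue (\<lambda>x. norm (\<Psi>' (u x) *\<^sub>R G x) powr p)" using i\<Psi>G by (simp add: in_Lp_def)
      show "integrable lebesgue (\<lambda>x. (1 + 2 * b) powr p * ?T1 x)" using iT(1) by (rule integrable_mult_right)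
      fix x
      have "norm (\<Psi>' (u x) *\<^sub>R G x) powr p = \<bar>\<Psi>' (u x)\<bar> powr p * norm (G x) powr p" by (simp add: powr_mult)
      also have "\<dots> \<le> ((1 + 2 * b) * ?w (u x) powr b) powr p * norm (G x) powr p"
        using \<Psi>'b p0 by (intro mult_right_mono powr_mono2) auto
      also have "\<dots> = (1 + 2 * b) powr p * (?w (u x) ^ m * norm (G x) powr p)"
        using b0 by (simp add: powr_mult wp)
      also have "\<dots> \<le> (1 + 2 * b) powr p * ?T1 x"
        unfolding T1 using g'l by (intro mult_left_mono mult_right_mono) auto
      finally show "norm (\<Psi>' (u x) *\<^sub>R G x) powr p \<le> (1 + 2 * b) powr p * ?T1 x" .
    qed
    also have "\<dots> = (1 + 2 * b) powr p * (\<integral>x. ?T1 x \<partial>lebesgue)" by (rule integral_mult_right_zero)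
    also have "(\<integral>x. ?T1 x \<partial>lebesgue) \<le> \<mu> * (\<integral>x. ?T3 x \<partial>lebesgue) + (\<integral>x. ?T4 x \<partial>lebesgue)"
    proof -
      have "0 \<le> (\<integral>x. ?T2 x \<partial>lebesgue)" using T2 by (intro integral_nonneg_AE AE_I2)
      then show ?thesis using weak_split[OF V] by linarith
    qed
    also have "\<mu> * (\<integral>x. ?T3 x \<partial>lebesgue) + (\<integral>x. ?T4 x \<partial>lebesgue) = (\<integral>x. \<mu> * ?T3 x + ?T4 x \<partial>lebesgue)"
      using iT(3,4) by (subst Bochner_Integration.integral_add) auto
    also have "\<dots> \<le> D1 + (\<bar>\<mu>\<bar> + 1) * (tail K powr (1 - p/P) * X powr (p/P))"
    proof -
      \<comment> \<open>Above the level, |u|^P w^m factors as (|u|^P)^{1 - p/P} times (|u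
        w^b|^P)^{p/P}; Hoelder's inequality then splits off the small tail of |u|^P from
        X^{p/P}.\<close>
      let ?h = "\<lambda>x. (indicator {x. K < \<bar>u x\<bar>} x * \<bar>u x\<bar> powr P) powr (1 - p/P) * (norm (\<Psi> (u x)) powr P) powr (1 - (1 - p/P))"
      have H: "integrable lebesgue ?h" "(\<integral>x. ?h x \<partial>lebesgue) \<le> tail K powr (1 - p/P) * X powr (1 - (1 - p/P))"
        using Holder_powr[OF pP(3,4) itail[of K] _ iX] by (auto simp: tail_def X_def)
      have \<Omega>l: "\<Omega> \<in> lmeasurable" using \<Omega> by (simp add: bounded_set_imp_lmeasurable)
      have i\<Omega>: "integrable lebesgue (indicator \<Omega> :: 'a \<Rightarrow> real)" using \<Omega>l by (intro integrable_real_indicator) (auto simp: fmeasurable_def)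
      let ?c = "(\<bar>\<mu>\<bar> + 1) * K powr P * (1 + K\<^sup>2) ^ m"
      have "(\<integral>x. \<mu> * ?T3 x + ?T4 x \<partial>lebesgue) \<le> (\<integral>x. ?c * indicator \<Omega> x + (\<bar>\<mu>\<bar> + 1) * ?h x \<partial>lebesgue)"
      proof (rule integral_mono)
        show "integrable lebesgue (\<lambda>x. \<mu> * ?T3 x + ?T4 x)" using iT(3,4) by (intro Bochner_Integration.integrable_add integrable_mult_right)
        show "integrable lebesgue (\<lambda>x. ?c * indicator \<Omega> x + (\<bar>\<mu>\<bar> + 1) * ?h x)"
          using H(1) i\<Omega> by (intro Bochner_Integration.integrable_add integrable_mult_right)
        fix x
        have wm: "0 \<le> ?w (u x) ^ m" using w0[of "u x"] by simp
        have h0: "0 \<le> ?h x" by simp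
        have e1: "\<mu> * ?T3 x + ?T4 x \<le> (\<bar>\<mu>\<bar> * \<bar>u x\<bar> powr q + \<bar>u x\<bar> powr P) * ?w (u x) ^ m"
          unfolding T3 T4 using wm by (simp add: distrib_right mult.assoc[symmetric] mult_right_mono)
        show "\<mu> * ?T3 x + ?T4 x \<le> ?c * indicator \<Omega> x + (\<bar>\<mu>\<bar> + 1) * ?h x"
        proof (cases "K < \<bar>u x\<bar>")
          case True
          have "\<bar>u x\<bar> powr q \<le> \<bar>u x\<bar> powr P" using True K(2) P_gt by (intro powr_mono) auto
          then have "\<bar>\<mu>\<bar> * \<bar>u x\<bar> powr q + \<bar>u x\<bar> powr P \<le> (\<bar>\<mu>\<bar> + 1) * \<bar>u x\<bar> powr P"
            by (simp add: distrib_right mult_left_mono)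
          then have "\<mu> * ?T3 x + ?T4 x \<le> (\<bar>\<mu>\<bar> + 1) * \<bar>u x\<bar> powr P * ?w (u x) ^ m"
            using e1 wm by (meson mult_right_mono order_trans)
          also have "\<dots> = (\<bar>\<mu>\<bar> + 1) * (\<bar>u x\<bar> powr P * ?w (u x) ^ m)" by (simp only: mult.assoc)
          also have "\<bar>u x\<bar> powr P * ?w (u x) ^ m = ?h x"
          proof -
            have u0: "0 < \<bar>u x\<bar>" using True K(2) by linarith
            have "(norm (\<Psi> (u x)) powr P) powr (p/P) = norm (\<Psi> (u x)) powr p" using P_gt by (simp add: powr_powr)
            also have "\<dots> = \<bar>u x\<bar> powr p * ?w (u x) ^ m" by (simp add: \<Psi>_def abs_mult powr_mult wp)
            finally have e: "(norm (\<Psi> (u x)) powr P) powr (p/P) = \<bar>u x\<bar> powr p * ?w (u x) ^ m" .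
            have "P * (1 - p/P) = P - p" using P_gt by (simp add: right_diff_distrib)
            then have "(\<bar>u x\<bar> powr P) powr (1 - p/P) * \<bar>u x\<bar> powr p = \<bar>u x\<bar> powr P"
              using u0 by (simp add: powr_powr powr_add[symmetric])
            then show ?thesis using True e by (simp add: mult.assoc[symmetric])
          qed
          finally have "\<mu> * ?T3 x + ?T4 x \<le> (\<bar>\<mu>\<bar> + 1) * ?h x" .
          moreover have "0 \<le> ?c * indicator \<Omega> x" by (simp add: indicator_def)
          ultimately show ?thesis by linarith
        next
          case False
          have hz: "0 \<le> (\<bar>\<mu>\<bar> + 1) * ?h x" using h0 by simp
          show ?thesis
          proof (cases "x \<in> \<Omega>")
            case True
            have a: "\<bar>u x\<bar> powr q \<le> K powr P"
            proof -
              have "\<bar>u x\<bar> powr q \<le> K powr q" using False q by (intro powr_mono2) auto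
              also have "\<dots> \<le> K powr P" using K(2) P_gt by (intro powr_mono) auto
              finally show ?thesis .
            qed
            have b': "\<bar>u x\<bar> powr P \<le> K powr P" using False P_gt by (intro powr_mono2) auto
            have "(u x)\<^sup>2 \<le> K\<^sup>2" using False K(2) by (simp add: abs_le_square_iff[symmetric])
            then have c: "?w (u x) ^ m \<le> (1 + K\<^sup>2) ^ m" using w(3)[of "u x"] w0[of "u x"] by (intro power_mono) auto
            have "\<bar>\<mu>\<bar> * \<bar>u x\<bar> powr q + \<bar>u x\<bar> powr P \<le> (\<bar>\<mu>\<bar> + 1) * K powr P"
              using a b' by (simp add: distrib_right add_mono mult_left_mono)
            then have "(\<bar>\<mu>\<bar> * \<bar>u x\<bar> powr q + \<bar>u x\<bar> powr P) * ?w (u x) ^ m \<le> (\<bar>\<mu>\<bar> + 1) * K powr P * (1 + K\<^sup>2) ^ m"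
              using c wm by (intro mult_mono) auto
            then have "\<mu> * ?T3 x + ?T4 x \<le> ?c * indicator \<Omega> x" using e1 True by simp
            then show ?thesis using hz by linarith
          next
            case False
            then have "\<mu> * ?T3 x + ?T4 x = 0" using out by simp
            then show ?thesis using False hz by simp
          qed
        qed
      qed
      also have "\<dots> = ?c * measure lebesgue \<Omega> + (\<bar>\<mu>\<bar> + 1) * (\<integral>x. ?h x \<partial>lebesgue)"
        using H(1) i\<Omega> by (subst Bochner_Integration.integral_add) auto
      also have "\<dots> \<le> D1 + (\<bar>\<mu>\<bar> + 1) * (tail K powr (1 - p/P) * X powr (p/P))"
        using H(2) unfolding D1_def by (intro add_mono mult_left_mono) auto
      finally show ?thesis .
    qed
    finally have Y1: "Y \<le> (1 + 2 * b) powr p * (D1 + (\<bar>\<mu>\<bar> + 1) * (tail K powr (1 - p/P) * X powr (p/P)))"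
      by (simp add: mult_left_mono)
    have "X powr (p/P) \<le> C powr (p/P) * ((1 + 2 * b) powr p * (D1 + (\<bar>\<mu>\<bar> + 1) * (tail K powr (1 - p/P) * X powr (p/P))))"
      using AY Y1 by (meson mult_left_mono order_trans powr_ge_zero)
    also have "\<dots> = S * D1 + S * (\<bar>\<mu>\<bar> + 1) * tail K powr (1 - p/P) * X powr (p/P)"
      by (simp add: S_def algebra_simps)
    \<comment> \<open>For fixed \<epsilon> the function lies in L^P by \<open>sob\<close>, so
      \<open>X\<close> is a genuine finite integral and half of its power can be absorbed on the
      left. The remaining bound is free of \<epsilon>.\<close>
    also have "\<dots> \<le> S * D1 + 1/2 * X powr (p/P)"
      using K(1) by (intro add_left_mono mult_right_mono) auto
    finally have "X powr (p/P) \<le> 2 * S * D1" by simp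
    then have "(X powr (p/P)) powr (P/p) \<le> D" unfolding D_def using P_gt p0 by (intro powr_mono2) auto
    then have "X \<le> D" using XY0 P_gt p0 by (simp add: powr_powr)
    then show ?thesis using sob by (simp add: X_def \<Psi>_def)
  qed
  then show ?thesis unfolding b_def by (intro exI[of _ D]) (auto simp: D_def)
qed

text \<open>Fatou's lemma as \<epsilon> tends to 0: the weight tends to 1 + u^2 \<ge> u^2, so |u
  w^b|^P is at least |u|^{P(1 + 2b)} in the limit.\<close>

lemma in_Lp_higher: "in_Lp (P * (1 + 2 * (real m / p))) u"
proof -
  have p0: "0 < p" using p1 by simp
  define b where "b = real m / p"
  have b0: "0 \<le> b" using p0 by (simp add: b_def)
  define r where "r = P * (1 + 2 * b)"
  obtain D where D: "0 \<le> D" "\<And>\<epsilon>. 0 < \<epsilon> \<Longrightarrow> \<epsilon> \<le> 1 \<Longrightarrow> in_Lp P (\<lambda>x. u x * cutoff_weight \<epsilon> (u x) powr b)"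
    "\<And>\<epsilon>. 0 < \<epsilon> \<Longrightarrow> \<epsilon> \<le> 1 \<Longrightarrow> (\<integral>x. norm (u x * cutoff_weight \<epsilon> (u x) powr b) powr P \<partial>lebesgue) \<le> D"
    using brezis_kato_uniform[of m] unfolding b_def by blast
  have um[measurable]: "u \<in> borel_measurable lebesgue" using sobolev0_in_Lp[OF W] by (auto simp: in_Lp_def)
  define e where "e k = inverse (real (Suc k))" for k
  have e: "0 < e k" "e k \<le> 1" for k by (auto simp: e_def divide_simps)
  have e0: "e \<longlonglongrightarrow> 0" unfolding e_def by (rule LIMSEQ_inverse_real_of_nat)
  define f where "f k x = norm (u x * cutoff_weight (e k) (u x) powr b) powr P" for k x
  have fm: "(\<lambda>x. ennreal (f k x)) \<in> borel_measurable lebesgue" for k unfolding f_def cutoff_weight_def by measurable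
  have "(\<integral>\<^sup>+x. ennreal (norm (u x) powr r) \<partial>lebesgue) \<le> (\<integral>\<^sup>+x. liminf (\<lambda>k. ennreal (f k x)) \<partial>lebesgue)"
  proof (rule nn_integral_mono)
    fix x
    have "(\<lambda>k. cutoff_weight (e k) (u x)) \<longlonglongrightarrow> (1 + (u x)\<^sup>2) / (1 + 0 * (u x)\<^sup>2)"
      unfolding cutoff_weight_def by (intro tendsto_intros e0) auto
    then have "(\<lambda>k. f k x) \<longlonglongrightarrow> norm (u x * (1 + (u x)\<^sup>2) powr b) powr P"
      unfolding f_def using P_gt by (intro tendsto_powr' tendsto_norm tendsto_mult tendsto_const) (auto simp: add_nonneg_eq_0_iff)
    from lim_imp_Liminf[OF _ tendsto_ennrealI[OF this]]
    have "liminf (\<lambda>k. ennreal (f k x)) = ennreal (norm (u x * (1 + (u x)\<^sup>2) powr b) powr P)" by simp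
    moreover have "norm (u x) powr r \<le> norm (u x * (1 + (u x)\<^sup>2) powr b) powr P"
    proof (cases "u x = 0")
      case False
      have "norm (u x) powr (2 * b) = (\<bar>u x\<bar> powr 2) powr b" unfolding powr_powr by simp
      also have "\<bar>u x\<bar> powr 2 = (u x)\<^sup>2" using False by simp
      also have "((u x)\<^sup>2) powr b \<le> (1 + (u x)\<^sup>2) powr b" using b0 by (intro powr_mono2) auto
      finally have "norm (u x) * norm (u x) powr (2 * b) \<le> norm (u x * (1 + (u x)\<^sup>2) powr b)"
        by (simp add: abs_mult mult_left_mono)
      then have "norm (u x) powr (1 + 2 * b) \<le> norm (u x * (1 + (u x)\<^sup>2) powr b)"
        using False by (simp add: powr_add)
      then have "(norm (u x) powr (1 + 2 * b)) powr P \<le> norm (u x * (1 + (u x)\<^sup>2) powr b) powr P"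
        using P_gt by (intro powr_mono2) auto
      then show ?thesis by (simp add: powr_powr r_def mult.commute)
    qed (use b0 P_gt in \<open>auto simp: r_def\<close>)
    ultimately show "ennreal (norm (u x) powr r) \<le> liminf (\<lambda>k. ennreal (f k x))" by (simp add: ennreal_leI)
  qed
  also have "\<dots> \<le> liminf (\<lambda>k. \<integral>\<^sup>+x. ennreal (f k x) \<partial>lebesgue)"
    by (rule nn_integral_liminf[OF fm])
  also have "\<dots> \<le> liminf (\<lambda>k. ennreal D)"
  proof (rule Liminf_mono[OF always_eventually[OF allI]])
    fix k
    have "(\<integral>\<^sup>+x. ennreal (f k x) \<partial>lebesgue) = ennreal (\<integral>x. f k x \<partial>lebesgue)"
      using D(2)[OF e, of k] by (intro nn_integral_eq_integral) (auto simp: f_def in_Lp_def)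
    then show "(\<integral>\<^sup>+x. ennreal (f k x) \<partial>lebesgue) \<le> ennreal D" using D(3)[OF e, of k] by (simp add: f_def ennreal_leI)
  qed
  also have "\<dots> = ennreal D" by (simp add: Liminf_const)
  finally have "(\<integral>\<^sup>+x. ennreal (norm (norm (u x) powr r)) \<partial>lebesgue) < \<infinity>" by (simp add: le_less_trans)
  then have "integrable lebesgue (\<lambda>x. norm (u x) powr r)" by (intro integrableI_bounded) auto
  then show ?thesis by (simp add: in_Lp_def r_def b_def)
qed

text \<open>One application with m large reaches any exponent, and boundedness of the domain gives
  the smaller ones. No iteration occurs, because the level in the Brezis-Kato step may depend on
  m.\<close>

lemma in_Lp_all:
  assumes s: "0 < s" shows "in_Lp s u"
proof -
  obtain m :: nat where m: "s * p < real m" using reals_Archimedean2 by blast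
  have "s < real m / p" using m p1 by (simp add: less_divide_eq)
  also have "\<dots> \<le> 1 * (1 + 2 * (real m / p))"
  proof -
    have "0 \<le> x \<Longrightarrow> x \<le> 1 * (1 + 2 * x)" for x :: real by simp
    from this[of "real m / p"] show ?thesis using p1 by simp
  qed
  also have "\<dots> \<le> P * (1 + 2 * (real m / p))"
    using P_gt p1 by (intro mult_right_mono) auto
  finally have "s < P * (1 + 2 * (real m / p))" .
  then show ?thesis
    using in_Lp_mono(1)[OF in_Lp_higher[of m], of \<Omega> s] W \<Omega> s by (auto simp: sobolev0_def)
qed

end

section \<open>The Pohozaev inequality\<close>

context pq_solution
begin

lemma energy_identity:
  "(\<integral>x. norm (G x) powr p \<partial>lebesgue) + (\<integral>x. norm (G x) powr q \<partial>lebesgue)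
    = \<mu> * (\<integral>x. \<bar>u x\<bar> powr q \<partial>lebesgue) + (\<integral>x. \<bar>u x\<bar> powr P \<partial>lebesgue)"
proof -
  have "\<bar>u x\<bar> powr (q-2) * u x * u x = \<bar>u x\<bar> powr q" "\<bar>u x\<bar> powr (P-2) * u x * u x = \<bar>u x\<bar> powr P" for x
    using norm_powr_minus_2(2)[OF q(1), of "u x"] norm_powr_minus_2(2)[OF P_gt(2), of "u x"] by (simp_all add: mult.assoc)
  then show ?thesis
    using weak_split[OF W] by (simp add: norm_powr_minus_2(2)[OF q(1)] norm_powr_minus_2(2)[OF p1])
qed

text \<open>A gradient vanishing almost everywhere has zero L^p norm too, and Sobolev's inequality
  does the rest. This is what makes the integral of |grad u|^q strictly positive for a nontrivial
  solution.\<close>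

lemma gradient_zero_imp_zero:
  assumes "(\<integral>x. norm (G x) powr q \<partial>lebesgue) = 0"
  shows "(\<integral>x. \<bar>u x\<bar> powr q \<partial>lebesgue) = 0"
proof -
  have p0: "0 < p" using p1 by simp
  have Gq: "in_Lp q G" using sobolev0_in_Lp(2)[OF sobolev0_q[OF W]] .
  have "AE x in lebesgue. norm (G x) powr q = 0"
    using assms Gq integral_nonneg_eq_0_iff_AE[of lebesgue "\<lambda>x. norm (G x) powr q"] by (auto simp: in_Lp_def)
  then have "AE x in lebesgue. norm (G x) powr p = 0" by eventually_elim auto
  then have "(\<integral>x. norm (G x) powr p \<partial>lebesgue) = (\<integral>x. 0 \<partial>(lebesgue::'a measure))"
    using sobolev0_in_Lp(2)[OF W] by (intro integral_cong_AE) (auto simp: in_Lp_def)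
  then have A: "(\<integral>x. norm (G x) powr p \<partial>lebesgue) = 0" by simp
  obtain \<phi>s gs where F: "\<And>k. C1c \<Omega> (\<phi>s k) (gs k)" "Lp_tendsto p \<phi>s u" "Lp_tendsto p gs G"
    by (rule sobolev0_approx[OF W p0], rule that)
  have "\<exists>C\<ge>0. in_Lp P u \<and> (\<integral>x. norm (u x) powr P \<partial>lebesgue) \<le> C * (\<integral>x. norm (G x) powr p \<partial>lebesgue) powr (P/p)"
    using sobolev_limit[OF N \<Omega>(2) p1 p] F unfolding P by blast
  then have uP: "in_Lp P u" "(\<integral>x. norm (u x) powr P \<partial>lebesgue) \<le> 0" using A by auto
  have "(\<integral>x. norm (u x) powr P \<partial>lebesgue) = 0"
  proof (rule antisym[OF uP(2)])
    show "0 \<le> (\<integral>x. norm (u x) powr P \<partial>lebesgue)" by (intro integral_nonneg_AE AE_I2) simp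
  qed
  then have "AE x in lebesgue. norm (u x) powr P = 0"
    using uP(1) integral_nonneg_eq_0_iff_AE[of lebesgue "\<lambda>x. norm (u x) powr P"] by (auto simp: in_Lp_def)
  then have "AE x in lebesgue. \<bar>u x\<bar> powr q = 0" by eventually_elim auto
  then have "(\<integral>x. \<bar>u x\<bar> powr q \<partial>lebesgue) = (\<integral>x. 0 \<partial>(lebesgue::'a measure))"
    using sobolev0_in_Lp(1)[OF sobolev0_q[OF W]] by (intro integral_cong_AE) (auto simp: in_Lp_def)
  then show ?thesis by simp
qed

text \<open>A minimizer of the Rayleigh quotient satisfies the Euler--Lagrange inequality; comparing
  \<open>u\<close> with \<open>u - t v\<close> through convexity leaves a single limit \<open>t \<rightarrow> 0\<close>.\<close>
lemma euler_lagrange: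
  assumes ray: "\<And>w K. sobolev0 \<Omega> q w K \<Longrightarrow> \<Lambda> * (\<integral>x. \<bar>w x\<bar> powr q \<partial>lebesgue) \<le> (\<integral>x. norm (K x) powr q \<partial>lebesgue)"
    and min: "\<Lambda> * (\<integral>x. \<bar>u x\<bar> powr q \<partial>lebesgue) = (\<integral>x. norm (G x) powr q \<partial>lebesgue)" and \<Lambda>: "0 \<le> \<Lambda>"
    and V: "sobolev0 \<Omega> q v H"
  shows "(\<integral>x. norm (G x) powr (q - 2) * (G x \<bullet> H x) \<partial>lebesgue) \<le> \<Lambda> * (\<integral>x. \<bar>u x\<bar> powr (q - 2) * u x * v x \<partial>lebesgue)"
proof -
  have q0: "0 < q" using q by simp
  note U = sobolev0_q[OF W]
  have Lu: "in_Lp q u" "in_Lp q G" "in_Lp q v" "in_Lp q H" using sobolev0_in_Lp U V by blast+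
  have [measurable]: "G \<in> borel_measurable lebesgue" "H \<in> borel_measurable lebesgue" using Lu by (auto simp: in_Lp_def)
  define Z where "Z = (\<integral>x. \<bar>u x\<bar> powr (q - 2) * u x * v x \<partial>lebesgue)"
  have iZ: "integrable lebesgue (\<lambda>x. \<bar>u x\<bar> powr (q - 2) * u x * v x)"
    using dual_integrable[OF q(1) Lu(1,3)] by (simp add: mult.assoc)
  define K where "K t x = G x - t *\<^sub>R H x" for t x
  define Y where "Y t = (\<integral>x. norm (K t x) powr (q - 2) * (K t x \<bullet> H x) \<partial>lebesgue)" for t
  have KL: "in_Lp q (K t)" for t unfolding K_def using q0 by (intro in_Lp_diff_scaleR Lu) auto
  have iY: "integrable lebesgue (\<lambda>x. norm (K t x) powr (q - 2) * (K t x \<bullet> H x))" for t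
    by (rule dual_integrable[OF q(1) KL Lu(4)])
  \<comment> \<open>The tangents are taken at G - t H for the gradient energy and at
    \<open>u\<close> for the power. Both inequalities then point the same way, and since
    \<open>u\<close> attains equality in the Rayleigh bound, division by q t leaves
    \<open>Y t\<close> against a quantity free of t.\<close>
  have ineq: "Y t \<le> \<Lambda> * Z" if t: "0 < t" for t
  proof -
    define w where "w x = u x - t * v x" for x
    have S: "sobolev0 \<Omega> q w (K t)" unfolding w_def K_def[abs_def] by (rule sobolev0_diff[OF U V q0])
    have wL: "in_Lp q w" using sobolev0_in_Lp(1)[OF S] .
    have "(\<integral>x. q * t * (norm (K t x) powr (q - 2) * (K t x \<bullet> H x)) \<partial>lebesgue) \<le> (\<integral>x. norm (G x) powr q - norm (K t x) powr q \<partial>lebesgue)"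
    proof (rule integral_mono)
      show "integrable lebesgue (\<lambda>x. q * t * (norm (K t x) powr (q - 2) * (K t x \<bullet> H x)))" using iY by (rule integrable_mult_right)
      show "integrable lebesgue (\<lambda>x. norm (G x) powr q - norm (K t x) powr q)" using KL Lu by (auto simp: in_Lp_def)
      fix x
      have "G x - K t x = t *\<^sub>R H x" by (simp add: K_def)
      then have "norm (K t x) powr (q - 2) * (t * (K t x \<bullet> H x)) \<le> (norm (G x) powr q - norm (K t x) powr q) / q"
        using norm_powr_convex[OF q(1), of "K t x" "G x"] by simp
      then show "q * t * (norm (K t x) powr (q - 2) * (K t x \<bullet> H x)) \<le> norm (G x) powr q - norm (K t x) powr q"
        using q0 by (simp add: le_divide_eq mult_ac)
    qed
    then have 1: "q * t * Y t \<le> (\<integral>x. norm (G x) powr q \<partial>lebesgue) - (\<integral>x. norm (K t x) powr q \<partial>lebesgue)"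
      using KL[of t] Lu by (simp add: Y_def in_Lp_def)
    have "(\<integral>x. \<bar>u x\<bar> powr q - \<bar>w x\<bar> powr q \<partial>lebesgue) \<le> (\<integral>x. q * t * (\<bar>u x\<bar> powr (q - 2) * u x * v x) \<partial>lebesgue)"
    proof (rule integral_mono)
      show "integrable lebesgue (\<lambda>x. q * t * (\<bar>u x\<bar> powr (q - 2) * u x * v x))" using iZ by (rule integrable_mult_right)
      show "integrable lebesgue (\<lambda>x. \<bar>u x\<bar> powr q - \<bar>w x\<bar> powr q)" using wL Lu by (auto simp: in_Lp_def)
      fix x
      have "w x - u x = - (t * v x)" by (simp add: w_def)
      then have "- (\<bar>u x\<bar> powr (q - 2) * (u x * (t * v x))) \<le> (\<bar>w x\<bar> powr q - \<bar>u x\<bar> powr q) / q"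
        using norm_powr_convex[OF q(1), of "u x" "w x"] by simp
      then have "- (\<bar>u x\<bar> powr (q - 2) * (u x * (t * v x))) * q \<le> \<bar>w x\<bar> powr q - \<bar>u x\<bar> powr q"
        using q0 by (simp add: le_divide_eq)
      then show "\<bar>u x\<bar> powr q - \<bar>w x\<bar> powr q \<le> q * t * (\<bar>u x\<bar> powr (q - 2) * u x * v x)"
        by (simp add: mult_ac)
    qed
    then have "(\<integral>x. \<bar>u x\<bar> powr q \<partial>lebesgue) - (\<integral>x. \<bar>w x\<bar> powr q \<partial>lebesgue) \<le> q * t * Z"
      using wL Lu by (simp add: Z_def in_Lp_def)
    then have "\<Lambda> * ((\<integral>x. \<bar>u x\<bar> powr q \<partial>lebesgue) - (\<integral>x. \<bar>w x\<bar> powr q \<partial>lebesgue)) \<le> \<Lambda> * (q * t * Z)"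
      using \<Lambda> by (rule mult_left_mono)
    then have "q * t * Y t \<le> q * t * (\<Lambda> * Z)" using 1 min ray[OF S] by (simp add: right_diff_distrib mult_ac)
    then show ?thesis using q0 t by (simp add: mult_le_cancel_left)
  qed
  define t where "t n = inverse (real (Suc n))" for n
  have t: "0 < t n" "t n \<le> 1" for n by (auto simp: t_def divide_simps)
  have t0: "t \<longlonglongrightarrow> 0" unfolding t_def by (rule LIMSEQ_inverse_real_of_nat)
  have lim: "(\<lambda>n. Y (t n)) \<longlonglongrightarrow> (\<integral>x. norm (G x) powr (q - 2) * (G x \<bullet> H x) \<partial>lebesgue)"
    unfolding Y_def
  proof (rule integral_dominated_convergence)
    show "integrable lebesgue (\<lambda>x. 2 powr q * (norm (G x) powr q + norm (H x) powr q))" using Lu by (auto simp: in_Lp_def)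
    show "AE x in lebesgue. (\<lambda>n. norm (K (t n) x) powr (q - 2) * (K (t n) x \<bullet> H x)) \<longlonglongrightarrow> norm (G x) powr (q - 2) * (G x \<bullet> H x)"
    proof (rule AE_I2)
      fix x
      have "(\<lambda>n. K (t n) x) \<longlonglongrightarrow> G x - 0 *\<^sub>R H x" unfolding K_def by (intro tendsto_intros t0)
      then have KG: "(\<lambda>n. K (t n) x) \<longlonglongrightarrow> G x" by simp
      have "isCont (\<lambda>a::'a. norm a powr (q-2) *\<^sub>R a) (G x)"
        using continuous_on_norm_powr_scaleR[OF q(1)] by (metis UNIV_I continuous_on_eq_continuous_at open_UNIV)
      from tendsto_inner[OF isCont_tendsto_compose[OF this KG] tendsto_const]
      have "(\<lambda>n. (norm (K (t n) x) powr (q-2) *\<^sub>R K (t n) x) \<bullet> H x) \<longlonglongrightarrow> (norm (G x) powr (q-2) *\<^sub>R G x) \<bullet> H x"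
        .
      then show "(\<lambda>n. norm (K (t n) x) powr (q - 2) * (K (t n) x \<bullet> H x)) \<longlonglongrightarrow> norm (G x) powr (q - 2) * (G x \<bullet> H x)" by simp
    qed
    show "AE x in lebesgue. norm (norm (K (t n) x) powr (q - 2) * (K (t n) x \<bullet> H x)) \<le> 2 powr q * (norm (G x) powr q + norm (H x) powr q)" for n
    proof (rule AE_I2)
      fix x
      let ?s = "norm (G x) + norm (H x)"
      have "norm (K (t n) x) \<le> norm (G x) + norm (t n *\<^sub>R H x)" unfolding K_def by (rule norm_triangle_ineq4)
      also have "\<dots> \<le> ?s" using t[of n] by (simp add: mult_left_le_one_le)
      finally have Ks: "norm (K (t n) x) \<le> ?s" .
      have "norm (norm (K (t n) x) powr (q - 2) * (K (t n) x \<bullet> H x)) \<le> norm (K (t n) x) powr (q - 2) * (norm (K (t n) x) * norm (H x))"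
        by (simp add: abs_mult mult_left_mono Cauchy_Schwarz_ineq2)
      also have "\<dots> = norm (K (t n) x) powr (q - 1) * norm (H x)"
        using norm_powr_minus_2(1)[OF q(1), of "K (t n) x"] by (simp add: mult.assoc[symmetric])
      also have "\<dots> \<le> ?s powr (q - 1) * ?s" using Ks q by (intro mult_mono powr_mono2) auto
      also have "\<dots> = ?s powr q" using norm_powr_minus_2(3)[OF q(1), of ?s] by simp
      also have "\<dots> \<le> 2 powr q * (norm (G x) powr q + norm (H x) powr q)"
        using norm_add_powr_le[of q "norm (G x)" "norm (H x)"] q0 by simp
      finally show "norm (norm (K (t n) x) powr (q - 2) * (K (t n) x \<bullet> H x)) \<le> 2 powr q * (norm (G x) powr q + norm (H x) powr q)" .
    qed
    show "(\<lambda>x. norm (K (t n) x) powr (q - 2) * (K (t n) x \<bullet> H x)) \<in> borel_measurable lebesgue" for n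
      using iY by auto
  qed measurable
  show ?thesis unfolding Z_def[symmetric]
    by (rule LIMSEQ_le_const2[OF lim]) (use ineq t in blast)
qed

text \<open>The tangent inequality at \<open>G\<close>, followed by the scaling law: the r-energy of
  u_l is l^{r - N} times that of \<open>u\<close>. It is used both for r = p and for r = q.\<close>

lemma dil_gradient_bound:
  assumes r: "1 < r" and Gr: "in_Lp r G" and l: "1 < l"
  shows "(\<integral>x. norm (G x) powr (r - 2) * (G x \<bullet> (l *\<^sub>R G (dil a l x) - G x)) \<partial>lebesgue)
    \<le> (l powr (r - real DIM('a)) - 1) * ((\<integral>x. norm (G x) powr r \<partial>lebesgue) / r)"
proof -
  have l0: "0 < l" and r0: "0 < r" using l r by auto
  have D: "in_Lp r (\<lambda>x. G (dil a l x))" by (rule in_Lp_dil(1)[OF Gr l0])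
  have lG: "in_Lp r (\<lambda>x. l *\<^sub>R G (dil a l x))" using r0 l0 by (intro in_Lp_scaleR[OF D, where C=l]) auto
  have dG: "in_Lp r (\<lambda>x. l *\<^sub>R G (dil a l x) - G x)" using r0 by (intro in_Lp_diff lG Gr) auto
  have e: "norm (l *\<^sub>R G (dil a l x)) powr r = l powr r * norm (G (dil a l x)) powr r" for x using l0 by (simp add: powr_mult)
  have iD: "integrable lebesgue (\<lambda>x. l powr r * norm (G (dil a l x)) powr r)"
    using D unfolding in_Lp_def by (intro integrable_mult_right) auto
  have "(\<integral>x. norm (G x) powr (r - 2) * (G x \<bullet> (l *\<^sub>R G (dil a l x) - G x)) \<partial>lebesgue)
     \<le> (\<integral>x. (l powr r * norm (G (dil a l x)) powr r - norm (G x) powr r) / r \<partial>lebesgue)"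
  proof (rule integral_mono)
    show "integrable lebesgue (\<lambda>x. norm (G x) powr (r - 2) * (G x \<bullet> (l *\<^sub>R G (dil a l x) - G x)))"
      by (rule dual_integrable[OF r Gr dG])
    show "integrable lebesgue (\<lambda>x. (l powr r * norm (G (dil a l x)) powr r - norm (G x) powr r) / r)"
      using iD Gr unfolding in_Lp_def by (intro integrable_divide Bochner_Integration.integrable_diff) auto
    show "norm (G x) powr (r - 2) * (G x \<bullet> (l *\<^sub>R G (dil a l x) - G x)) \<le> (l powr r * norm (G (dil a l x)) powr r - norm (G x) powr r) / r" for x
      using norm_powr_convex[OF r, of "G x" "l *\<^sub>R G (dil a l x)"] unfolding e by simp
  qed
  also have "\<dots> = (l powr r * (l powr (- real DIM('a)) * (\<integral>x. norm (G x) powr r \<partial>lebesgue)) - (\<integral>x. norm (G x) powr r \<partial>lebesgue)) / r"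
    using iD Gr in_Lp_dil(2)[OF Gr l0, of a] by (simp add: in_Lp_def)
  also have "\<dots> = (l powr (r - real DIM('a)) - 1) * ((\<integral>x. norm (G x) powr r \<partial>lebesgue) / r)"
    by (simp add: powr_diff powr_minus field_simps)
  finally show ?thesis .
qed

end

text \<open>The Pohozaev inequality, in a form where the \<open>q\<close>-Laplacian part may be estimated in two ways:
  by scaling, or, for a minimizer of the Rayleigh quotient, by the Euler--Lagrange inequality.\<close>
locale pq_solution_star = pq_solution \<Omega> p q \<mu> P u G
  for \<Omega> :: "'a::euclidean_space set" and p q \<mu> P u G +
  fixes a :: 'a and ls :: "nat \<Rightarrow> real"
  assumes star: "\<And>x. x \<in> \<Omega> \<Longrightarrow> closed_segment a x \<subseteq> \<Omega>"
    and ls: "\<And>k. 1 < ls k" "ls \<longlonglongrightarrow> 1" "AE x in lebesgue. (\<lambda>k. u (dil a (ls k) x)) \<longlonglongrightarrow> u x"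
begin

definition incr_u :: "nat \<Rightarrow> 'a \<Rightarrow> real" where
  "incr_u k x = u (dil a (ls k) x) - u x"

definition incr_G :: "nat \<Rightarrow> 'a \<Rightarrow> 'a" where
  "incr_G k x = ls k *\<^sub>R G (dil a (ls k) x) - G x"

lemma sobolev0_incr: "sobolev0 \<Omega> p (incr_u k) (incr_G k)"
  unfolding incr_u_def[abs_def] incr_G_def[abs_def]
  using sobolev0_diff[OF sobolev0_dil[OF W star ls(1)] W, of k 1] p1 by simp

text \<open>This is where the higher integrability is spent: for r = P the dual exponent leads to
  (P-1) p/(p-1), which exceeds P because P > p.\<close>

lemma power_limit:
  assumes r: "1 < r"
  shows "(\<lambda>k. (\<integral>x. \<bar>u x\<bar> powr (r-2) * u x * incr_u k x \<partial>lebesgue) / (ls k - 1))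
    \<longlonglongrightarrow> - real DIM('a) / r * (\<integral>x. \<bar>u x\<bar> powr r \<partial>lebesgue)"
proof -
  obtain R where R: "0 < R" "\<And>x. x \<in> \<Omega> \<Longrightarrow> dist a x \<le> R"
    using \<Omega>(2) unfolding bounded_any_center[of _ a] by (metis less_eq_real_def not_le order.trans zero_less_one)
  then have \<Omega>R: "\<Omega> \<subseteq> cball a R" by auto
  let ?s = "(r - 1) * (p/(p-1))"
  have s: "0 < ?s" using r p1 by simp
  have um: "u \<in> borel_measurable lebesgue" using in_Lp_all[OF s] by (simp add: in_Lp_def)
  have "norm (\<bar>u x\<bar> powr (r-2) * u x) powr (p/(p-1)) = norm (u x) powr ?s" for x
  proof -
    have "norm (\<bar>u x\<bar> powr (r-2) * u x) = \<bar>u x\<bar> powr (r-1)" using norm_powr_minus_2(1)[OF r, of "u x"] by (simp add: abs_mult)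
    then show ?thesis by (simp add: powr_powr)
  qed
  then have ih: "in_Lp (p/(p-1)) (\<lambda>x. \<bar>u x\<bar> powr (r-2) * u x)"
    using in_Lp_all[OF s] um unfolding in_Lp_def by simp
  show ?thesis
    using dil_power_limit[OF p1 r in_Lp_all in_Lp_all ih ls dil_diff_sobolev0[OF W \<Omega>R R(1) ls(1) p1]] p1 r
    by (simp add: incr_u_def)
qed

text \<open>In the equation tested with u_l - u the two gradient terms are needed only from above,
  whereas the source terms have exact limits. Exactness matters for the term with \<mu>, whose sign
  is arbitrary.\<close>

lemma pohozaev_inequality:
  assumes Y: "\<And>k. (\<integral>x. norm (G x) powr (q - 2) * (G x \<bullet> incr_G k x) \<partial>lebesgue) \<le> Y k"
    and lim: "(\<lambda>k. Y k / (ls k - 1)) \<longlonglongrightarrow> y"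
  shows "\<mu> * (- real DIM('a) / q * (\<integral>x. \<bar>u x\<bar> powr q \<partial>lebesgue)) - real DIM('a) / P * (\<integral>x. \<bar>u x\<bar> powr P \<partial>lebesgue) - y
    \<le> (p - real DIM('a)) * ((\<integral>x. norm (G x) powr p \<partial>lebesgue) / p)"
proof -
  let ?Zq = "\<lambda>k. \<integral>x. \<bar>u x\<bar> powr (q-2) * u x * incr_u k x \<partial>lebesgue"
  let ?ZP = "\<lambda>k. \<integral>x. \<bar>u x\<bar> powr (P-2) * u x * incr_u k x \<partial>lebesgue"
  let ?A = "(\<integral>x. norm (G x) powr p \<partial>lebesgue) / p"
  have "\<mu> * ?Zq k + ?ZP k - Y k \<le> (ls k powr (p - real DIM('a)) - 1) * ?A" for k
    using weak_split[OF sobolev0_incr[of k]] Y[of k] dil_gradient_bound[OF p1 sobolev0_in_Lp(2)[OF W] ls(1)[of k], of a]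
    unfolding incr_G_def by linarith
  then have quot: "(\<mu> * ?Zq k + ?ZP k - Y k) / (ls k - 1) \<le> (ls k powr (p - real DIM('a)) - 1) * ?A / (ls k - 1)" for k
    using ls(1)[of k] by (intro divide_right_mono) auto
  have le: "\<mu> * (?Zq k / (ls k - 1)) + ?ZP k / (ls k - 1) - Y k / (ls k - 1) \<le> (ls k powr (p - real DIM('a)) - 1) / (ls k - 1) * ?A" for k
  proof -
    have "(m * z + w - y) / d = m * (z / d) + w / d - y / d" "e * c / d = e / d * c" for m z w y d e c :: real
      by (simp_all add: add_divide_distrib diff_divide_distrib)
    then show ?thesis using quot[of k] by metis
  qed
  have "(\<lambda>k. \<mu> * (?Zq k / (ls k - 1)) + ?ZP k / (ls k - 1) - Y k / (ls k - 1)) \<longlonglongrightarrow>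
      \<mu> * (- real DIM('a) / q * (\<integral>x. \<bar>u x\<bar> powr q \<partial>lebesgue)) + (- real DIM('a) / P * (\<integral>x. \<bar>u x\<bar> powr P \<partial>lebesgue)) - y"
    by (intro tendsto_intros power_limit q(1) P_gt(2) lim)
  moreover have "(\<lambda>k. (ls k powr (p - real DIM('a)) - 1) / (ls k - 1) * ?A) \<longlonglongrightarrow> (p - real DIM('a)) * ?A"
    by (intro tendsto_intros powr_diff_quotient ls)
  ultimately have "\<mu> * (- real DIM('a) / q * (\<integral>x. \<bar>u x\<bar> powr q \<partial>lebesgue)) + (- real DIM('a) / P * (\<integral>x. \<bar>u x\<bar> powr P \<partial>lebesgue)) - y \<le> (p - real DIM('a)) * ?A"
    by (rule LIMSEQ_le) (use le in blast)
  then show ?thesis by simp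
qed

text \<open>Of \<Lambda> only the Rayleigh bound is assumed. That the bound is attained, and by
  \<open>u\<close>, results from the forced equality, so no existence theorem for eigenfunctions
  enters.\<close>

lemma solution_trivial:
  assumes ray: "\<And>w K. sobolev0 \<Omega> q w K \<Longrightarrow> \<Lambda> * (\<integral>x. \<bar>w x\<bar> powr q \<partial>lebesgue) \<le> (\<integral>x. norm (K x) powr q \<partial>lebesgue)"
    and \<mu>: "\<mu> \<le> (real DIM('a) * (p - q)) / (real DIM('a) * (p - q) + p * q) * \<Lambda>"
  shows "(\<integral>x. \<bar>u x\<bar> powr q \<partial>lebesgue) = 0"
proof (rule ccontr)
  assume nz: "(\<integral>x. \<bar>u x\<bar> powr q \<partial>lebesgue) \<noteq> 0"
  define n where "n = real DIM('a)"
  define A where "A = (\<integral>x. norm (G x) powr p \<partial>lebesgue)"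
  define B where "B = (\<integral>x. norm (G x) powr q \<partial>lebesgue)"
  define C where "C = (\<integral>x. \<bar>u x\<bar> powr q \<partial>lebesgue)"
  define D where "D = (\<integral>x. \<bar>u x\<bar> powr P \<partial>lebesgue)"
  have n: "p < n" "0 < n" "2 \<le> n" using p N p1 by (auto simp: n_def)
  have pq: "1 < p" "1 < q" "0 < p" "0 < q" "q < p" using p1 q by auto
  have C0: "0 < C" unfolding less_le using nz by (auto simp: C_def)
  have B0: "0 < B" unfolding less_le using gradient_zero_imp_zero nz by (auto simp: B_def)
  have en: "A + B = \<mu> * C + D" using energy_identity by (simp add: A_def B_def C_def D_def)
  have nP: "n / P = (n - p) / p" using n pq by (simp add: P pstar_def n_def[symmetric])
  define k where "k = n * (p - q)"
  have k: "0 < k" using n pq by (simp add: k_def)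
  have kpq: "0 < k + p * q" using k pq by (simp add: add_pos_pos)
  have "\<mu> * (k + p * q) \<le> k * \<Lambda>"
    using \<mu> kpq unfolding n_def[symmetric] k_def[symmetric] by (simp add: le_divide_eq)
  then have \<mu>C: "\<mu> * (k + p * q) * C \<le> k * (\<Lambda> * C)"
    using C0 mult_right_mono[of "\<mu> * (k + p * q)" "k * \<Lambda>" C] by (simp add: mult.assoc)
  have \<Lambda>C: "k * (\<Lambda> * C) \<le> k * B" using ray[OF sobolev0_q[OF W]] k by (simp add: B_def C_def)
  have poh1: "\<mu> * (- n / q * C) - (n - p) / p * D - (q - n) * (B / q) \<le> (p - n) * (A / p)"
  proof -
    have "(\<lambda>j. (ls j powr (q - n) - 1) * (B / q) / (ls j - 1)) \<longlonglongrightarrow> (q - n) * (B / q)"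
      using tendsto_mult[OF powr_diff_quotient[OF ls(1,2), of "q - n"] tendsto_const, of "B / q"] by (simp add: mult.commute[of q])
    then have "\<mu> * (- n / q * C) - n / P * D - (q - n) * (B / q) \<le> (p - n) * (A / p)"
      using pohozaev_inequality[of "\<lambda>j. (ls j powr (q - n) - 1) * (B / q)" "(q - n) * (B / q)"]
        dil_gradient_bound[OF q(1) sobolev0_in_Lp(2)[OF sobolev0_q[OF W]] ls(1), where a=a]
      by (simp add: incr_G_def n_def A_def B_def C_def D_def)
    then show ?thesis unfolding nP .
  qed
  have clear: "p * q * (x * (- n / q * C)) = - (p * n * x * C)" "p * q * ((n - p) / p * D) = q * (n - p) * D"
    "p * q * ((q - n) * (B / q)) = p * (q - n) * B" "p * q * ((p - n) * (A / p)) = q * (p - n) * A" for x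
    using pq by simp_all
  \<comment> \<open>With D eliminated by the energy identity the terms in A cancel; B is left with
    p(n-q) - q(n-p) = k and \<mu> C with p n - q(n-p) = k + p q. These two numbers form the
    threshold constant.\<close>
  have "k * B \<le> \<mu> * (k + p * q) * C"
  proof -
    have "p * q * (\<mu> * (- n / q * C) - (n - p) / p * D - (q - n) * (B / q)) \<le> p * q * ((p - n) * (A / p))"
      using poh1 pq by (intro mult_left_mono) auto
    then have "- (p * n * \<mu> * C) - q * (n - p) * D - p * (q - n) * B \<le> q * (p - n) * A"
      unfolding right_diff_distrib[of "p * q"] clear by linarith
    moreover have "D = A + B - \<mu> * C" using en by simp
    ultimately show ?thesis by (simp add: k_def algebra_simps)
  qed
  \<comment> \<open>The three inequalities close up to a cycle, so each of them is an
    equality.\<close>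
  then have eq: "k * (\<Lambda> * C) = k * B" "\<mu> * (k + p * q) * C = k * B" using \<mu>C \<Lambda>C by linarith+
  have min: "\<Lambda> * C = B" using eq(1) k by simp
  have \<Lambda>: "0 < \<Lambda>" using min B0 C0 by (metis zero_less_mult_pos2)
  \<comment> \<open>At equality the two values are still apart: (k + p q)(\<Lambda> - \<mu>) C = p q
    B, which is positive since \<open>u\<close> is nontrivial.\<close>
  have gap: "0 < (\<Lambda> - \<mu>) * C"
  proof -
    have "(k + p * q) * ((\<Lambda> - \<mu>) * C) = (k + p * q) * (\<Lambda> * C) - \<mu> * (k + p * q) * C" by (simp add: algebra_simps)
    also have "\<dots> = p * q * B" using eq(2) min by (simp add: algebra_simps)
    finally show ?thesis using kpq pq B0 by (metis mult_pos_pos zero_less_mult_pos)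
  qed
  \<comment> \<open>The same inequality, with the q-gradient term now bounded through the
    Euler-Lagrange inequality instead of by scaling. The net source term has coefficient \<mu> -
    \<Lambda> < 0, as in the pure p-Laplacian problem.\<close>
  have poh2: "\<mu> * (- n / q * C) - (n - p) / p * D - \<Lambda> * (- n / q * C) \<le> (p - n) * (A / p)"
  proof -
    let ?Y = "\<lambda>j. \<Lambda> * (\<integral>x. \<bar>u x\<bar> powr (q-2) * u x * incr_u j x \<partial>lebesgue)"
    have "(\<lambda>j. ?Y j / (ls j - 1)) \<longlonglongrightarrow> \<Lambda> * (- n / q * C)"
      using tendsto_mult[OF tendsto_const[of \<Lambda>] power_limit[OF q(1)]] by (simp add: n_def C_def)
    moreover have "(\<integral>x. norm (G x) powr (q - 2) * (G x \<bullet> incr_G j x) \<partial>lebesgue) \<le> ?Y j" for j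
      by (rule euler_lagrange[OF ray _ _ sobolev0_q[OF sobolev0_incr]]) (use min \<Lambda> in \<open>auto simp: B_def C_def\<close>)
    ultimately have "\<mu> * (- n / q * C) - n / P * D - \<Lambda> * (- n / q * C) \<le> (p - n) * (A / p)"
      unfolding n_def A_def C_def D_def by (rule pohozaev_inequality[rotated])
    then show ?thesis unfolding nP .
  qed
  have "p * q * (\<mu> * (- n / q * C) - (n - p) / p * D - \<Lambda> * (- n / q * C)) \<le> p * q * ((p - n) * (A / p))"
    using poh2 pq by (intro mult_left_mono) auto
  then have "- (p * n * \<mu> * C) - q * (n - p) * D + p * n * \<Lambda> * C \<le> q * (p - n) * A"
    unfolding right_diff_distrib[of "p * q"] clear by linarith
  moreover have "D = A + \<Lambda> * C - \<mu> * C" using en min by simp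
  \<comment> \<open>Eliminating D once more cancels A. The coefficient p n - q(n-p) is positive, so
    the conclusion contradicts \<open>gap\<close>.\<close>
  ultimately have "(p * n - q * (n - p)) * ((\<Lambda> - \<mu>) * C) \<le> 0" by (simp add: algebra_simps)
  moreover have "0 < p * n - q * (n - p)"
  proof -
    have "q * (n - p) < p * n" using n pq by (intro mult_strict_mono') auto
    then show ?thesis by simp
  qed
  ultimately show False using gap mult_pos_pos by (meson not_le)
qed

end

section \<open>Nonexistence\<close>

text \<open>The quotients are nonnegative, so the infimum really is a lower bound. The case of a
  vanishing denominator is separate: there \<open>w\<close> is trivial and its quotient is not in
  the set.\<close>

lemma mu1_rayleigh:
  assumes W: "sobolev0 \<Omega> q w K" and \<Omega>: "open \<Omega>" and q: "1 < q"
  shows "mu1 \<Omega> q * (\<integral>x. \<bar>w x\<bar> powr q \<partial>lebesgue) \<le> (\<integral>x. norm (K x) powr q \<partial>lebesgue)"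
proof (cases "(\<integral>x. \<bar>w x\<bar> powr q \<partial>lebesgue) = 0")
  case True
  have "0 \<le> (\<integral>x. norm (K x) powr q \<partial>lebesgue)" by (intro integral_nonneg_AE AE_I2) simp
  then show ?thesis using True by simp
next
  case False
  have out: "x \<notin> \<Omega> \<Longrightarrow> w x = 0" "x \<notin> \<Omega> \<Longrightarrow> K x = 0" for x using W by (auto simp: sobolev0_def)
  have wm: "w \<in> borel_measurable lebesgue" using sobolev0_in_Lp(1)[OF W] by (simp add: in_Lp_def)
  have pos: "0 < (\<integral>x. \<bar>w x\<bar> powr q \<partial>lebesgue)" unfolding less_le using False by auto
  have "nontrivial \<Omega> w"
    unfolding nontrivial_def
  proof
    assume "AE x in lebesgue. x \<in> \<Omega> \<longrightarrow> w x = 0"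
    then have "AE x in lebesgue. \<bar>w x\<bar> powr q = 0" by eventually_elim (use out in auto)
    then have "(\<integral>x. \<bar>w x\<bar> powr q \<partial>lebesgue) = (\<integral>x. 0 \<partial>(lebesgue :: 'a measure))"
      using wm by (intro integral_cong_AE) auto
    then show False using False by simp
  qed
  moreover have "W1p0 \<Omega> q w K" by (rule sobolev0_imp_W1p0[OF W \<Omega> q])
  moreover have "(LINT x:\<Omega>|lebesgue. norm (K x) powr q) = (\<integral>x. norm (K x) powr q \<partial>lebesgue)"
    "(LINT x:\<Omega>|lebesgue. \<bar>w x\<bar> powr q) = (\<integral>x. \<bar>w x\<bar> powr q \<partial>lebesgue)"
    by (rule set_integral_zero_ext(1), use out in simp)+
  ultimately have "(\<integral>x. norm (K x) powr q \<partial>lebesgue) / (\<integral>x. \<bar>w x\<bar> powr q \<partial>lebesgue) \<in>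
      {(LINT x:\<Omega>|lebesgue. norm (G x) powr q) / (LINT x:\<Omega>|lebesgue. \<bar>u x\<bar> powr q) | u G. W1p0 \<Omega> q u G \<and> nontrivial \<Omega> u}"
    by force
  then have "mu1 \<Omega> q \<le> (\<integral>x. norm (K x) powr q \<partial>lebesgue) / (\<integral>x. \<bar>w x\<bar> powr q \<partial>lebesgue)"
    unfolding mu1_def
  proof (rule cInf_lower)
    have "0 \<le> (LINT x:\<Omega>|lebesgue. norm (G x) powr q) / (LINT x:\<Omega>|lebesgue. \<bar>u x\<bar> powr q)" for u :: "'a \<Rightarrow> real" and G :: "'a \<Rightarrow> 'a"
      unfolding set_lebesgue_integral_def by (intro divide_nonneg_nonneg integral_nonneg_AE AE_I2) auto
    then show "bdd_below {(LINT x:\<Omega>|lebesgue. norm (G x) powr q) / (LINT x:\<Omega>|lebesgue. \<bar>u x\<bar> powr q) | u G. W1p0 \<Omega> q u G \<and> nontrivial \<Omega> u}"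
      by (intro bdd_belowI[of _ 0]) auto
  qed
  then show ?thesis using pos by (simp add: le_divide_eq)
qed

theorem theorem2p6:
  fixes \<Omega> :: "'a::euclidean_space set" and p q \<mu> :: real and u :: "'a \<Rightarrow> real"
  assumes "DIM('a) \<ge> 2"
    and "1 < q" and "q < p" and "p < real DIM('a)"
    and "open \<Omega>" and "connected \<Omega>" and "bounded \<Omega>" and "starlike \<Omega>"
    and "C1_boundary \<Omega>"
    and "\<mu> \<le> (real DIM('a) * (p - q)) / (real DIM('a) * (p - q) + p * q) * mu1 \<Omega> q"
  shows "\<not> (weak_solution \<Omega> p q \<mu> u \<and> W2p \<Omega> p u \<and> nontrivial \<Omega> u)"
proof (intro notI, elim conjE)
  assume sol: "weak_solution \<Omega> p q \<mu> u" and nt: "nontrivial \<Omega> u"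
  have p1: "1 < p" and p0: "0 < p" using assms(2,3) by auto
  obtain G where G: "W1p0 \<Omega> p u G" and weak: "\<And>v H. W1p0 \<Omega> p v H \<Longrightarrow>
      (LINT x:\<Omega>|lebesgue. norm (G x) powr (p - 2) * (G x \<bullet> H x) + norm (G x) powr (q - 2) * (G x \<bullet> H x)
          - \<mu> * (\<bar>u x\<bar> powr (q - 2) * u x * v x)
          - \<bar>u x\<bar> powr (pstar (real DIM('a)) p - 2) * u x * v x) = 0"
    using sol unfolding weak_solution_def by blast
  define u0 where "u0 = (\<lambda>x. if x \<in> \<Omega> then u x else 0)"
  define G0 where "G0 = (\<lambda>x. if x \<in> \<Omega> then G x else 0)"
  have W: "sobolev0 \<Omega> p u0 G0" unfolding u0_def G0_def by (rule W1p0_imp_sobolev0[OF G assms(5) p0])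
  interpret pq_solution \<Omega> p q \<mu> "pstar (real DIM('a)) p" u0 G0
  proof
    fix v H assume V: "sobolev0 \<Omega> p v H"
    show "(\<integral>x. norm (G0 x) powr (p - 2) * (G0 x \<bullet> H x) + norm (G0 x) powr (q - 2) * (G0 x \<bullet> H x)
          - \<mu> * (\<bar>u0 x\<bar> powr (q - 2) * u0 x * v x) - \<bar>u0 x\<bar> powr (pstar (real DIM('a)) p - 2) * u0 x * v x \<partial>lebesgue) = 0"
      unfolding weak[OF sobolev0_imp_W1p0[OF V assms(5) p1], symmetric] set_lebesgue_integral_def
      by (rule Bochner_Integration.integral_cong) (auto simp: u0_def G0_def indicator_def)
  qed (use assms W in auto)
  obtain a where a: "a \<in> \<Omega>" "\<And>x. x \<in> \<Omega> \<Longrightarrow> closed_segment a x \<subseteq> \<Omega>"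
    using assms(8) unfolding starlike_def by blast
  obtain R where R: "\<Omega> \<subseteq> cball a R" "0 < R"
  proof -
    obtain e where "\<forall>x\<in>\<Omega>. dist a x \<le> e" using assms(7) unfolding bounded_any_center[of _ a] by blast
    then have "\<Omega> \<subseteq> cball a (max e 1)" by (auto simp: le_max_iff_disj)
    then show ?thesis by (rule that) simp
  qed
  obtain ls where ls: "\<And>k. 1 < ls k" "ls \<longlonglongrightarrow> 1" "AE x in lebesgue. (\<lambda>k. u0 (dil a (ls k) x)) \<longlonglongrightarrow> u0 x"
    by (rule sobolev0_dil_seq[OF W R p1], rule that)
  interpret pq_solution_star \<Omega> p q \<mu> "pstar (real DIM('a)) p" u0 G0 a ls
    by standard (use a ls in auto)
  have "(\<integral>x. \<bar>u0 x\<bar> powr q \<partial>lebesgue) = 0"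
    by (rule solution_trivial[OF mu1_rayleigh assms(10)]) (use assms in auto)
  moreover have "in_Lp q u0" using sobolev0_in_Lp(1)[OF sobolev0_q[OF W]] .
  ultimately have "AE x in lebesgue. \<bar>u0 x\<bar> powr q = 0"
    using integral_nonneg_eq_0_iff_AE[of lebesgue "\<lambda>x. \<bar>u0 x\<bar> powr q"] by (auto simp: in_Lp_def)
  then have "AE x in lebesgue. x \<in> \<Omega> \<longrightarrow> u x = 0" by eventually_elim (auto simp: u0_def)
  then show False using nt by (simp add: nontrivial_def)
qed

end
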